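(* Let $n$ be a positive integer and let $q$ be a prime power with $q\geq n$. Then there exists an element $x\in\mathbb{F}_{q^n}$ that is simultaneously primitive and completely normal over $\mathbb{F}_q$.
   Context: $\mathbb{F}_q$ denotes the finite field with $q$ elements and $\mathbb{F}_{q^n}$ its extension of degree $n$. An element of $\mathbb{F}_{q^n}$ is called primitive if it generates the multiplicative group $\mathbb{F}_{q^n}^*$. For a positive divisor $l$ of $n$, an element $x\in\mathbb{F}_{q^n}$ is called normal over $\mathbb{F}_{q^l}$ if $\{x, x^{q^l}, x^{q^{2l}},\ldots,x^{q^{l(n/l-1)}}\}$ is an $\mathbb{F}_{q^l}$-basis of $\mathbb{F}_{q^n}$. An element of $\mathbb{F}_{q^n}$ is called completely normal over $\mathbb{F}_q$ if it is normal over $\mathbb{F}_{q^l}$ for all positive divisors $l$ of $n$. *)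

theory Defs
  imports
    "HOL-Algebra.Multiplicative_Group"
    "HOL-Algebra.Embedded_Algebras"
    "HOL-Number_Theory.Prime_Powers"
begin

text \<open>
  A finite field is unique up to isomorphism, so the field with \<open>q ^ n\<close> elements is rendered
  as an arbitrary structure \<open>R\<close> satisfying \<^locale>\<open>field\<close> whose carrier has \<open>q ^ n\<close> elements
  (\<^const>\<open>order\<close> is the cardinality of the carrier, and \<open>0\<close> if that is infinite).
\<close>

definition primitive_element :: "('a, 'b) ring_scheme \<Rightarrow> 'a \<Rightarrow> bool" where
  "primitive_element R x \<longleftrightarrow>
     x \<in> carrier (mult_of R) \<and> generate (mult_of R) {x} = carrier (mult_of R)"

text \<open>
  For \<open>R\<close> the field with \<open>q ^ n\<close> elements and \<open>l\<close> a divisor of \<open>n\<close>, the field with \<open>q ^ l\<close>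
  elements is the subfield of \<open>R\<close> of that cardinality. It exists and is unique, see
  \<open>ex1_subfield_card\<close> and \<open>subfield_of_card\<close> below.
\<close>

definition subfield_of_card :: "('a, 'b) ring_scheme \<Rightarrow> nat \<Rightarrow> 'a set" where
  "subfield_of_card R m = (THE K. subfield K R \<and> card K = m)"

text \<open>
  The conjugates are listed as a family: \<^const>\<open>ring.independent\<close> fails for lists
  with repetitions. This agrees with the reading as a set, as a set of fewer than \<open>n div l\<close>
  elements cannot be a basis of a space of dimension \<open>n div l\<close>.
\<close>

definition normal_element :: "('a, 'b) ring_scheme \<Rightarrow> nat \<Rightarrow> nat \<Rightarrow> nat \<Rightarrow> 'a \<Rightarrow> bool" where
  "normal_element R q n l x \<longleftrightarrow>
     x \<in> carrier R \<and>
     (let K = subfield_of_card R (q ^ l);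
          conjs = map (\<lambda>i. x [^]\<^bsub>R\<^esub> (q ^ (l * i))) [0..<n div l]
      in ring.independent R K conjs \<and> ring.Span R K conjs = carrier R)"

definition completely_normal_element ::
    "('a, 'b) ring_scheme \<Rightarrow> nat \<Rightarrow> nat \<Rightarrow> 'a \<Rightarrow> bool" where
  "completely_normal_element R q n x \<longleftrightarrow>
     (\<forall>l. l > 0 \<and> l dvd n \<longrightarrow> normal_element R q n l x)"


text \<open>Existence and uniqueness of the subfield with \<open>q ^ l\<close> elements.\<close>

lemma (in cring) binomial_finsum:
  assumes x: "x \<in> carrier R" and y: "y \<in> carrier R"
  shows "(x \<oplus> y) [^] (m::nat) = (\<Oplus>i\<in>{..m}. [(m choose i)] \<cdot> (x [^] i \<otimes> y [^] (m - i)))"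
proof (induction m)
  case 0
  then show ?case by simp
next
  case (Suc m)
  let ?B = "\<lambda>i. [(m choose i)] \<cdot> (x [^] i \<otimes> y [^] (m - i))"
  let ?C = "\<lambda>i. [(m choose i)] \<cdot> (x [^] i \<otimes> y [^] (Suc m - i))"
  have B: "?B \<in> {..k} \<rightarrow> carrier R" and C: "?C \<in> {..k} \<rightarrow> carrier R" for k :: nat
    using x y by auto
  have "(x \<oplus> y) [^] Suc m = (x \<oplus> y) [^] m \<otimes> x \<oplus> (x \<oplus> y) [^] m \<otimes> y"
    using x y by (simp add: r_distr)
  also have "(x \<oplus> y) [^] m \<otimes> x = (\<Oplus>i\<in>{..m}. ?B i \<otimes> x)"
    unfolding Suc.IH using x B by (simp add: finsum_ldistr)
  also have "\<dots> = (\<Oplus>i\<in>{..m}. [(m choose i)] \<cdot> (x [^] Suc i \<otimes> y [^] (m - i)))"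
    using x y by (intro finsum_cong') (auto simp: add_pow_ldistr add_pow_rdistr m_ac)
  also have "(x \<oplus> y) [^] m \<otimes> y = (\<Oplus>i\<in>{..m}. ?B i \<otimes> y)"
    unfolding Suc.IH using y B by (simp add: finsum_ldistr)
  also have "\<dots> = (\<Oplus>i\<in>{..m}. ?C i)"
    using x y by (intro finsum_cong') (auto simp: add_pow_ldistr add_pow_rdistr m_ac Suc_diff_le)
  also have "\<dots> = (\<Oplus>i\<in>{..Suc m}. ?C i)"
  proof -
    have "(\<Oplus>i\<in>{..Suc m}. ?C i) = ?C (Suc m) \<oplus> (\<Oplus>i\<in>{..m}. ?C i)"
      by (rule finsum_Suc[OF C])
    also have "?C (Suc m) = \<zero>"
      by (simp add: binomial_eq_0)
    also have "\<zero> \<oplus> (\<Oplus>i\<in>{..m}. ?C i) = (\<Oplus>i\<in>{..m}. ?C i)"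
      using C by (intro l_zero finsum_closed)
    finally show ?thesis by simp
  qed
  also have "\<dots> = (\<Oplus>i\<in>{..m}. ?C (Suc i)) \<oplus> ?C 0"
    using C by (intro finsum_Suc2) auto
  also have "(\<Oplus>i\<in>{..m}. [(m choose i)] \<cdot> (x [^] Suc i \<otimes> y [^] (m - i))) \<oplus>
      ((\<Oplus>i\<in>{..m}. ?C (Suc i)) \<oplus> ?C 0) =
      ((\<Oplus>i\<in>{..m}. [(m choose i)] \<cdot> (x [^] Suc i \<otimes> y [^] (m - i))) \<oplus>
      (\<Oplus>i\<in>{..m}. ?C (Suc i))) \<oplus> ?C 0"
    using x y by (intro a_assoc[symmetric] finsum_closed) auto
  also have "(\<Oplus>i\<in>{..m}. [(m choose i)] \<cdot> (x [^] Suc i \<otimes> y [^] (m - i))) \<oplus>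
      (\<Oplus>i\<in>{..m}. ?C (Suc i)) = (\<Oplus>i\<in>{..m}. [(m choose i)] \<cdot> (x [^] Suc i \<otimes> y [^] (m - i)) \<oplus> ?C (Suc i))"
    using x y by (intro finsum_addf[symmetric]) auto
  also have "\<dots> = (\<Oplus>i\<in>{..m}. [(Suc m choose Suc i)] \<cdot> (x [^] Suc i \<otimes> y [^] (Suc m - Suc i)))"
    using x y by (intro finsum_cong') (auto simp: add.nat_pow_mult)
  also have "\<dots> \<oplus> ?C 0 = (\<Oplus>i\<in>{..Suc m}. [(Suc m choose i)] \<cdot> (x [^] i \<otimes> y [^] (Suc m - i)))"
    using x y by (subst finsum_Suc2) auto
  finally show ?case .
qed

lemma (in cring) pow_prime_add:
  assumes x: "x \<in> carrier R" and y: "y \<in> carrier R"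
    and p: "prime (p::nat)" and char: "[p] \<cdot> \<one> = \<zero>"
  shows "(x \<oplus> y) [^] p = x [^] p \<oplus> y [^] p"
proof -
  obtain r where r: "p = Suc r" using p prime_gt_0_nat[of p] by (cases p) auto
  obtain s where s: "r = Suc s" using p r by (cases r) auto
  let ?B = "\<lambda>i. [(p choose i)] \<cdot> (x [^] i \<otimes> y [^] (p - i))"
  have B: "?B \<in> A \<rightarrow> carrier R" for A using x y by auto
  have ann: "[c] \<cdot> a = \<zero>" if pc: "p dvd c" and a: "a \<in> carrier R" for c a
  proof -
    obtain d where d: "c = p * d" using pc by blast
    have "[p] \<cdot> a = ([p] \<cdot> \<one>) \<otimes> a" using a by (simp add: add_pow_ldistr)
    then have "[p] \<cdot> a = \<zero>" using a char by simp
    moreover have "[c] \<cdot> a = [d] \<cdot> ([p] \<cdot> a)"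
      using a unfolding d by (simp add: add.nat_pow_pow)
    ultimately show ?thesis by simp
  qed
  have mid: "(\<Oplus>i\<in>{..s}. ?B (Suc i)) = \<zero>"
  proof -
    have "(\<Oplus>i\<in>{..s}. ?B (Suc i)) = (\<Oplus>i\<in>{..s}. \<zero>)"
    proof (intro finsum_cong' ann)
      fix i assume "i \<in> {..s}"
      then show "p dvd (p choose Suc i)" using p r s by (intro dvd_choose_prime) auto
    qed (use x y in auto)
    then show ?thesis by simp
  qed
  have "(x \<oplus> y) [^] p = (\<Oplus>i\<in>{..Suc r}. ?B i)"
    using binomial_finsum[OF x y, of p] r by simp
  also have "\<dots> = ?B (Suc r) \<oplus> (\<Oplus>i\<in>{..r}. ?B i)" by (rule finsum_Suc[OF B])
  also have "(\<Oplus>i\<in>{..r}. ?B i) = (\<Oplus>i\<in>{..s}. ?B (Suc i)) \<oplus> ?B 0"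
    unfolding s by (rule finsum_Suc2[OF B])
  finally show ?thesis using x y mid r by simp
qed

lemma (in domain) char_of_order:
  assumes "order R = (p::nat) ^ m" "p > 0"
  shows "[p] \<cdot> \<one> = \<zero>"
proof -
  have "[(p ^ m)] \<cdot> \<one> = \<zero>"
    using add.pow_order_eq_1[of \<one>] assms by (simp add: order_def)
  moreover have "[(p ^ j)] \<cdot> \<one> = ([p] \<cdot> \<one>) [^] j" for j :: nat
  proof (induction j)
    case (Suc j)
    have "[(p ^ Suc j)] \<cdot> \<one> = [p] \<cdot> ([(p ^ j)] \<cdot> \<one>)"
      by (simp add: add.nat_pow_pow mult.commute)
    also have "\<dots> = ([(p ^ j)] \<cdot> \<one>) \<otimes> ([p] \<cdot> \<one>)"
      by (simp add: add_pow_rdistr)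
    finally show ?case using Suc by simp
  qed (simp)
  ultimately have "([p] \<cdot> \<one>) [^] m = \<zero>" by simp
  moreover have "a [^] m = \<zero> \<Longrightarrow> a = \<zero>" if "a \<in> carrier R" for a
    by (induction m) (use that integral in auto)
  ultimately show ?thesis by simp
qed

lemma (in field) ex1_subfield_card:
  assumes q: "primepow q" and R: "order R = q ^ n" and n: "n > 0" and l: "l dvd n"
  shows "\<exists>!K. subfield K R \<and> card K = q ^ l"
proof -
  obtain p k where p: "prime p" and k: "k > 0" and qp: "q = p ^ k"
    using q by (auto simp: primepow_def)
  define Q where "Q = q ^ l"
  have l0: "l > 0" using l n by (auto intro: Nat.gr0I)
  have q1: "q > 1" using primepow_gt_Suc_0[OF q] by simp
  have Q1: "Q > 1" unfolding Q_def using q1 l0 by (rule one_less_power)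
  have fin: "finite (carrier R)"
    using R q1 by (intro card_ge_0_finite) (simp add: order_def)
  have ch: "[p] \<cdot> \<one> = \<zero>"
    using char_of_order[of p "k * n"] R p prime_gt_0_nat qp by (simp add: power_mult)
  have frob: "(x \<oplus> y) [^] (p ^ j) = x [^] (p ^ j) \<oplus> y [^] (p ^ j)"
    if "x \<in> carrier R" "y \<in> carrier R" for x y and j :: nat
  proof (induction j)
    case (Suc j)
    have "(x \<oplus> y) [^] (p ^ Suc j) = ((x \<oplus> y) [^] (p ^ j)) [^] p"
      using that by (simp add: nat_pow_pow mult.commute)
    also have "\<dots> = (x [^] (p ^ j)) [^] p \<oplus> (y [^] (p ^ j)) [^] p"
      using that p ch by (simp add: Suc pow_prime_add)
    finally show ?case using that by (simp add: nat_pow_pow mult.commute)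
  qed (use that in simp)
  have add: "(x \<oplus> y) [^] Q = x [^] Q \<oplus> y [^] Q" if "x \<in> carrier R" "y \<in> carrier R" for x y
    using frob[OF that, of "k * l"] by (simp add: Q_def qp power_mult)
  define S where "S = {x \<in> carrier R. x [^] Q = x}"
  have finS: "finite S" unfolding S_def using fin by simp
  have zpow: "\<zero> [^] Q = \<zero>" using Q1 by (simp add: nat_pow_zero)
  have S_split: "S = insert \<zero> {x \<in> carrier R. x [^] (Q - 1) = \<one>}"
  proof -
    have "x [^] Q = x \<longleftrightarrow> x = \<zero> \<or> x [^] (Q - 1) = \<one>" if x: "x \<in> carrier R" for x
    proof -
      obtain r where r: "Q = Suc r" using Q1 by (cases Q) auto
      show ?thesis
      proof (cases "x = \<zero>")
        case True then show ?thesis using zpow by simp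
      next
        case False
        have "x [^] r \<otimes> x = \<one> \<otimes> x \<longleftrightarrow> x [^] r = \<one>"
          using x False by (intro m_rcancel) auto
        then show ?thesis using x False r by simp
      qed
    qed
    then show ?thesis unfolding S_def using zpow by auto
  qed
  have le: "card S \<le> Q"
  proof -
    have "card S \<le> Suc (card {x \<in> carrier R. x [^] (Q - 1) = \<one>})"
      unfolding S_split by (rule card_insert_le_m1) auto
    also have "\<dots> \<le> Suc (Q - 1)"
      using num_roots_le_deg[OF fin, of "Q - 1"] Q1 by simp
    finally show ?thesis using Q1 by simp
  qed
  interpret G: group "mult_of R" by (rule field_mult_group)
  have ge: "card S \<ge> Q"
  proof -
    obtain a where a: "a \<in> carrier (mult_of R)"
      and gen: "carrier (mult_of R) = {a [^] i | i::nat. i \<in> UNIV}"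
      using finite_field_mult_group_has_gen[OF fin] by blast
    have finM: "finite (carrier (mult_of R))" using finite_mult_of[OF fin] .
    have "generate (mult_of R) {a} = carrier (mult_of R)"
      using G.generate_pow_on_finite_carrier[OF finM a] gen by (simp add: nat_pow_mult_of)
    then have "G.ord a = card (carrier (mult_of R))"
      using G.generate_pow_card[OF a] by simp
    then have orda: "G.ord a = q ^ n - 1"
      using order_mult_of[OF fin] R by (simp add: order_def)
    obtain m where m: "n = l * m" using l by blast
    have "Q - 1 dvd q ^ n - 1"
    proof -
      have "Q - 1 dvd Q ^ m - 1"
      proof (induction m)
        case (Suc m)
        have "Q ^ Suc m - 1 = (Q ^ m - 1) * Q + (Q - 1)"
          using Q1 by (simp add: algebra_simps)
        then show ?case using Suc by simp
      qed simp
      then show ?thesis by (simp add: m Q_def power_mult)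
    qed
    then obtain c where c: "q ^ n - 1 = (Q - 1) * c" by blast
    have qn: "q ^ n > 1" using q1 n by (rule one_less_power)
    have c0: "c > 0" using c qn by (cases c) auto
    have inj: "inj_on (\<lambda>j. a [^] (c * j)) {..<Q - 1}"
    proof -
      have "inj_on ((\<lambda>i::nat. a [^] i) \<circ> (\<lambda>j. c * j)) {..<Q - 1}"
      proof (rule comp_inj_on)
        show "inj_on ((*) c) {..<Q - 1}" using c0 by (auto intro: inj_onI)
        have "(*) c ` {..<Q - 1} \<subseteq> {0..G.ord a - 1}"
        proof
          fix i assume "i \<in> (*) c ` {..<Q - 1}"
          then obtain j where j: "j < Q - 1" "i = c * j" by blast
          then have "i < c * (Q - 1)" using c0 by simp
          then have "i < G.ord a" unfolding orda c by (simp add: mult.commute)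
          then show "i \<in> {0..G.ord a - 1}" by auto
        qed
        then show "inj_on (\<lambda>i::nat. a [^] i) ((*) c ` {..<Q - 1})"
          using G.ord_inj[OF a] by (auto simp: nat_pow_mult_of intro: inj_on_subset)
      qed
      then show ?thesis by (simp add: comp_def)
    qed
    have aR: "a \<in> carrier R" "a \<noteq> \<zero>" using a by auto
    have one: "a [^] (q ^ n - 1) = \<one>"
      using G.pow_ord_eq_1[OF a] by (simp add: orda nat_pow_mult_of)
    have sub: "(\<lambda>j. a [^] (c * j)) ` {..<Q - 1} \<subseteq> {x \<in> carrier R. x [^] (Q - 1) = \<one>}"
    proof safe
      fix j
      have "(a [^] (c * j)) [^] (Q - 1) = (a [^] ((Q - 1) * c)) [^] j"
        using aR by (simp add: nat_pow_pow mult_ac)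
      then show "(a [^] (c * j)) [^] (Q - 1) = \<one>"
        unfolding c[symmetric] one by simp
    qed (use aR in simp)
    have "Q - 1 \<le> card {x \<in> carrier R. x [^] (Q - 1) = \<one>}"
      using card_mono[OF _ sub] fin card_image[OF inj] by simp
    moreover have "\<zero> \<notin> {x \<in> carrier R. x [^] (Q - 1) = \<one>}"
      using Q1 by (simp add: nat_pow_zero)
    ultimately show ?thesis unfolding S_split using fin by simp
  qed
  have card: "card S = Q" using le ge by simp
  have sf: "subfield S R"
  proof (rule subfieldI')
    show "subring S R"
    proof (rule subringI)
      fix h assume h: "h \<in> S"
      then have hR: "h \<in> carrier R" "h [^] Q = h" by (auto simp: S_def)
      have "(\<ominus> h) [^] Q \<oplus> h = \<zero>"
        using add[of "\<ominus> h" h] hR zpow by (simp add: l_neg)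
      then have "\<ominus> h = (\<ominus> h) [^] Q"
        using hR by (intro minus_equality) auto
      then show "\<ominus> h \<in> S" using hR by (simp add: S_def)
    qed (use add in \<open>auto simp: S_def nat_pow_distrib\<close>)
    fix h assume "h \<in> S - {\<zero>}"
    then have h: "h \<in> Units R" "h [^] Q = h" "h \<in> carrier R" by (auto simp: S_def field_Units)
    have "(inv h) [^] Q \<otimes> h = (inv h) [^] Q \<otimes> h [^] Q" using h by simp
    also have "\<dots> = (inv h \<otimes> h) [^] Q" using h by (intro nat_pow_distrib[symmetric]) auto
    also have "\<dots> = \<one>" using h by simp
    finally have "inv h = (inv h) [^] Q" using h by (intro inv_char) (auto simp: m_comm)
    then show "inv h \<in> S" using h by (simp add: S_def)
  qed
  show ?thesis
  proof (rule ex1I[of _ S])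
    show "subfield S R \<and> card S = q ^ l" using sf card by (simp add: Q_def)
    fix K assume K: "subfield K R \<and> card K = q ^ l"
    then have KR: "K \<subseteq> carrier R" and zK: "\<zero> \<in> K" and cK: "card K = Q"
      using subfieldE(3) subringE(2)[OF subfieldE(1)] by (auto simp: Q_def)
    interpret KG: group "mult_of R \<lparr> carrier := K - {\<zero>} \<rparr>"
      using G.subgroup_imp_group subgroup_mult_of K by blast
    have "x \<in> S" if x: "x \<in> K" for x
    proof (cases "x = \<zero>")
      case False
      have "x [^]\<^bsub>mult_of R \<lparr> carrier := K - {\<zero>} \<rparr>\<^esub> order (mult_of R \<lparr> carrier := K - {\<zero>} \<rparr>)
          = \<one>\<^bsub>mult_of R \<lparr> carrier := K - {\<zero>} \<rparr>\<^esub>"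
        using x False by (intro KG.pow_order_eq_1) simp
      moreover have "order (mult_of R \<lparr> carrier := K - {\<zero>} \<rparr>) = Q - 1"
        using cK zK by (simp add: order_def card_Diff_singleton)
      ultimately have "x [^] (Q - 1) = \<one>"
        by (simp add: nat_pow_consistent[symmetric] G.nat_pow_consistent[symmetric] nat_pow_mult_of)
      then show ?thesis unfolding S_split using KR x by auto
    qed (simp add: S_split)
    then have "K \<subseteq> S" by blast
    then show "K = S" using finS cK card by (simp add: card_subset_eq)
  qed
qed

lemma (in field) subfield_of_card:
  assumes "primepow q" "order R = q ^ n" "n > 0" "l dvd n"
  shows "subfield (subfield_of_card R (q ^ l)) R" "card (subfield_of_card R (q ^ l)) = q ^ l"
  using theI'[OF ex1_subfield_card[OF assms]] by (simp_all add: subfield_of_card_def)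

end

theory Submission
  imports "HOL-Algebra.Algebraic_Closure" Defs "HOL-Number_Theory.Number_Theory" Complex_Main
begin

text \<open>
  Write \<open>K\<^sub>l\<close> for the subfield with \<open>q ^ l\<close> elements. By discrete Fourier analysis (after a reduction
  to the part of \<open>n / l\<close> prime to the characteristic), \<open>x\<close> fails to be normal over \<open>K\<^sub>l\<close> iff one of at most
  \<open>n / l\<close> resolvents vanishes, each of which cuts out a proper \<open>K\<^sub>l\<close>-subspace, contained in a
  \<open>K\<^sub>l\<close>-hyperplane. Hyperplanes behave like difference sets: a nontrivial multiplicative character has
  sum at most \<open>sqrt (q ^ n)\<close> over such a hyperplane. Hence the elements that are residues for no prime
  dividing \<open>M = (q ^ n - 1) / (q - 1)\<close> are equidistributed over it, and a union bound produces such an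
  element outside all hyperplanes as soon as \<open>2 ^ \<omega>(M)\<close> times the number of hyperplanes is less than
  \<open>sqrt (q ^ n) * (1 - \<Sum>l. (n / l) / q ^ l)\<close>; a scalar multiple of it is primitive. If the part of \<open>n\<close>
  prime to the characteristic divides \<open>q - 1\<close>, then only \<open>l = 1\<close> is needed. With
  \<open>2 ^ \<omega>(M) \<le> 4.87 M powr (1 / 4)\<close> this covers all \<open>q \<ge> n > 2\<close> except finitely many pairs, of which
  only \<open>(q, n) = (4, 3), (5, 4), (7, 6)\<close> resist the actual value of \<open>\<omega>(M)\<close>. There \<open>n = q - 1\<close>, and in
  the Kummer extension generated by \<open>t\<close> with \<open>t ^ n = c\<close> a scalar multiple of \<open>1 / (t - 1)\<close> works.
\<close>

hide_const (open) Ring_Divisibility.mult_of Divisibility.prime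
hide_fact (open) Ring_Divisibility.nat_pow_mult_of

subsection \<open>Power sums and sequences over a commutative ring\<close>

text \<open>A resolvent takes values in an extension field, so its kernel may have codimension above
  one; enlarging it to a hyperplane gives one size and one bound for all kernels of a level. The
  bound needs no Gauss sums: the squared modulus of the character sum is a sum over quotients
  \<open>b = x / y\<close>, and the number of pairs in the hyperplane with quotient \<open>b\<close>
  takes one value for \<open>b\<close> in \<open>K\<^sub>l\<close> and another one outside. Only
  primes dividing \<open>M\<close> are sieved because a ground field factor repairs all others, and
  such a factor changes none of the normality conditions. The hypothesis \<open>q >= n\<close>
  enters through the sum of \<open>(n / l) / q ^ l\<close>, whose first term is already
  \<open>n / q\<close>. From \<open>q >= n + 2\<close> on a margin of order \<open>1 / q\<close>
  remains; for \<open>n = q\<close> and \<open>n = q - 1\<close> the part of \<open>n\<close> prime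
  to the characteristic divides \<open>q - 1\<close>, so level one is enough. The constant 4.87
  bounds the fourth root of \<open>16 ^ 6 / 30030\<close>, with 30030 the product of the primes
  below 16. In degree 2 the sieve is too weak, but there a generator is normal by a direct
  computation.\<close>

lemma (in abelian_monoid) finsum_swap:
  assumes "finite A" "finite B" "\<And>i j. i \<in> A \<Longrightarrow> j \<in> B \<Longrightarrow> f i j \<in> carrier G"
  shows "(\<Oplus>i\<in>A. \<Oplus>j\<in>B. f i j) = (\<Oplus>j\<in>B. \<Oplus>i\<in>A. f i j)"
  using assms(1,3)
proof (induction A rule: finite_induct)
  case (insert a A)
  have "(\<Oplus>i\<in>insert a A. \<Oplus>j\<in>B. f i j) = (\<Oplus>j\<in>B. f a j) \<oplus> (\<Oplus>j\<in>B. \<Oplus>i\<in>A. f i j)"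
    using insert by (subst finsum_insert) (auto intro!: finsum_closed)
  also have "\<dots> = (\<Oplus>j\<in>B. f a j \<oplus> (\<Oplus>i\<in>A. f i j))"
    using insert by (intro finsum_addf[symmetric]) (auto intro!: finsum_closed)
  also have "\<dots> = (\<Oplus>j\<in>B. \<Oplus>i\<in>insert a A. f i j)"
    using insert by (intro finsum_cong') (auto intro!: finsum_closed)
  finally show ?case .
qed (use assms in simp)

lemma (in abelian_group) finsum_diff:
  assumes "f \<in> A \<rightarrow> carrier G" "g \<in> A \<rightarrow> carrier G"
  shows "(\<Oplus>i\<in>A. f i \<ominus> g i) = (\<Oplus>i\<in>A. f i) \<ominus> (\<Oplus>i\<in>A. g i)"
proof -
  have zz: "\<zero> \<ominus> \<zero> = \<zero>" using r_neg[OF zero_closed] by (simp only: minus_eq)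
  from assms show ?thesis
  proof (induction A rule: infinite_finite_induct)
    case (insert a A)
    have c: "(\<Oplus>i\<in>A. f i) \<in> carrier G" "(\<Oplus>i\<in>A. g i) \<in> carrier G" "f a \<in> carrier G" "g a \<in> carrier G"
      using insert by (auto intro!: finsum_closed)
    have "(\<Oplus>i\<in>insert a A. f i \<ominus> g i) = (f a \<ominus> g a) \<oplus> ((\<Oplus>i\<in>A. f i) \<ominus> (\<Oplus>i\<in>A. g i))"
      using insert by (subst finsum_insert) auto
    also have "\<dots> = (f a \<oplus> (\<Oplus>i\<in>A. f i)) \<ominus> (g a \<oplus> (\<Oplus>i\<in>A. g i))"
      using c by (simp add: minus_eq minus_add a_ac)
    also have "\<dots> = (\<Oplus>i\<in>insert a A. f i) \<ominus> (\<Oplus>i\<in>insert a A. g i)"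
      using insert by (subst (1 2) finsum_insert) auto
    finally show ?case .
  qed (simp_all add: zz)
qed

lemma (in cring) pow_prime_power_add:
  assumes "x \<in> carrier R" "y \<in> carrier R" "prime (p::nat)" "[p] \<cdot> \<one> = \<zero>"
  shows "(x \<oplus> y) [^] (p ^ j) = x [^] (p ^ j) \<oplus> y [^] (p ^ j)"
proof (induction j)
  case (Suc j)
  have "(x \<oplus> y) [^] (p ^ Suc j) = ((x \<oplus> y) [^] (p ^ j)) [^] p"
    using assms by (simp add: nat_pow_pow mult.commute)
  also have "\<dots> = (x [^] (p ^ j)) [^] p \<oplus> (y [^] (p ^ j)) [^] p"
    using assms by (simp add: Suc pow_prime_add)
  finally show ?case using assms by (simp add: nat_pow_pow mult.commute)
qed (use assms in simp)

lemma (in cring) finsum_pow_prime_power: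
  assumes "finite A" "f \<in> A \<rightarrow> carrier R" "prime (p::nat)" "[p] \<cdot> \<one> = \<zero>"
  shows "(\<Oplus>i\<in>A. f i) [^] (p ^ j) = (\<Oplus>i\<in>A. f i [^] (p ^ j))"
  using assms(1,2)
proof (induction A rule: finite_induct)
  case empty
  then show ?case using prime_gt_0_nat[OF assms(3)] by (simp add: nat_pow_zero)
next
  case (insert a A)
  then have "(\<Oplus>i\<in>insert a A. f i) [^] (p ^ j) = (f a \<oplus> (\<Oplus>i\<in>A. f i)) [^] (p ^ j)"
    by (subst finsum_insert) auto
  also have "\<dots> = f a [^] (p ^ j) \<oplus> (\<Oplus>i\<in>A. f i) [^] (p ^ j)"
    using insert assms by (intro pow_prime_power_add) auto
  also have "\<dots> = (\<Oplus>i\<in>insert a A. f i [^] (p ^ j))"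
    using insert by (subst finsum_insert) auto
  finally show ?case .
qed

lemma (in cring) nat_add_pow_char:
  assumes "[p] \<cdot> \<one> = \<zero>" "p dvd m" "x \<in> carrier R"
  shows "[(m::nat)] \<cdot> x = \<zero>"
proof -
  obtain d where d: "m = p * d" using assms(2) by blast
  have "[p] \<cdot> x = ([p] \<cdot> \<one>) \<otimes> x" using assms(3) by (simp add: add_pow_ldistr)
  then have "[p] \<cdot> x = \<zero>" using assms by simp
  moreover have "[m] \<cdot> x = [d] \<cdot> ([p] \<cdot> x)"
    using assms unfolding d by (simp add: add.nat_pow_pow)
  ultimately show ?thesis by simp
qed

lemma (in domain) nat_pow_eq_zero_iff:
  assumes "x \<in> carrier R"
  shows "x [^] (m::nat) = \<zero> \<Longrightarrow> x = \<zero>"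
  by (induction m) (use assms integral in auto)

section \<open>Finite differences of sequences\<close>

definition (in ring) shift_diff :: "nat \<Rightarrow> (nat \<Rightarrow> 'a) \<Rightarrow> nat \<Rightarrow> 'a" where
  "shift_diff s c i = c (i + s) \<ominus> c i"

lemma (in ring) shift_diff_funpow_closed:
  assumes "\<And>i. c i \<in> carrier R"
  shows "(shift_diff s ^^ j) c i \<in> carrier R"
  by (induction j arbitrary: i) (use assms in \<open>auto simp: shift_diff_def\<close>)

text \<open>With \<open>T\<close> the shift, \<open>shift_diff s\<close> is
  \<open>T ^ s - 1\<close>, and the formula is the binomial expansion of
  \<open>T ^ (k * s) = (1 + (T ^ s - 1)) ^ k\<close>. The induction step is Pascal's rule.\<close>

lemma (in ring) newton_forward:
  assumes c: "\<And>i. c i \<in> carrier R"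
  shows "c (i + k * s) = (\<Oplus>j\<in>{..k}. [(k choose j)] \<cdot> (shift_diff s ^^ j) c i)"
proof (induction k arbitrary: i)
  case 0
  then show ?case using c by simp
next
  case (Suc k)
  define D where "D j i = (shift_diff s ^^ j) c i" for j i
  have D: "D j i \<in> carrier R" for j i
    unfolding D_def using shift_diff_funpow_closed c by blast
  have D0: "D 0 i = c i" for i by (simp add: D_def)
  have step: "D j (i + s) = D j i \<oplus> D (Suc j) i" for j
    using D[of j "i + s"] D[of j i] a_lcomm[of "D j i" "D j (i + s)" "\<ominus> D j i"]
    by (simp add: D_def shift_diff_def minus_eq r_neg)
  have "c (i + Suc k * s) = c ((i + s) + k * s)" by (simp add: algebra_simps)
  also have "\<dots> = (\<Oplus>j\<in>{..k}. [(k choose j)] \<cdot> D j (i + s))" unfolding D_def by (rule Suc.IH)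
  also have "\<dots> = (\<Oplus>j\<in>{..k}. [(k choose j)] \<cdot> D j i \<oplus> [(k choose j)] \<cdot> D (Suc j) i)"
    using D by (intro finsum_cong') (auto simp: step add.nat_pow_distrib)
  also have "\<dots> = (\<Oplus>j\<in>{..k}. [(k choose j)] \<cdot> D j i) \<oplus> (\<Oplus>j\<in>{..k}. [(k choose j)] \<cdot> D (Suc j) i)"
    using D by (intro finsum_addf) auto
  also have "(\<Oplus>j\<in>{..k}. [(k choose j)] \<cdot> D j i) = (\<Oplus>j\<in>{..Suc k}. [(k choose j)] \<cdot> D j i)"
    using D by (subst finsum_Suc) (auto intro!: finsum_closed simp: binomial_eq_0)
  also have "\<dots> = (\<Oplus>j\<in>{..k}. [(k choose Suc j)] \<cdot> D (Suc j) i) \<oplus> D 0 i"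
    using D c by (subst finsum_Suc2) (auto simp: D0)
  also have "\<dots> \<oplus> (\<Oplus>j\<in>{..k}. [(k choose j)] \<cdot> D (Suc j) i) =
     ((\<Oplus>j\<in>{..k}. [(k choose j)] \<cdot> D (Suc j) i) \<oplus> (\<Oplus>j\<in>{..k}. [(k choose Suc j)] \<cdot> D (Suc j) i)) \<oplus> D 0 i"
  proof -
    have "(\<Oplus>j\<in>{..k}. [(k choose j)] \<cdot> D (Suc j) i) \<in> carrier R"
      "(\<Oplus>j\<in>{..k}. [(k choose Suc j)] \<cdot> D (Suc j) i) \<in> carrier R" "D 0 i \<in> carrier R"
      using D by (auto intro!: finsum_closed)
    then show ?thesis by (simp add: a_ac)
  qed
  also have "(\<Oplus>j\<in>{..k}. [(k choose j)] \<cdot> D (Suc j) i) \<oplus> (\<Oplus>j\<in>{..k}. [(k choose Suc j)] \<cdot> D (Suc j) i)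
      = (\<Oplus>j\<in>{..k}. [(k choose j)] \<cdot> D (Suc j) i \<oplus> [(k choose Suc j)] \<cdot> D (Suc j) i)"
    using D by (intro finsum_addf[symmetric]) (auto)
  also have "\<dots> = (\<Oplus>j\<in>{..k}. [(Suc k choose Suc j)] \<cdot> D (Suc j) i)"
    using D by (intro finsum_cong') (auto simp: add.nat_pow_mult)
  also have "\<dots> \<oplus> D 0 i = (\<Oplus>j\<in>{..Suc k}. [(Suc k choose j)] \<cdot> D j i)"
    using D c by (subst finsum_Suc2) (auto simp: D0)
  finally show ?case unfolding D_def .
qed

text \<open>The middle binomial coefficients in Newton's formula are divisible by \<open>p\<close>,
  so \<open>(T ^ s - 1) ^ p = T ^ (p * s) - 1\<close>. This vanishes on sequences of period
  \<open>p * s\<close>.\<close>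

lemma (in cring) shift_diff_funpow_prime:
  assumes c: "\<And>i. c i \<in> carrier R" and p: "prime (p::nat)" and ch: "[p] \<cdot> \<one> = \<zero>"
  shows "(shift_diff s ^^ p) c i = c (i + p * s) \<ominus> c i"
proof -
  define D where "D j i = (shift_diff s ^^ j) c i" for j i
  have D: "D j i \<in> carrier R" for j i
    unfolding D_def using shift_diff_funpow_closed c by blast
  have D0: "D 0 i = c i" for i by (simp add: D_def)
  obtain r where r: "p = Suc r" using p prime_gt_0_nat[of p] by (cases p) auto
  obtain t where t: "r = Suc t" using p r by (cases r) auto
  let ?F = "\<lambda>j. [(p choose j)] \<cdot> D j i"
  have F: "?F \<in> A \<rightarrow> carrier R" for A using D by auto
  have "(\<Oplus>j\<in>{..t}. ?F (Suc j)) = (\<Oplus>j\<in>{..t}. \<zero>)"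
  proof (intro finsum_cong' nat_add_pow_char[OF ch] D)
    fix j assume "j \<in> {..t}"
    then show "p dvd (p choose Suc j)" using p r t by (intro dvd_choose_prime) auto
  qed auto
  then have mid: "(\<Oplus>j\<in>{..t}. ?F (Suc j)) = \<zero>" by simp
  have "c (i + p * s) = (\<Oplus>j\<in>{..Suc r}. ?F j)"
    using newton_forward[where c=c and k=p and s=s and i=i] c r by (simp add: D_def)
  also have "\<dots> = ?F (Suc r) \<oplus> (\<Oplus>j\<in>{..r}. ?F j)" by (rule finsum_Suc[OF F])
  also have "(\<Oplus>j\<in>{..r}. ?F j) = (\<Oplus>j\<in>{..t}. ?F (Suc j)) \<oplus> ?F 0"
    unfolding t by (rule finsum_Suc2[OF F])
  also have "\<dots> = c i" using c by (simp add: mid D0)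
  finally have "c (i + p * s) = D p i \<oplus> c i" using D[of p i] r by simp
  then show ?thesis unfolding D_def[symmetric] using D[of p i] c[of i] by (simp add: minus_eq a_assoc r_neg)
qed

text \<open>
  A shift-invariant property that holds for a nonzero sequence of period \<open>N p\<^sup>a\<close> also holds for one
  of period \<open>N\<close>: in characteristic \<open>p\<close> the operator \<open>T\<^sup>s - 1\<close> is nilpotent on sequences of period
  \<open>p s\<close>, so the last nonzero iterate has period \<open>s\<close>.
\<close>

lemma (in cring) prime_power_period_reduction:
  assumes p: "prime (p::nat)" and ch: "[p] \<cdot> \<one> = \<zero>"
    and P: "\<And>c s. P c \<Longrightarrow> P (shift_diff s c)"
    and Pc: "\<And>c i. P c \<Longrightarrow> c i \<in> carrier R"
    and "P c" "\<And>i. c (i + N * p ^ a) = c i" "c i0 \<noteq> \<zero>"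
  shows "\<exists>w i. P w \<and> (\<forall>i. w (i + N) = w i) \<and> w i \<noteq> \<zero>"
  using assms(5-7)
proof (induction a arbitrary: c i0)
  case 0
  then show ?case by auto
next
  case (Suc a)
  define s where "s = N * p ^ a"
  let ?D = "\<lambda>j. (shift_diff s ^^ j) c"
  have PD: "P (?D j)" for j by (induction j) (use Suc.prems P in auto)
  have "?D p i = \<zero>" for i
  proof -
    have "?D p i = c (i + p * s) \<ominus> c i"
      using shift_diff_funpow_prime[of c p s i] p ch Pc[OF Suc.prems(1)] by simp
    also have "p * s = N * p ^ Suc a" by (simp add: s_def)
    finally show ?thesis using Suc.prems(2)[of i] Pc[OF Suc.prems(1)] by (simp add: r_right_minus_eq)
  qed
  then have ex: "\<exists>j. \<forall>i. ?D j i = \<zero>" by blast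
  define j where "j = (LEAST j. \<forall>i. ?D j i = \<zero>)"
  have j: "\<forall>i. ?D j i = \<zero>" unfolding j_def by (rule LeastI_ex[OF ex])
  have "j \<noteq> 0" using j Suc.prems(3) by (intro notI) auto
  then obtain j' where j': "j = Suc j'" by (cases j) auto
  have "\<not> (\<forall>i. ?D j' i = \<zero>)" using not_less_Least[of j' "\<lambda>j. \<forall>i. ?D j i = \<zero>"] j'
    unfolding j_def by auto
  then obtain i1 where i1: "?D j' i1 \<noteq> \<zero>" by blast
  have "?D j' (i + s) = ?D j' i" for i
  proof -
    have "?D j' (i + s) \<ominus> ?D j' i = \<zero>" using j unfolding j' by (auto simp: shift_diff_def)
    then show ?thesis using Pc[OF PD] by (simp add: r_right_minus_eq)
  qed
  then show ?case using Suc.IH[OF PD _ i1] unfolding s_def by blast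
qed

section \<open>Sums over initial segments and over periods\<close>

lemma (in abelian_monoid) finsum_lessThan_Suc:
  assumes "\<And>i. f i \<in> carrier G"
  shows "(\<Oplus>i\<in>{..<Suc m}. f i) = f m \<oplus> (\<Oplus>i\<in>{..<m}. f i)"
  using assms by (simp add: lessThan_Suc)

lemma (in abelian_monoid) finsum_lessThan_add:
  fixes m k :: nat
  assumes f: "\<And>i. f i \<in> carrier G"
  shows "(\<Oplus>i\<in>{..<m + k}. f i) = (\<Oplus>i\<in>{..<m}. f i) \<oplus> (\<Oplus>i\<in>{..<k}. f (m + i))"
proof (induction k)
  case (Suc k)
  have c: "(\<Oplus>i\<in>{..<m}. f i) \<in> carrier G" "(\<Oplus>i\<in>{..<k}. f (m + i)) \<in> carrier G" "f (m + k) \<in> carrier G"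
    using f by (auto intro!: finsum_closed)
  have "(\<Oplus>i\<in>{..<m + Suc k}. f i) = f (m + k) \<oplus> (\<Oplus>i\<in>{..<m + k}. f i)"
    using finsum_lessThan_Suc[of f, OF f] by simp
  also have "\<dots> = (\<Oplus>i\<in>{..<m}. f i) \<oplus> (f (m + k) \<oplus> (\<Oplus>i\<in>{..<k}. f (m + i)))"
    using c by (simp add: Suc a_lcomm)
  also have "f (m + k) \<oplus> (\<Oplus>i\<in>{..<k}. f (m + i)) = (\<Oplus>i\<in>{..<Suc k}. f (m + i))"
    using f by (intro finsum_lessThan_Suc[symmetric])
  finally show ?case .
qed (use f in simp)

text \<open>Indices are split into residue and multiple of \<open>m\<close>. This folds a sum over a
  long period onto a short one, and it sorts the conjugates at level one into residue classes modulo
  \<open>l\<close>.\<close>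

lemma (in abelian_monoid) finsum_lessThan_mult:
  fixes m k :: nat
  assumes f: "\<And>i. f i \<in> carrier G"
  shows "(\<Oplus>i\<in>{..<m * k}. f i) = (\<Oplus>i\<in>{..<m}. \<Oplus>j\<in>{..<k}. f (i + j * m))"
proof (induction k)
  case (Suc k)
  have "(\<Oplus>i\<in>{..<m * Suc k}. f i) = (\<Oplus>i\<in>{..<m * k}. f i) \<oplus> (\<Oplus>i\<in>{..<m}. f (m * k + i))"
    using finsum_lessThan_add[of f "m * k" m, OF f] by (simp add: add.commute)
  also have "\<dots> = (\<Oplus>i\<in>{..<m}. (\<Oplus>j\<in>{..<k}. f (i + j * m)) \<oplus> f (m * k + i))"
    unfolding Suc using f by (intro finsum_addf[symmetric]) (auto intro!: finsum_closed)
  also have "\<dots> = (\<Oplus>i\<in>{..<m}. \<Oplus>j\<in>{..<Suc k}. f (i + j * m))"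
  proof (intro finsum_cong')
    fix i
    have "(\<Oplus>j\<in>{..<Suc k}. f (i + j * m)) = f (i + k * m) \<oplus> (\<Oplus>j\<in>{..<k}. f (i + j * m))"
      using f by (intro finsum_lessThan_Suc)
    then show "(\<Oplus>j\<in>{..<k}. f (i + j * m)) \<oplus> f (m * k + i) = (\<Oplus>j\<in>{..<Suc k}. f (i + j * m))"
      using f by (simp add: a_comm add.commute mult.commute finsum_closed)
  qed (use f in \<open>auto intro!: finsum_closed\<close>)
  finally show ?case .
qed simp

lemma (in abelian_monoid) finsum_periodic_shift:
  fixes s N :: nat
  assumes f: "\<And>i. f i \<in> carrier G" and per: "\<And>i. f (i + N) = f i"
  shows "(\<Oplus>i\<in>{..<N}. f (i + s)) = (\<Oplus>i\<in>{..<N}. f i)"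
proof (induction s)
  case (Suc s)
  show ?case
  proof (cases N)
    case 0
    then show ?thesis by simp
  next
    case (Suc r)
    let ?g = "\<lambda>i. f (i + s)"
    have g: "?g i \<in> carrier G" for i using f by simp
    have "(\<Oplus>i\<in>{..<N}. f (i + Suc s)) = f (r + Suc s) \<oplus> (\<Oplus>i\<in>{..<r}. ?g (1 + i))"
      unfolding Suc using f by (subst finsum_lessThan_Suc) auto
    also have "f (r + Suc s) = ?g 0" using per[of s] by (simp add: Suc add.commute)
    also have "\<dots> \<oplus> (\<Oplus>i\<in>{..<r}. ?g (1 + i)) = (\<Oplus>i\<in>{..<1 + r}. ?g i)"
      using finsum_lessThan_add[of ?g 1 r, OF g] finsum_lessThan_Suc[of ?g 0, OF g] f by simp
    finally show ?thesis using Suc.IH by (simp add: \<open>N = Suc r\<close>)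
  qed
qed simp

section \<open>Roots of unity and the finite Fourier transform\<close>

definition (in ring) root_of_unity :: "nat \<Rightarrow> 'a \<Rightarrow> bool" where
  "root_of_unity m z \<longleftrightarrow> z \<in> carrier R \<and> z [^] m = \<one> \<and> (\<forall>i. 0 < i \<and> i < m \<longrightarrow> z [^] i \<noteq> \<one>)"

lemma (in ring) root_of_unity_pow_mod:
  assumes "root_of_unity m z"
  shows "z [^] (i mod m) = z [^] i"
proof -
  have z: "z \<in> carrier R" "z [^] m = \<one>" using assms by (auto simp: root_of_unity_def)
  have "z [^] i = z [^] (m * (i div m) + i mod m)" by simp
  also have "\<dots> = (z [^] m) [^] (i div m) \<otimes> z [^] (i mod m)"
    by (simp only: nat_pow_pow[OF z(1)] nat_pow_mult[OF z(1)])
  finally show ?thesis using z by simp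
qed

lemma (in ring) root_of_unity_pow_eq_one_iff:
  assumes "root_of_unity m z" "m > 0"
  shows "z [^] i = \<one> \<longleftrightarrow> m dvd i"
proof
  assume "z [^] i = \<one>"
  then have "z [^] (i mod m) = \<one>" using root_of_unity_pow_mod[OF assms(1)] by simp
  moreover have "i mod m < m" using assms(2) by simp
  moreover have "\<And>j. 0 < j \<Longrightarrow> j < m \<Longrightarrow> z [^] j \<noteq> \<one>"
    using assms(1) by (simp add: root_of_unity_def)
  ultimately have "\<not> 0 < i mod m" by metis
  then show "m dvd i" by (simp add: dvd_eq_mod_eq_0)
next
  assume "m dvd i"
  then show "z [^] i = \<one>" using root_of_unity_pow_mod[OF assms(1), of i] by simp
qed

text \<open>Multiplication by \<open>z [^] k\<close> permutes the terms cyclically, so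
  \<open>z [^] k \<ominus> \<one>\<close> annihilates the sum; it is nonzero because the order of
  \<open>z\<close> is exactly \<open>m\<close>.\<close>

lemma (in domain) root_of_unity_sum:
  assumes z: "root_of_unity m z" and m: "m > 0" and k: "\<not> m dvd k"
  shows "(\<Oplus>i\<in>{..<m}. z [^] (i * k)) = \<zero>"
proof -
  let ?S = "\<Oplus>i\<in>{..<m}. z [^] (i * k)"
  have zc: "z \<in> carrier R" using z by (simp add: root_of_unity_def)
  have S: "?S \<in> carrier R" using zc by (auto intro!: finsum_closed)
  have "z [^] k \<otimes> ?S = (\<Oplus>i\<in>{..<m}. z [^] k \<otimes> z [^] (i * k))"
    using zc by (intro finsum_rdistr) auto
  also have "\<dots> = (\<Oplus>i\<in>{..<m}. z [^] ((i + 1) * k))"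
    using zc by (intro finsum_cong') (auto simp: nat_pow_mult)
  also have "\<dots> = ?S"
  proof (rule finsum_periodic_shift[where f = "\<lambda>i. z [^] (i * k)"])
    fix i
    have "z [^] ((i + m) * k) = z [^] (i * k) \<otimes> z [^] (m * k)" using zc by (simp add: nat_pow_mult algebra_simps)
    also have "z [^] (m * k) = \<one>" using root_of_unity_pow_eq_one_iff[OF z m] by simp
    finally show "z [^] ((i + m) * k) = z [^] (i * k)" using zc by simp
  qed (use zc in simp)
  finally have "(z [^] k \<ominus> \<one>) \<otimes> ?S = \<zero>"
    using S zc by (simp add: minus_eq l_distr l_minus r_neg)
  moreover have "z [^] k \<ominus> \<one> \<noteq> \<zero>"
    using root_of_unity_pow_eq_one_iff[OF z m] k zc by (simp add: r_right_minus_eq)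
  ultimately show ?thesis using integral[of "z [^] k \<ominus> \<one>" ?S] S zc by auto
qed

text \<open>Fourier inversion: summing the coefficients against \<open>z ^ (- k * i0)\<close>
  recovers \<open>[m] \<cdot> w i0\<close>, which is nonzero because \<open>m\<close> is nonzero in
  the field.\<close>

lemma (in domain) fourier_nonzero:
  assumes z: "root_of_unity m z" and m: "m > 0" and inv: "[m] \<cdot> \<one> \<noteq> \<zero>"
    and w: "\<And>i. w i \<in> carrier R" and i0: "i0 < m" "w i0 \<noteq> \<zero>"
  shows "\<exists>k<m. (\<Oplus>i\<in>{..<m}. z [^] (k * i) \<otimes> w i) \<noteq> \<zero>"
proof (rule ccontr)
  assume "\<not> ?thesis"
  then have 0: "(\<Oplus>i\<in>{..<m}. z [^] (k * i) \<otimes> w i) = \<zero>" if "k < m" for k using that by blast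
  have zc: "z \<in> carrier R" using z by (simp add: root_of_unity_def)
  \<comment> \<open>The exponent \<open>m - i0\<close> stands for \<open>- i0\<close>, as exponents
    are natural numbers.\<close>
  have "\<zero> = (\<Oplus>k\<in>{..<m}. z [^] (k * (m - i0)) \<otimes> (\<Oplus>i\<in>{..<m}. z [^] (k * i) \<otimes> w i))"
  proof -
    have "(\<Oplus>k\<in>{..<m}. z [^] (k * (m - i0)) \<otimes> (\<Oplus>i\<in>{..<m}. z [^] (k * i) \<otimes> w i)) = (\<Oplus>k\<in>{..<m}. \<zero>)"
      using 0 zc by (intro finsum_cong') auto
    then show ?thesis by simp
  qed
  also have "\<dots> = (\<Oplus>k\<in>{..<m}. \<Oplus>i\<in>{..<m}. z [^] (k * (m - i0 + i)) \<otimes> w i)"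
  proof (intro finsum_cong')
    fix k
    have "z [^] (k * (m - i0)) \<otimes> (\<Oplus>i\<in>{..<m}. z [^] (k * i) \<otimes> w i)
       = (\<Oplus>i\<in>{..<m}. z [^] (k * (m - i0)) \<otimes> (z [^] (k * i) \<otimes> w i))"
      using zc w by (intro finsum_rdistr) auto
    also have "\<dots> = (\<Oplus>i\<in>{..<m}. z [^] (k * (m - i0 + i)) \<otimes> w i)"
      using zc w by (intro finsum_cong') (auto simp: m_assoc[symmetric] nat_pow_mult algebra_simps)
    finally show "z [^] (k * (m - i0)) \<otimes> (\<Oplus>i\<in>{..<m}. z [^] (k * i) \<otimes> w i) = \<dots>" .
  qed (use zc w in \<open>auto intro!: finsum_closed\<close>)
  also have "\<dots> = (\<Oplus>i\<in>{..<m}. \<Oplus>k\<in>{..<m}. z [^] (k * (m - i0 + i)) \<otimes> w i)"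
    using zc w by (intro finsum_swap) auto
  also have "\<dots> = (\<Oplus>i\<in>{..<m}. (if i0 = i then [m] \<cdot> w i0 else \<zero>))"
  proof (intro finsum_cong')
    fix i assume i: "i \<in> {..<m}"
    have "(\<Oplus>k\<in>{..<m}. z [^] (k * (m - i0 + i)) \<otimes> w i) = (\<Oplus>k\<in>{..<m}. z [^] (k * (m - i0 + i))) \<otimes> w i"
      using zc w by (intro finsum_ldistr[symmetric]) auto
    also have "\<dots> = (if i0 = i then [m] \<cdot> w i0 else \<zero>)"
    proof (cases "i0 = i")
      case True
      then have "z [^] (k * (m - i0 + i)) = \<one>" for k
        using root_of_unity_pow_eq_one_iff[OF z m] i by simp
      then have "(\<Oplus>k\<in>{..<m}. z [^] (k * (m - i0 + i))) = [m] \<cdot> \<one>"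
        using add.finprod_const[of \<one> "{..<m}"] by simp
      then show ?thesis using True w by (simp add: add_pow_ldistr)
    next
      case False
      have "\<not> m dvd m - i0 + i"
      proof
        assume "m dvd m - i0 + i"
        then obtain c where c: "m - i0 + i = m * c" by blast
        then have "m * c + i0 = m + i" using i0 by linarith
        then have "(m * c + i0) mod m = (m + i) mod m" by simp
        then show False using i0 i False by simp
      qed
      then show ?thesis using root_of_unity_sum[OF z m] False w by simp
    qed
    finally show "(\<Oplus>k\<in>{..<m}. z [^] (k * (m - i0 + i)) \<otimes> w i) = (if i0 = i then [m] \<cdot> w i0 else \<zero>)" .
  qed (use w in auto)
  also have "\<dots> = [m] \<cdot> w i0"
    using i0 w finsum_singleton[of i0 "{..<m}" "\<lambda>i. [m] \<cdot> w i0"] by auto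
  finally have "([m] \<cdot> \<one>) \<otimes> w i0 = \<zero>" using w by (simp add: add_pow_ldistr)
  then show False using integral[of "[m] \<cdot> \<one>" "w i0"] inv i0 w by auto
qed

text \<open>
  The space of relations of a periodic sequence is shift invariant, hence contains an eigenvector
  of the shift; it gives a vanishing Fourier coefficient.
\<close>

lemma (in domain) cyclic_relation_imp_fourier_zero:
  assumes p: "prime (p::nat)" and ch: "[p] \<cdot> \<one> = \<zero>"
    and z: "root_of_unity m z" and m: "m > 0" and inv: "[m] \<cdot> \<one> \<noteq> \<zero>" and N: "N = m * p ^ a"
    and u: "\<And>i. u i \<in> carrier R" "\<And>i. u (i + N) = u i"
    and c: "\<And>i. c i \<in> carrier R" "\<And>i. c (i + N) = c i" "c i0 \<noteq> \<zero>"
    and rel: "\<And>j. (\<Oplus>i\<in>{..<N}. c i \<otimes> u (i + j)) = \<zero>"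
  shows "\<exists>k<m. (\<Oplus>i\<in>{..<N}. z [^] (k * i) \<otimes> u i) = \<zero>"
proof -
  have zc: "z \<in> carrier R" using z by (simp add: root_of_unity_def)
  have perN: "f (i + s * N) = f i" if "\<And>i. f (i + N) = f i" for f :: "nat \<Rightarrow> 'a" and i s
  proof (induction s)
    case (Suc s)
    have "f (i + Suc s * N) = f ((i + s * N) + N)" by (simp add: algebra_simps)
    then show ?case using that Suc by simp
  qed simp
  have N0: "N > 0" using m p prime_gt_0_nat by (simp add: N)
  \<comment> \<open>All offsets \<open>j\<close> are included, so that a shifted relation is again a
    relation.\<close>
  define P where "P c \<longleftrightarrow> (\<forall>i. c i \<in> carrier R) \<and> (\<forall>i. c (i + N) = c i) \<and>
     (\<forall>j. (\<Oplus>i\<in>{..<N}. c i \<otimes> u (i + j)) = \<zero>)" for c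
  have P: "P (shift_diff s d)" if d: "P d" for s d
  proof -
    have dc: "d i \<in> carrier R" "d (i + N) = d i" for i using d by (auto simp: P_def)
    have dr: "(\<Oplus>i\<in>{..<N}. d i \<otimes> u (i + j)) = \<zero>" for j using d by (auto simp: P_def)
    have "(\<Oplus>i\<in>{..<N}. shift_diff s d i \<otimes> u (i + j)) = \<zero>" for j
    proof -
      \<comment> \<open>\<open>(N - 1) * s\<close> replaces \<open>- s\<close>: adding
        \<open>s\<close> to it gives \<open>s * N\<close>, a multiple of the period.\<close>
      let ?f = "\<lambda>i. d i \<otimes> u (i + (j + (N - 1) * s))"
      have "(\<Oplus>i\<in>{..<N}. shift_diff s d i \<otimes> u (i + j)) = (\<Oplus>i\<in>{..<N}. ?f (i + s) \<ominus> d i \<otimes> u (i + j))"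
      proof (intro finsum_cong')
        fix i
        have "i + s + (j + (N - 1) * s) = i + j + s * N"
          using N0 by (cases N) (auto simp: algebra_simps)
        then have "u (i + s + (j + (N - 1) * s)) = u (i + j)"
          using perN[of u "i + j" s] u(2) by metis
        then show "shift_diff s d i \<otimes> u (i + j) = ?f (i + s) \<ominus> d i \<otimes> u (i + j)"
          using dc u by (simp add: shift_diff_def minus_eq l_distr l_minus)
      qed (use dc u in auto)
      also have "\<dots> = (\<Oplus>i\<in>{..<N}. ?f (i + s)) \<ominus> (\<Oplus>i\<in>{..<N}. d i \<otimes> u (i + j))"
        using dc u by (intro finsum_diff) auto
      also have "(\<Oplus>i\<in>{..<N}. ?f (i + s)) = (\<Oplus>i\<in>{..<N}. ?f i)"
      proof (rule finsum_periodic_shift)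
        fix i
        have "u (i + N + (j + (N - 1) * s)) = u (i + (j + (N - 1) * s))"
          using u(2)[of "i + (j + (N - 1) * s)"] by (simp add: algebra_simps)
        then show "?f (i + N) = ?f i" using dc by simp
      qed (use dc u in auto)
      finally show ?thesis using dr[of j] dr[of "j + (N - 1) * s"] by (simp add: minus_eq r_neg)
    qed
    moreover have "shift_diff s d (i + N) = shift_diff s d i" for i
      using dc(2)[of i] dc(2)[of "i + s"] by (simp add: shift_diff_def algebra_simps)
    ultimately show ?thesis using dc by (auto simp: P_def shift_diff_def)
  qed
  \<comment> \<open>A nonzero relation of period \<open>m\<close>; since \<open>m\<close> is nonzero
    in the field, Fourier inversion applies to it.\<close>
  obtain w i1 where w: "P w" "\<And>i. w (i + m) = w i" "w i1 \<noteq> \<zero>"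
    using prime_power_period_reduction[of p P c m a i0] p ch P c rel unfolding N[symmetric]
    by (auto simp: P_def)
  have wc: "w i \<in> carrier R" for i using w(1) by (auto simp: P_def)
  have wr: "(\<Oplus>i\<in>{..<N}. w i \<otimes> u (i + j)) = \<zero>" for j using w(1) by (auto simp: P_def)
  have wmul: "w (i + s * m) = w i" for i s
  proof (induction s)
    case (Suc s)
    have "w (i + Suc s * m) = w ((i + s * m) + m)" by (simp add: algebra_simps)
    then show ?case using w(2) Suc by simp
  qed simp
  have "w (i1 mod m) = w i1" using wmul[of "i1 mod m" "i1 div m"] by simp
  then obtain k where k: "k < m" and Fw: "(\<Oplus>i\<in>{..<m}. z [^] (k * i) \<otimes> w i) \<noteq> \<zero>"
    using fourier_nonzero[OF z m inv, of w "i1 mod m"] wc m w(3) by auto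
  \<comment> \<open>\<open>k'\<close> is \<open>- k\<close> modulo \<open>m\<close>. The coefficient
    of \<open>w\<close> at \<open>k\<close> is nonzero, and this will force the one of
    \<open>u\<close> at \<open>- k\<close> to vanish.\<close>
  define k' where "k' = (m - k) mod m"
  have zkk: "z [^] (k * i) \<otimes> z [^] (k' * i) = \<one>" for i
  proof -
    have "m dvd k + k'" unfolding k'_def using k by (cases "k = 0") auto
    then have "m dvd (k + k') * i" by simp
    then show ?thesis
      using root_of_unity_pow_eq_one_iff[OF z m] zc by (simp add: nat_pow_mult algebra_simps)
  qed
  \<comment> \<open>Against a factor of period \<open>m\<close>, only the sums of \<open>u\<close>
    over residue classes modulo \<open>m\<close> matter.\<close>
  define y where "y j = (\<Oplus>s\<in>{..<p ^ a}. u (j + s * m))" for j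
  have yc: "y j \<in> carrier R" for j unfolding y_def using u by (auto intro!: finsum_closed)
  have yper: "y (j + m) = y j" for j
  proof -
    have "(\<Oplus>s\<in>{..<p ^ a}. (\<lambda>s. u (j + s * m)) (s + 1)) = (\<Oplus>s\<in>{..<p ^ a}. u (j + s * m))"
    proof (rule finsum_periodic_shift)
      show "u (j + (i + p ^ a) * m) = u (j + i * m)" for i
        using u(2)[of "j + i * m"] unfolding N by (simp add: algebra_simps)
    qed (use u in auto)
    then show ?thesis by (simp add: y_def algebra_simps)
  qed
  have fold: "(\<Oplus>i\<in>{..<N}. g i \<otimes> u (i + j)) = (\<Oplus>i\<in>{..<m}. g i \<otimes> y (i + j))"
    if g: "\<And>i. g i \<in> carrier R" "\<And>i s. g (i + s * m) = g i" for g j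
  proof -
    have "(\<Oplus>i\<in>{..<N}. g i \<otimes> u (i + j)) = (\<Oplus>i\<in>{..<m}. \<Oplus>s\<in>{..<p ^ a}. g (i + s * m) \<otimes> u (i + s * m + j))"
      unfolding N using g u by (intro finsum_lessThan_mult) auto
    also have "\<dots> = (\<Oplus>i\<in>{..<m}. g i \<otimes> y (i + j))"
    proof (intro finsum_cong')
      fix i
      have "(\<Oplus>s\<in>{..<p ^ a}. g (i + s * m) \<otimes> u (i + s * m + j)) = (\<Oplus>s\<in>{..<p ^ a}. g i \<otimes> u (i + j + s * m))"
        using g u by (intro finsum_cong') (auto simp: algebra_simps)
      also have "\<dots> = g i \<otimes> y (i + j)"
        unfolding y_def using g u by (intro finsum_rdistr[symmetric]) auto
      finally show "(\<Oplus>s\<in>{..<p ^ a}. g (i + s * m) \<otimes> u (i + s * m + j)) = g i \<otimes> y (i + j)" .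
    qed (use g yc in auto)
    finally show ?thesis .
  qed
  define F where "F = (\<Oplus>i\<in>{..<N}. z [^] (k' * i) \<otimes> u i)"
  have zper: "z [^] (k' * (i + s * m)) = z [^] (k' * i)" for i s
  proof -
    have "z [^] (k' * (i + s * m)) = z [^] (k' * i) \<otimes> z [^] (m * (k' * s))"
      using zc by (simp add: nat_pow_mult algebra_simps)
    also have "z [^] (m * (k' * s)) = \<one>" using root_of_unity_pow_eq_one_iff[OF z m] by simp
    finally show ?thesis using zc by simp
  qed
  have Fy: "F = (\<Oplus>j\<in>{..<m}. z [^] (k' * j) \<otimes> y j)"
    using fold[of "\<lambda>i. z [^] (k' * i)" 0] zper zc by (simp add: F_def)
  have Fc: "F \<in> carrier R" unfolding F_def using zc u by (auto intro!: finsum_closed)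
  \<comment> \<open>Shifting \<open>y\<close> by \<open>i\<close> multiplies its Fourier coefficient
    by a power of \<open>z\<close>.\<close>
  have Fi: "(\<Oplus>j\<in>{..<m}. z [^] (k' * j) \<otimes> y (i + j)) = z [^] (k * i) \<otimes> F" for i
  proof -
    let ?S = "\<Oplus>j\<in>{..<m}. z [^] (k' * j) \<otimes> y (i + j)"
    have Sc: "?S \<in> carrier R" using zc yc by (auto intro!: finsum_closed)
    have "z [^] (k' * i) \<otimes> ?S = (\<Oplus>j\<in>{..<m}. z [^] (k' * i) \<otimes> (z [^] (k' * j) \<otimes> y (i + j)))"
      using zc yc by (intro finsum_rdistr) auto
    also have "\<dots> = (\<Oplus>j\<in>{..<m}. (\<lambda>j. z [^] (k' * j) \<otimes> y j) (j + i))"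
      using zc yc by (intro finsum_cong') (auto simp: m_assoc[symmetric] nat_pow_mult algebra_simps)
    also have "\<dots> = F" unfolding Fy
      by (rule finsum_periodic_shift) (use zc yc yper zper[of _ 1] in auto)
    finally have "z [^] (k * i) \<otimes> F = z [^] (k * i) \<otimes> (z [^] (k' * i) \<otimes> ?S)" by simp
    also have "\<dots> = ?S" using zc Sc zkk[of i] by (simp add: m_assoc[symmetric])
    finally show ?thesis by simp
  qed
  \<comment> \<open>The transform of the correlation of \<open>w\<close> and \<open>y\<close> is a
    product of transforms: the left side is zero by the relations, and the right side is a nonzero
    coefficient of \<open>w\<close> times \<open>F\<close>.\<close>
  have "\<zero> = (\<Oplus>j\<in>{..<m}. z [^] (k' * j) \<otimes> (\<Oplus>i\<in>{..<m}. w i \<otimes> y (i + j)))"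
  proof -
    have "(\<Oplus>i\<in>{..<m}. w i \<otimes> y (i + j)) = \<zero>" for j using fold[of w j] wc wmul wr by simp
    then show ?thesis using zc by simp
  qed
  also have "\<dots> = (\<Oplus>j\<in>{..<m}. \<Oplus>i\<in>{..<m}. w i \<otimes> (z [^] (k' * j) \<otimes> y (i + j)))"
  proof (intro finsum_cong')
    fix j
    have "z [^] (k' * j) \<otimes> (\<Oplus>i\<in>{..<m}. w i \<otimes> y (i + j)) = (\<Oplus>i\<in>{..<m}. z [^] (k' * j) \<otimes> (w i \<otimes> y (i + j)))"
      using zc wc yc by (intro finsum_rdistr) auto
    also have "\<dots> = (\<Oplus>i\<in>{..<m}. w i \<otimes> (z [^] (k' * j) \<otimes> y (i + j)))"
      using zc wc yc by (intro finsum_cong') (auto simp: m_lcomm)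
    finally show "z [^] (k' * j) \<otimes> (\<Oplus>i\<in>{..<m}. w i \<otimes> y (i + j)) = \<dots>" .
  qed (use zc wc yc in \<open>auto intro!: finsum_closed\<close>)
  also have "\<dots> = (\<Oplus>i\<in>{..<m}. \<Oplus>j\<in>{..<m}. w i \<otimes> (z [^] (k' * j) \<otimes> y (i + j)))"
    using zc wc yc by (intro finsum_swap) auto
  also have "\<dots> = (\<Oplus>i\<in>{..<m}. (z [^] (k * i) \<otimes> w i) \<otimes> F)"
  proof (intro finsum_cong')
    fix i
    have "(\<Oplus>j\<in>{..<m}. w i \<otimes> (z [^] (k' * j) \<otimes> y (i + j))) = w i \<otimes> (\<Oplus>j\<in>{..<m}. z [^] (k' * j) \<otimes> y (i + j))"
      using zc wc yc by (intro finsum_rdistr[symmetric]) auto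
    also have "\<dots> = (z [^] (k * i) \<otimes> w i) \<otimes> F"
      unfolding Fi using zc wc Fc by (simp add: m_ac)
    finally show "(\<Oplus>j\<in>{..<m}. w i \<otimes> (z [^] (k' * j) \<otimes> y (i + j))) = (z [^] (k * i) \<otimes> w i) \<otimes> F" .
  qed (use zc wc Fc in auto)
  also have "\<dots> = (\<Oplus>i\<in>{..<m}. z [^] (k * i) \<otimes> w i) \<otimes> F"
    using zc wc Fc by (intro finsum_ldistr[symmetric]) auto
  finally have "F = \<zero>"
    using integral[of "\<Oplus>i\<in>{..<m}. z [^] (k * i) \<otimes> w i" F] Fw Fc zc wc
    by (auto intro!: finsum_closed)
  moreover have "k' < m" using m by (simp add: k'_def)
  ultimately show ?thesis unfolding F_def by blast
qed

text \<open>Subtracting \<open>b a\<close> times the \<open>k\<close>-th equation from the next one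
  removes the term of \<open>a\<close> and multiplies every other coefficient by
  \<open>b i \<ominus> b a\<close>, which is nonzero by injectivity.\<close>

lemma (in domain) vandermonde_trivial_kernel:
  assumes "finite I" "inj_on b I" "b \<in> I \<rightarrow> carrier R" "c \<in> I \<rightarrow> carrier R"
    and "\<And>k::nat. (\<Oplus>i\<in>I. c i \<otimes> b i [^] k) = \<zero>"
  shows "\<forall>i\<in>I. c i = \<zero>"
  using assms
proof (induction I arbitrary: c rule: finite_induct)
  case (insert a I)
  have bc: "b i \<in> carrier R" "c i \<in> carrier R" if "i \<in> insert a I" for i using insert.prems that by auto
  have split: "c a \<otimes> b a [^] k \<oplus> (\<Oplus>i\<in>I. c i \<otimes> b i [^] k) = \<zero>" for k :: nat
  proof -
    have "(\<Oplus>i\<in>insert a I. c i \<otimes> b i [^] k) = c a \<otimes> b a [^] k \<oplus> (\<Oplus>i\<in>I. c i \<otimes> b i [^] k)"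
      using insert.hyps bc by (intro finsum_insert) auto
    then show ?thesis using insert.prems(4) by simp
  qed
  have "\<forall>i\<in>I. c i \<otimes> (b i \<ominus> b a) = \<zero>"
  proof (rule insert.IH)
    fix k :: nat
    have S: "(\<Oplus>i\<in>I. c i \<otimes> b i [^] j) \<in> carrier R" for j :: nat using bc by (auto intro!: finsum_closed)
    have "(\<Oplus>i\<in>I. (c i \<otimes> (b i \<ominus> b a)) \<otimes> b i [^] k) = (\<Oplus>i\<in>I. c i \<otimes> b i [^] Suc k \<ominus> b a \<otimes> (c i \<otimes> b i [^] k))"
      using bc by (intro finsum_cong') (auto simp: minus_eq r_distr l_distr r_minus l_minus m_ac)
    also have "\<dots> = (\<Oplus>i\<in>I. c i \<otimes> b i [^] Suc k) \<ominus> (\<Oplus>i\<in>I. b a \<otimes> (c i \<otimes> b i [^] k))"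
      using bc by (intro finsum_diff) auto
    also have "(\<Oplus>i\<in>I. b a \<otimes> (c i \<otimes> b i [^] k)) = b a \<otimes> (\<Oplus>i\<in>I. c i \<otimes> b i [^] k)"
      using bc insert.hyps by (intro finsum_rdistr[symmetric]) auto
    also have "(\<Oplus>i\<in>I. c i \<otimes> b i [^] Suc k) = \<ominus> (c a \<otimes> b a [^] Suc k)"
      using split[of "Suc k"] S bc by (intro minus_equality[symmetric]) (auto simp: a_comm)
    also have "(\<Oplus>i\<in>I. c i \<otimes> b i [^] k) = \<ominus> (c a \<otimes> b a [^] k)"
      using split[of k] S bc by (intro minus_equality[symmetric]) (auto simp: a_comm)
    also have "\<ominus> (c a \<otimes> b a [^] Suc k) \<ominus> b a \<otimes> (\<ominus> (c a \<otimes> b a [^] k)) = \<zero>"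
      using bc by (simp add: r_minus minus_eq l_neg m_ac)
    finally show "(\<Oplus>i\<in>I. (c i \<otimes> (b i \<ominus> b a)) \<otimes> b i [^] k) = \<zero>" .
  qed (use insert.prems bc in auto)
  moreover have "b i \<noteq> b a" if "i \<in> I" for i
    using that insert.prems(1) insert.hyps by (metis inj_on_contraD insertI1 insertI2)
  ultimately have I: "c i = \<zero>" if "i \<in> I" for i
    using that bc integral[of "c i" "b i \<ominus> b a"] by auto
  have "(\<Oplus>i\<in>I. c i \<otimes> b i [^] (0::nat)) = (\<Oplus>i\<in>I. \<zero>)" using I by (intro finsum_cong') auto
  then have "c a = \<zero>" using split[of 0] bc by simp
  then show ?case using I by simp
qed simp

subsection \<open>The field with \<open>q ^ n\<close> elements\<close>

locale finite_field_ext = field R for R (structure) +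
  fixes q n p e :: nat
  assumes prime_p: "prime p" and q_eq: "q = p ^ e" and e_pos: "e > 0" and n_pos: "n > 0"
    and order_eq: "order R = q ^ n"
begin

lemma q_gt_1: "q > 1"
  using one_less_power[of p e] prime_gt_1_nat[OF prime_p] e_pos by (simp add: q_eq)

lemma qn_gt_1: "q ^ n > 1"
  using q_gt_1 n_pos by (intro one_less_power)

lemma finite_carrier: "finite (carrier R)"
  using order_eq q_gt_1 by (intro card_ge_0_finite) (simp add: order_def)

lemma card_carrier: "card (carrier R) = q ^ n"
  using order_eq by (simp add: order_def)

lemma primepow_q: "primepow q"
  using prime_p e_pos q_eq by (auto simp: primepow_def)

lemma char_p: "[p] \<cdot> \<one> = \<zero>"
  using char_of_order[of p "e * n"] order_eq prime_p prime_gt_0_nat q_eq by (simp add: power_mult)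

lemma mult_group: "group (mult_of R)"
  by (rule field_mult_group)

text \<open>One generator, fixed once and for all, turns multiplicative statements into congruences
  of exponents modulo \<open>q ^ n - 1\<close>.\<close>

definition gen :: 'a where
  "gen = (SOME g. g \<in> carrier R \<and> g \<noteq> \<zero> \<and> group.ord (mult_of R) g = q ^ n - 1)"

lemma gen: "gen \<in> carrier R" "gen \<noteq> \<zero>" "group.ord (mult_of R) gen = q ^ n - 1"
proof -
  interpret G: group "mult_of R" by (rule mult_group)
  obtain a where a: "a \<in> carrier (mult_of R)"
    and gen: "carrier (mult_of R) = {a [^] i | i::nat. i \<in> UNIV}"
    using finite_field_mult_group_has_gen[OF finite_carrier] by blast
  have finM: "finite (carrier (mult_of R))" using finite_mult_of[OF finite_carrier] .
  have "generate (mult_of R) {a} = carrier (mult_of R)"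
    using G.generate_pow_on_finite_carrier[OF finM a] gen by (simp add: nat_pow_mult_of)
  then have "G.ord a = card (carrier (mult_of R))"
    using G.generate_pow_card[OF a] by simp
  then have "G.ord a = q ^ n - 1"
    using order_mult_of[OF finite_carrier] order_eq by (simp add: order_def)
  then have "\<exists>g. g \<in> carrier R \<and> g \<noteq> \<zero> \<and> G.ord g = q ^ n - 1" using a by auto
  from someI_ex[OF this] show "gen \<in> carrier R" "gen \<noteq> \<zero>" "G.ord gen = q ^ n - 1"
    unfolding gen_def by blast+
qed

lemma gen_pow_eq_one_iff: "gen [^] (i::nat) = \<one> \<longleftrightarrow> q ^ n - 1 dvd i"
proof -
  interpret G: group "mult_of R" by (rule mult_group)
  show ?thesis using G.pow_eq_id[of gen i] gen by (simp add: nat_pow_mult_of)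
qed

lemma gen_pow_nonzero: "gen [^] (i::nat) \<noteq> \<zero>"
  using nat_pow_eq_zero_iff gen by blast

lemma gen_pow_eq_iff: "gen [^] (i::nat) = gen [^] j \<longleftrightarrow> i mod (q ^ n - 1) = j mod (q ^ n - 1)"
proof (induction i j rule: linorder_wlog)
  case (le i j)
  have "gen [^] j = gen [^] i \<otimes> gen [^] (j - i)" using le gen by (simp add: nat_pow_mult)
  then have "gen [^] i = gen [^] j \<longleftrightarrow> gen [^] i \<otimes> \<one> = gen [^] i \<otimes> gen [^] (j - i)" using gen by simp
  also have "\<dots> \<longleftrightarrow> gen [^] (j - i) = \<one>"
    using gen gen_pow_nonzero by (subst m_lcancel) auto
  also have "\<dots> \<longleftrightarrow> j mod (q ^ n - 1) = i mod (q ^ n - 1)"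
    using le by (simp add: gen_pow_eq_one_iff mod_eq_dvd_iff_nat)
  finally show ?case by auto
qed auto

lemma ex_gen_pow:
  assumes "x \<in> carrier R" "x \<noteq> \<zero>"
  shows "\<exists>k<q ^ n - 1. x = gen [^] k"
proof -
  let ?f = "\<lambda>k::nat. gen [^] k"
  have inj: "inj_on ?f {..<q ^ n - 1}"
    by (auto simp: inj_on_def gen_pow_eq_iff)
  have sub: "?f ` {..<q ^ n - 1} \<subseteq> carrier R - {\<zero>}" using gen gen_pow_nonzero by auto
  have "card (carrier R - {\<zero>}) = q ^ n - 1" using card_carrier by simp
  then have "?f ` {..<q ^ n - 1} = carrier R - {\<zero>}"
    using finite_carrier sub inj by (intro card_subset_eq) (auto simp: card_image)
  then show ?thesis using assms by blast
qed

lemma pow_qn: "x \<in> carrier R \<Longrightarrow> x [^] (q ^ n) = x"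
proof (cases "x = \<zero>")
  case True
  then show ?thesis using q_gt_1 by (simp add: nat_pow_zero)
next
  case False
  assume x: "x \<in> carrier R"
  obtain k :: nat where k: "x = gen [^] k" using ex_gen_pow[OF x False] by blast
  have "[k * q ^ n = k] (mod (q ^ n - 1))"
  proof -
    have "[q ^ n = 1] (mod (q ^ n - 1))" using qn_gt_1 by (simp add: cong_def mod_if)
    then show ?thesis using cong_mult[of k k "q ^ n - 1" "q ^ n" 1] by simp
  qed
  then show ?thesis unfolding k using gen by (simp add: nat_pow_pow gen_pow_eq_iff cong_def)
qed

lemma frob_add:
  assumes "x \<in> carrier R" "y \<in> carrier R"
  shows "(x \<oplus> y) [^] (q ^ j) = x [^] (q ^ j) \<oplus> y [^] (q ^ j)"
  using pow_prime_power_add[OF assms prime_p char_p, of "e * j"] by (simp add: q_eq power_mult)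

lemma primitive_element_gen_pow:
  assumes "coprime k (q ^ n - 1)"
  shows "primitive_element R (gen [^] k)"
proof -
  interpret G: group "mult_of R" by (rule mult_group)
  have c: "gen [^] k \<in> carrier (mult_of R)" using gen gen_pow_nonzero by simp
  have "gcd (q ^ n - 1) k = 1" using assms by (simp add: gcd.commute)
  \<comment> \<open>The exponent \<open>0\<close> is coprime to \<open>q ^ n - 1\<close> only in the
    field with two elements.\<close>
  moreover have "q ^ n - 1 = 1" if "k = 0" using assms that by simp
  ultimately have "G.ord (gen [^]\<^bsub>mult_of R\<^esub> k) = q ^ n - 1"
    using G.ord_pow_gen[of gen k] gen by (cases "k = 0") simp_all
  then have "card (generate (mult_of R) {gen [^] k}) = q ^ n - 1"
    using G.generate_pow_card[OF c] by (simp add: nat_pow_mult_of)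
  moreover have "card (carrier (mult_of R)) = q ^ n - 1" using card_carrier by simp
  moreover have "generate (mult_of R) {gen [^] k} \<subseteq> carrier (mult_of R)"
    by (rule G.generate_incl) (use c in simp)
  ultimately have "generate (mult_of R) {gen [^] k} = carrier (mult_of R)"
    using finite_mult_of[OF finite_carrier] by (intro card_subset_eq) auto
  then show ?thesis using c by (simp add: primitive_element_def)
qed

text \<open>Membership in the subfield becomes an equation. It makes sense for every
  \<open>l\<close>, and \<open>fixed_field_mono\<close> is applied to multiples of \<open>l\<close>
  that need not divide \<open>n\<close>.\<close>

definition fixed_field :: "nat \<Rightarrow> 'a set" where
  "fixed_field l = {x \<in> carrier R. x [^] (q ^ l) = x}"

text \<open>By Lagrange the nonzero elements of the subfield satisfy
  \<open>x [^] (q ^ l - 1) = \<one>\<close>, an equation with at most \<open>q ^ l - 1\<close>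
  solutions. So the subfield lies in \<open>fixed_field l\<close> and is at least as large.\<close>

lemma subfield_of_card_eq:
  assumes l: "l > 0" "l dvd n"
  shows "subfield_of_card R (q ^ l) = fixed_field l"
proof -
  let ?K = "subfield_of_card R (q ^ l)"
  interpret G: group "mult_of R" by (rule mult_group)
  have K: "subfield ?K R" "card ?K = q ^ l"
    using subfield_of_card[OF primepow_q order_eq n_pos l(2)] by auto
  have KR: "?K \<subseteq> carrier R" and zK: "\<zero> \<in> ?K"
    using subfieldE(3)[OF K(1)] subringE(2)[OF subfieldE(1)[OF K(1)]] by auto
  have ql: "q ^ l > 1" using q_gt_1 l by (intro one_less_power)
  interpret KG: group "mult_of R \<lparr> carrier := ?K - {\<zero>} \<rparr>"
    using G.subgroup_imp_group subgroup_mult_of K by blast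
  have sub: "?K \<subseteq> fixed_field l"
  proof
    fix x assume x: "x \<in> ?K"
    show "x \<in> fixed_field l"
    proof (cases "x = \<zero>")
      case True
      then show ?thesis using q_gt_1 by (simp add: fixed_field_def nat_pow_zero)
    next
      case False
      have "x [^]\<^bsub>mult_of R \<lparr> carrier := ?K - {\<zero>} \<rparr>\<^esub> order (mult_of R \<lparr> carrier := ?K - {\<zero>} \<rparr>)
          = \<one>\<^bsub>mult_of R \<lparr> carrier := ?K - {\<zero>} \<rparr>\<^esub>"
        using x False by (intro KG.pow_order_eq_1) simp
      moreover have "order (mult_of R \<lparr> carrier := ?K - {\<zero>} \<rparr>) = q ^ l - 1"
        using K(2) zK by (simp add: order_def card_Diff_singleton)
      ultimately have "x [^] (q ^ l - 1) = \<one>"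
        by (simp add: nat_pow_consistent[symmetric] G.nat_pow_consistent[symmetric] nat_pow_mult_of)
      then have "x [^] (q ^ l - 1) \<otimes> x = x" using x KR by auto
      moreover have "x [^] (q ^ l - 1) \<otimes> x = x [^] (q ^ l)"
        using ql by (metis One_nat_def Suc_pred nat_pow_Suc less_trans zero_less_one)
      ultimately show ?thesis using x KR by (auto simp: fixed_field_def)
    qed
  qed
  have "fixed_field l \<subseteq> insert \<zero> {x \<in> carrier R. x [^] (q ^ l - 1) = \<one>}"
  proof
    fix x assume x: "x \<in> fixed_field l"
    show "x \<in> insert \<zero> {x \<in> carrier R. x [^] (q ^ l - 1) = \<one>}"
    proof (cases "x = \<zero>")
      case False
      have "x [^] (q ^ l - 1) \<otimes> x = x [^] (q ^ l)"
        using ql by (metis One_nat_def Suc_pred nat_pow_Suc less_trans zero_less_one)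
      also have "\<dots> = \<one> \<otimes> x" using x by (simp add: fixed_field_def)
      finally show ?thesis using False x by (subst (asm) m_rcancel) (auto simp: fixed_field_def)
    qed simp
  qed
  then have "card (fixed_field l) \<le> card (insert \<zero> {x \<in> carrier R. x [^] (q ^ l - 1) = \<one>})"
    using finite_carrier by (intro card_mono) auto
  also have "\<dots> \<le> Suc (card {x \<in> carrier R. x [^] (q ^ l - 1) = \<one>})"
    by (rule card_insert_le_m1) auto
  also have "\<dots> \<le> q ^ l"
    using num_roots_le_deg[OF finite_carrier, of "q ^ l - 1"] ql by simp
  finally have "card (fixed_field l) \<le> card ?K" using K by simp
  then show ?thesis using sub finite_carrier
    by (intro card_seteq) (auto simp: fixed_field_def)
qed

lemma card_fixed_field:
  assumes "l > 0" "l dvd n"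
  shows "card (fixed_field l) = q ^ l"
  using subfield_of_card(2)[OF primepow_q order_eq n_pos assms(2)] subfield_of_card_eq[OF assms] by simp

lemma subfield_fixed_field:
  assumes "l > 0" "l dvd n"
  shows "subfield (fixed_field l) R"
  using subfield_of_card(1)[OF primepow_q order_eq n_pos assms(2)] subfield_of_card_eq[OF assms] by simp

lemma fixed_field_mono: "l dvd k \<Longrightarrow> fixed_field l \<subseteq> fixed_field k"
proof
  fix x assume x: "x \<in> fixed_field l" and "l dvd k"
  then obtain d where d: "k = l * d" by blast
  have "x [^] (q ^ (l * d)) = x"
  proof (induction d)
    case (Suc d)
    have "x [^] (q ^ (l * Suc d)) = (x [^] (q ^ (l * d))) [^] (q ^ l)"
      using x by (simp add: fixed_field_def nat_pow_pow power_add mult.commute)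
    then show ?case using x Suc by (simp add: fixed_field_def)
  qed (use x in \<open>simp add: fixed_field_def\<close>)
  then show "x \<in> fixed_field k" using x by (simp add: d fixed_field_def)
qed

end

section \<open>Linear combinations of conjugates and resolvents\<close>

lemma (in ring) combine_eq_finsum:
  assumes "set Ks \<subseteq> carrier R" "set Us \<subseteq> carrier R"
  shows "combine Ks Us = (\<Oplus>i\<in>{..<length Us}. (if i < length Ks then Ks ! i else \<zero>) \<otimes> Us ! i)"
  using assms
proof (induction Ks Us rule: combine.induct)
  case (1 k Ks u Us)
  \<comment> \<open>\<open>combine\<close> stops at the end of the shorter list, hence the default
    coefficient \<open>\<zero>\<close>. The outer cutoff keeps \<open>?f\<close> in the carrier at
    every index, as the splitting lemma requires.\<close>
  let ?f = "\<lambda>i. if i < Suc (length Us) then (if i < Suc (length Ks) then (k # Ks) ! i else \<zero>) \<otimes> (u # Us) ! i else \<zero>"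
  have mem: "i < length Ks \<Longrightarrow> Ks ! i \<in> carrier R" "i < length Us \<Longrightarrow> Us ! i \<in> carrier R" for i
    using 1 nth_mem by (auto simp: subset_iff)
  have f: "?f i \<in> carrier R" for i
    using 1 mem by (cases i) auto
  have "(\<Oplus>i\<in>{..<length (u # Us)}. (if i < length (k # Ks) then (k # Ks) ! i else \<zero>) \<otimes> (u # Us) ! i)
     = (\<Oplus>i\<in>{..<1 + length Us}. ?f i)"
    using f by (intro finsum_cong') (auto split: if_splits)
  also have "\<dots> = (\<Oplus>i\<in>{..<1}. ?f i) \<oplus> (\<Oplus>i\<in>{..<length Us}. ?f (1 + i))"
    by (rule finsum_lessThan_add[OF f])
  also have "(\<Oplus>i\<in>{..<1}. ?f i) = k \<otimes> u"
    using finsum_lessThan_Suc[of ?f 0, OF f] 1 by simp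
  also have "(\<Oplus>i\<in>{..<length Us}. ?f (1 + i)) = (\<Oplus>i\<in>{..<length Us}. (if i < length Ks then Ks ! i else \<zero>) \<otimes> Us ! i)"
    using 1 mem by (intro finsum_cong') auto
  finally show ?case using 1 by simp
next
  case ("2_1" Us)
  have "(\<Oplus>i\<in>{..<length Us}. (if i < length [] then [] ! i else \<zero>) \<otimes> Us ! i) = (\<Oplus>i\<in>{..<length Us}. \<zero>)"
    using "2_1" nth_mem[of _ Us] by (intro finsum_cong') (auto simp: subset_iff)
  then show ?case by simp
next
  case ("2_2" Ks)
  then show ?case by simp
qed

lemma (in finite_field_ext) pow_add_periods:
  assumes "x \<in> carrier R"
  shows "x [^] (q ^ (i + n)) = x [^] (q ^ i)"
proof -
  have "x [^] (q ^ (i + n)) = (x [^] (q ^ n)) [^] (q ^ i)"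
    using assms by (simp add: nat_pow_pow power_add mult.commute)
  then show ?thesis using pow_qn[OF assms] by simp
qed

text \<open>The roots of unity in the resolvents need not lie in \<open>R\<close>. \<open>E\<close>
  is the algebraic closure in the general argument and \<open>R\<close> itself, with
  \<open>h\<close> the identity, in the Kummer extensions.\<close>

locale finite_field_hom = finite_field_ext R q n p e for R (structure) and q n p e +
  fixes E :: "('c, 'd) ring_scheme" and h :: "'a \<Rightarrow> 'c"
  assumes field_E: "field E" and hom_h: "h \<in> ring_hom R E"
begin

sublocale E: field E
  by (rule field_E)

sublocale h: ring_hom_cring R E h
  by unfold_locales (rule hom_h)

lemma h_eq_iff: "x \<in> carrier R \<Longrightarrow> y \<in> carrier R \<Longrightarrow> h x = h y \<longleftrightarrow> x = y"
  using non_trivial_field_hom_is_inj[OF hom_h] field_axioms field_E by (auto simp: inj_on_def)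

lemma h_eq_zero_iff: "x \<in> carrier R \<Longrightarrow> h x = \<zero>\<^bsub>E\<^esub> \<longleftrightarrow> x = \<zero>"
  using h_eq_iff[of x \<zero>] by simp

lemma char_E: "[p] \<cdot>\<^bsub>E\<^esub> \<one>\<^bsub>E\<^esub> = \<zero>\<^bsub>E\<^esub>"
proof -
  have "h ([k] \<cdot> \<one>) = [k] \<cdot>\<^bsub>E\<^esub> \<one>\<^bsub>E\<^esub>" for k :: nat
    by (induction k) simp_all
  from this[of p] show ?thesis by (simp add: char_p)
qed

text \<open>From a Bezout identity \<open>m * x = p * y + 1\<close>, vanishing of \<open>m\<close>
  in \<open>E\<close> would give \<open>1 = 0\<close>.\<close>

lemma nat_E_nonzero:
  assumes "coprime m p"
  shows "[m] \<cdot>\<^bsub>E\<^esub> \<one>\<^bsub>E\<^esub> \<noteq> \<zero>\<^bsub>E\<^esub>"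
proof
  assume 0: "[m] \<cdot>\<^bsub>E\<^esub> \<one>\<^bsub>E\<^esub> = \<zero>\<^bsub>E\<^esub>"
  have p0: "m \<noteq> 0" using assms prime_p by (intro notI) auto
  obtain x y where xy: "m * x = p * y + 1"
    using bezout_nat[OF p0, of p] assms by auto
  have "[(m * x)] \<cdot>\<^bsub>E\<^esub> \<one>\<^bsub>E\<^esub> = \<zero>\<^bsub>E\<^esub>" "[(p * y)] \<cdot>\<^bsub>E\<^esub> \<one>\<^bsub>E\<^esub> = \<zero>\<^bsub>E\<^esub>"
    using E.nat_add_pow_char[OF 0, of "m * x"] E.nat_add_pow_char[OF char_E, of "p * y"] by auto
  then have "\<one>\<^bsub>E\<^esub> = \<zero>\<^bsub>E\<^esub>" unfolding xy by simp
  then show False by simp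
qed

lemma finsum_E_frob:
  assumes "finite A" "f \<in> A \<rightarrow> carrier E"
  shows "(\<Oplus>\<^bsub>E\<^esub>i\<in>A. f i) [^]\<^bsub>E\<^esub> (q ^ j) = (\<Oplus>\<^bsub>E\<^esub>i\<in>A. f i [^]\<^bsub>E\<^esub> (q ^ j))"
  using E.finsum_pow_prime_power[OF assms prime_p char_E, of "e * j"] by (simp add: q_eq power_mult)

text \<open>
  These resolvents detect normality: \<open>x\<close> is normal over the subfield with \<open>q ^ l\<close> elements iff
  \<open>frob_sum l z x \<noteq> 0\<close> for all \<open>z\<close> with \<open>z ^ (n div l) = 1\<close>.
\<close>

definition frob_sum :: "nat \<Rightarrow> 'c \<Rightarrow> 'a \<Rightarrow> 'c" where
  "frob_sum l z x = (\<Oplus>\<^bsub>E\<^esub>i\<in>{..<n div l}. z [^]\<^bsub>E\<^esub> i \<otimes>\<^bsub>E\<^esub> h x [^]\<^bsub>E\<^esub> (q ^ (l * i)))"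

lemma frob_sum_closed: "z \<in> carrier E \<Longrightarrow> x \<in> carrier R \<Longrightarrow> frob_sum l z x \<in> carrier E"
  unfolding frob_sum_def by (auto intro!: E.finsum_closed)

lemma frob_sum_add:
  assumes "z \<in> carrier E" "x \<in> carrier R" "y \<in> carrier R"
  shows "frob_sum l z (x \<oplus> y) = frob_sum l z x \<oplus>\<^bsub>E\<^esub> frob_sum l z y"
proof -
  have "h (x \<oplus> y) [^]\<^bsub>E\<^esub> (q ^ j) = h x [^]\<^bsub>E\<^esub> (q ^ j) \<oplus>\<^bsub>E\<^esub> h y [^]\<^bsub>E\<^esub> (q ^ j)" for j
  proof -
    have "h (x \<oplus> y) [^]\<^bsub>E\<^esub> (q ^ j) = h ((x \<oplus> y) [^] (q ^ j))"
      using assms by (intro h.hom_pow[symmetric]) auto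
    also have "\<dots> = h (x [^] (q ^ j)) \<oplus>\<^bsub>E\<^esub> h (y [^] (q ^ j))"
      using assms by (simp only: frob_add h.hom_add nat_pow_closed)
    finally show ?thesis using assms by (simp only: h.hom_pow)
  qed
  then have "frob_sum l z (x \<oplus> y) = (\<Oplus>\<^bsub>E\<^esub>i\<in>{..<n div l}. z [^]\<^bsub>E\<^esub> i \<otimes>\<^bsub>E\<^esub> h x [^]\<^bsub>E\<^esub> (q ^ (l * i)) \<oplus>\<^bsub>E\<^esub>
     z [^]\<^bsub>E\<^esub> i \<otimes>\<^bsub>E\<^esub> h y [^]\<^bsub>E\<^esub> (q ^ (l * i)))"
    unfolding frob_sum_def using assms
    by (intro E.finsum_cong') (auto simp: E.r_distr simp del: h.hom_add)
  then show ?thesis unfolding frob_sum_def using assms by (simp add: E.finsum_addf)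
qed

lemma frob_sum_scale:
  assumes "z \<in> carrier E" "x \<in> carrier R" "a \<in> fixed_field l"
  shows "frob_sum l z (a \<otimes> x) = h a \<otimes>\<^bsub>E\<^esub> frob_sum l z x"
proof -
  have a: "a \<in> carrier R" using assms by (simp add: fixed_field_def)
  have "a [^] (q ^ (l * i)) = a" for i
    using fixed_field_mono[of l "l * i"] assms by (auto simp: fixed_field_def)
  then have "h a [^]\<^bsub>E\<^esub> (q ^ (l * i)) = h a" for i using h.hom_pow[OF a] by metis
  then have "frob_sum l z (a \<otimes> x) = (\<Oplus>\<^bsub>E\<^esub>i\<in>{..<n div l}. h a \<otimes>\<^bsub>E\<^esub> (z [^]\<^bsub>E\<^esub> i \<otimes>\<^bsub>E\<^esub> h x [^]\<^bsub>E\<^esub> (q ^ (l * i))))"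
    unfolding frob_sum_def using assms a
    by (intro E.finsum_cong') (auto simp: E.nat_pow_distrib E.m_lcomm)
  then show ?thesis unfolding frob_sum_def using assms a by (simp add: E.finsum_rdistr)
qed

text \<open>The exponents \<open>q ^ (l * i)\<close> are distinct and, one degenerate field aside,
  smaller than the order of \<open>gen\<close>.\<close>

lemma inj_gen_frob:
  assumes "l > 0" "l dvd n"
  shows "inj_on (\<lambda>i. gen [^] (q ^ (l * i))) {..<n div l}"
proof (rule inj_onI)
  fix i j assume ij: "i \<in> {..<n div l}" "j \<in> {..<n div l}"
    and eq: "gen [^] (q ^ (l * i)) = gen [^] (q ^ (l * j))"
  \<comment> \<open>In the field with two elements \<open>q ^ 0\<close> equals the order
    \<open>q ^ n - 1\<close>; there \<open>n = 1\<close> leaves a single index.\<close>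
  have lt: "q ^ (l * i) < q ^ n - 1 \<or> (q ^ (l * i) = q ^ n - 1 \<and> q = 2 \<and> n = 1)" if "i \<in> {..<n div l}" for i
  proof -
    have "l * Suc i \<le> l * (n div l)" using that by (intro mult_le_mono2) auto
    then have "l * i \<le> n - 1" using assms by simp
    then have 1: "q ^ (l * i) \<le> q ^ (n - 1)" using q_gt_1 by (intro power_increasing) auto
    have 2: "q ^ n = q * q ^ (n - 1)" using n_pos by (cases n) auto
    have "q * q ^ (n - 1) \<ge> 2 * q ^ (n - 1)" using q_gt_1 by (intro mult_le_mono1) auto
    moreover have "q ^ (n - 1) \<ge> 1" using q_gt_1 by simp
    moreover have "n = 1 \<and> q = 2" if "q ^ n - 1 = q ^ (n - 1)"
    proof -
      have "q * q ^ (n - 1) = q ^ (n - 1) + 1" using that 2 qn_gt_1 by linarith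
      then have "(q - 1) * q ^ (n - 1) = 1" using q_gt_1 by (simp add: diff_mult_distrib)
      then have "q - 1 = 1" "q ^ (n - 1) = 1" by auto
      then show ?thesis using q_gt_1 n_pos by auto
    qed
    moreover have "q ^ n - 1 = q ^ (n - 1)" if "q ^ (l * i) = q ^ n - 1"
      using that 1 2 calculation by linarith
    moreover have "q ^ (l * i) < q ^ n - 1" if "q ^ (l * i) \<noteq> q ^ n - 1"
      using that 1 2 calculation by linarith
    ultimately show ?thesis by blast
  qed
  show "i = j"
  proof (cases "n = 1")
    case True
    then have "l = 1" using assms by simp
    then show ?thesis using ij True by simp
  next
    case False
    then have "q ^ (l * i) = q ^ (l * j)" using eq lt ij by (auto simp: gen_pow_eq_iff)
    then show ?thesis using q_gt_1 assms by simp
  qed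
qed

text \<open>A resolvent vanishing on all powers of \<open>gen\<close> is a Vandermonde system in the
  distinct conjugates of \<open>gen\<close>. Its coefficients \<open>z ^ i\<close> would all vanish,
  but the one at \<open>i = 0\<close> is \<open>1\<close>.\<close>

lemma frob_sum_nonzero:
  assumes l: "l > 0" "l dvd n" and z: "z \<in> carrier E"
  shows "\<exists>x\<in>carrier R. frob_sum l z x \<noteq> \<zero>\<^bsub>E\<^esub>"
proof (rule ccontr)
  assume "\<not> ?thesis"
  then have 0: "frob_sum l z x = \<zero>\<^bsub>E\<^esub>" if "x \<in> carrier R" for x using that by blast
  have N: "n div l > 0" using l n_pos by (auto simp: div_greater_zero_iff dvd_imp_le)
  have "\<forall>i\<in>{..<n div l}. z [^]\<^bsub>E\<^esub> i = \<zero>\<^bsub>E\<^esub>"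
  proof (rule E.vandermonde_trivial_kernel)
    show "inj_on (\<lambda>i. h gen [^]\<^bsub>E\<^esub> (q ^ (l * i))) {..<n div l}"
    proof (rule inj_onI)
      fix i j assume ij: "i \<in> {..<n div l}" "j \<in> {..<n div l}"
        and "h gen [^]\<^bsub>E\<^esub> (q ^ (l * i)) = h gen [^]\<^bsub>E\<^esub> (q ^ (l * j))"
      then have "h (gen [^] (q ^ (l * i))) = h (gen [^] (q ^ (l * j)))"
        using gen by (simp only: h.hom_pow)
      then have "gen [^] (q ^ (l * i)) = gen [^] (q ^ (l * j))"
        using gen by (subst (asm) h_eq_iff) auto
      then show "i = j" using inj_gen_frob[OF l] ij by (auto dest: inj_onD)
    qed
    fix k :: nat
    have "(\<Oplus>\<^bsub>E\<^esub>i\<in>{..<n div l}. z [^]\<^bsub>E\<^esub> i \<otimes>\<^bsub>E\<^esub> (h gen [^]\<^bsub>E\<^esub> (q ^ (l * i))) [^]\<^bsub>E\<^esub> k) = frob_sum l z (gen [^] k)"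
      unfolding frob_sum_def using gen z
      by (intro E.finsum_cong') (auto simp: h.hom_pow E.nat_pow_pow mult.commute)
    also have "\<dots> = \<zero>\<^bsub>E\<^esub>" using 0 gen by simp
    finally show "(\<Oplus>\<^bsub>E\<^esub>i\<in>{..<n div l}. z [^]\<^bsub>E\<^esub> i \<otimes>\<^bsub>E\<^esub> (h gen [^]\<^bsub>E\<^esub> (q ^ (l * i))) [^]\<^bsub>E\<^esub> k) = \<zero>\<^bsub>E\<^esub>" .
  qed (use gen z in auto)
  then have "z [^]\<^bsub>E\<^esub> (0::nat) = \<zero>\<^bsub>E\<^esub>" using N by blast
  then show False by simp
qed

text \<open>A dependence of the conjugates over \<open>K\<^sub>l\<close>, raised to the powers
  \<open>q ^ (l * j)\<close>, keeps its coefficients and so holds at every shift of the conjugates.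
  The lemma on cyclic relations then produces a vanishing resolvent.\<close>

lemma normal_elementI:
  assumes l: "l > 0" "l dvd n" and N: "n div l = m * p ^ a" and m: "m > 0" "coprime m p"
    and z: "E.root_of_unity m z" and x: "x \<in> carrier R"
    and nz: "\<And>k. k < m \<Longrightarrow> frob_sum l (z [^]\<^bsub>E\<^esub> k) x \<noteq> \<zero>\<^bsub>E\<^esub>"
  shows "normal_element R q n l x"
proof -
  define N where "N = n div l"
  define K where "K = subfield_of_card R (q ^ l)"
  define conjs where "conjs = map (\<lambda>i. x [^] (q ^ (l * i))) [0..<N]"
  have KF: "K = fixed_field l" unfolding K_def by (rule subfield_of_card_eq[OF l])
  have subK: "subfield K R" unfolding KF by (rule subfield_fixed_field[OF l])
  have KR: "K \<subseteq> carrier R" by (auto simp: KF fixed_field_def)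
  have conjsR: "set conjs \<subseteq> carrier R" using x by (auto simp: conjs_def)
  have len: "length conjs = N" by (simp add: conjs_def)
  have lN: "l * N = n" using l by (simp add: N_def)
  have N0: "N > 0" using lN n_pos by (cases N) auto
  have zc: "z \<in> carrier E" using z by (simp add: E.root_of_unity_def)
  have indep: "independent K conjs"
  proof (rule trivial_combine_imp_independent[OF subK conjsR], rule ccontr)
    fix Ks assume Ks: "set Ks \<subseteq> K" and comb: "combine Ks conjs = \<zero>"
      and "\<not> set (take (length conjs) Ks) \<subseteq> {\<zero>}"
    then obtain y where y: "y \<in> set (take N Ks)" "y \<noteq> \<zero>" unfolding len by blast
    then obtain i0 where i0: "i0 < N" "i0 < length Ks" "Ks ! i0 \<noteq> \<zero>"
      by (auto simp: in_set_conv_nth)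
    \<comment> \<open>The coefficient list is padded with zeros up to \<open>N\<close> and continued
      periodically.\<close>
    define d where "d i = (if i mod N < length Ks then Ks ! (i mod N) else \<zero>)" for i
    have dK: "d i \<in> K" for i
      using Ks nth_mem[of "i mod N" Ks] subringE(2)[OF subfieldE(1)[OF subK]] by (auto simp: d_def)
    have dR: "d i \<in> carrier R" for i using dK KR by blast
    have "\<exists>k<m. (\<Oplus>\<^bsub>E\<^esub>i\<in>{..<N}. z [^]\<^bsub>E\<^esub> (k * i) \<otimes>\<^bsub>E\<^esub> h x [^]\<^bsub>E\<^esub> (q ^ (l * i))) = \<zero>\<^bsub>E\<^esub>"
    proof (rule E.cyclic_relation_imp_fourier_zero[OF prime_p char_E z m(1) nat_E_nonzero[OF m(2)]])
      show "N = m * p ^ a" using N by (simp add: N_def)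
      show "h x [^]\<^bsub>E\<^esub> (q ^ (l * (i + N))) = h x [^]\<^bsub>E\<^esub> (q ^ (l * i))" for i
        using pow_add_periods[OF x, of "l * i"] h.hom_pow[OF x] by (metis distrib_left lN)
      show "h (d i0) \<noteq> \<zero>\<^bsub>E\<^esub>" using i0 h_eq_zero_iff[OF dR[of i0]] by (simp add: d_def)
      show "h (d (i + N)) = h (d i)" for i by (simp add: d_def)
      have fR: "(\<lambda>i. d i \<otimes> x [^] (q ^ (l * i))) \<in> {..<N} \<rightarrow> carrier R" using dR x by auto
      have "(\<Oplus>i\<in>{..<N}. d i \<otimes> x [^] (q ^ (l * i))) = combine Ks conjs"
        using Ks KR conjsR nth_mem[of _ Ks] x
        by (subst combine_eq_finsum) (auto simp: len d_def conjs_def subset_iff intro!: finsum_cong')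
      then have "h (\<Oplus>i\<in>{..<N}. d i \<otimes> x [^] (q ^ (l * i))) = \<zero>\<^bsub>E\<^esub>" using comb by simp
      then have sum0: "(\<Oplus>\<^bsub>E\<^esub>i\<in>{..<N}. h (d i \<otimes> x [^] (q ^ (l * i)))) = \<zero>\<^bsub>E\<^esub>"
        using h.hom_finsum[OF fR] by (simp add: comp_def)
      fix j
      have hd: "h (d i) [^]\<^bsub>E\<^esub> (q ^ (l * j)) = h (d i)" for i
      proof -
        have "d i \<in> fixed_field (l * j)" using fixed_field_mono[of l "l * j"] dK[of i] unfolding KF by auto
        then have "d i [^] (q ^ (l * j)) = d i" by (simp add: fixed_field_def)
        then show ?thesis using h.hom_pow[OF dR[of i]] by metis
      qed
      have "(\<Oplus>\<^bsub>E\<^esub>i\<in>{..<N}. h (d i) \<otimes>\<^bsub>E\<^esub> h x [^]\<^bsub>E\<^esub> (q ^ (l * (i + j))))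
          = (\<Oplus>\<^bsub>E\<^esub>i\<in>{..<N}. h (d i \<otimes> x [^] (q ^ (l * i))) [^]\<^bsub>E\<^esub> (q ^ (l * j)))"
        using dR x hd
        by (intro E.finsum_cong') (auto simp: E.nat_pow_distrib h.hom_pow E.nat_pow_pow distrib_left power_add)
      also have "\<dots> = (\<Oplus>\<^bsub>E\<^esub>i\<in>{..<N}. h (d i \<otimes> x [^] (q ^ (l * i)))) [^]\<^bsub>E\<^esub> (q ^ (l * j))"
        using dR x by (intro finsum_E_frob[symmetric]) auto
      also have "\<dots> = \<zero>\<^bsub>E\<^esub>" unfolding sum0 using q_gt_1 by (simp add: E.nat_pow_zero)
      finally show "(\<Oplus>\<^bsub>E\<^esub>i\<in>{..<N}. h (d i) \<otimes>\<^bsub>E\<^esub> h x [^]\<^bsub>E\<^esub> (q ^ (l * (i + j)))) = \<zero>\<^bsub>E\<^esub>" .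
    qed (use dR x in auto)
    then obtain k where k: "k < m"
      "(\<Oplus>\<^bsub>E\<^esub>i\<in>{..<N}. z [^]\<^bsub>E\<^esub> (k * i) \<otimes>\<^bsub>E\<^esub> h x [^]\<^bsub>E\<^esub> (q ^ (l * i))) = \<zero>\<^bsub>E\<^esub>" by blast
    then show False using nz[OF k(1)] zc by (simp add: frob_sum_def N_def E.nat_pow_pow)
  qed
  define S where "S = {Ks. set Ks \<subseteq> K \<and> length Ks = N}"
  have finK: "finite K" using KR finite_carrier finite_subset by blast
  \<comment> \<open>Spanning follows by counting: independence makes the
    \<open>(q ^ l) ^ N = q ^ n\<close> combinations distinct.\<close>
  have "inj_on (\<lambda>Ks. combine Ks conjs) S"
  proof (rule inj_onI)
    fix Ks Ls assume S: "Ks \<in> S" "Ls \<in> S" and eq: "combine Ks conjs = combine Ls conjs"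
    have "combine Ks conjs \<in> Span K conjs"
      using S Span_eq_combine_set_length_version[OF subK conjsR] by (auto simp: S_def len)
    from unique_decomposition[OF subK indep this] S eq show "Ks = Ls"
      unfolding S_def len by blast
  qed
  then have "card ((\<lambda>Ks. combine Ks conjs) ` S) = card S" by (rule card_image)
  also have "\<dots> = card K ^ N" unfolding S_def by (rule card_lists_length_eq[OF finK])
  also have "\<dots> = card (carrier R)"
    using card_fixed_field[OF l] by (simp add: KF card_carrier lN power_mult[symmetric])
  finally have cardS: "card ((\<lambda>Ks. combine Ks conjs) ` S) = card (carrier R)" .
  have "(\<lambda>Ks. combine Ks conjs) ` S = Span K conjs"
    using Span_eq_combine_set_length_version[OF subK conjsR] by (auto simp: S_def len)
  then have "Span K conjs = carrier R"
    using cardS Span_in_carrier[OF KR conjsR] finite_carrier by (intro card_subset_eq) auto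
  then show ?thesis
    using indep x by (simp add: normal_element_def Let_def K_def conjs_def N_def)
qed

text \<open>
  Let \<open>\<eta> ^ l = \<zeta>\<close> with \<open>\<zeta>\<close> in the ground field. Summing over the residues modulo \<open>l\<close>, the level \<open>1\<close>
  resolvent of \<open>\<eta>\<close> is the combination with coefficients \<open>\<eta> ^ j\<close> of the \<open>q ^ j\<close>-th powers of the
  level \<open>l\<close> resolvent of \<open>\<zeta>\<close>.
\<close>

lemma frob_sum_level_one:
  assumes l: "l > 0" "n = l * N" "l = l' * p ^ b" and m: "m > 0" "coprime m p" "m dvd q - 1"
    and z: "E.root_of_unity m z" and x: "x \<in> carrier R"
    and zero: "frob_sum l (z [^]\<^bsub>E\<^esub> (l' * k)) x = \<zero>\<^bsub>E\<^esub>"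
  shows "\<exists>k'<m. frob_sum 1 (z [^]\<^bsub>E\<^esub> k') x = \<zero>\<^bsub>E\<^esub>"
proof -
  have zc: "z \<in> carrier E" using z by (simp add: E.root_of_unity_def)
  have Nl: "n div l = N" using l by simp
  have "coprime (p ^ b) m" using m by (simp add: coprime_commute)
  \<comment> \<open>\<open>s\<close> inverts \<open>p ^ b\<close> modulo \<open>m\<close>, so that
    \<open>\<eta> = z ^ (k * s)\<close> satisfies \<open>\<eta> ^ l = z ^ (l' * k)\<close>.\<close>
  then obtain s where s: "[p ^ b * s = 1] (mod m)" using cong_solve_coprime_nat[of "p ^ b" m] by auto
  define k' where "k' = (k * s) mod m"
  have zk': "(z [^]\<^bsub>E\<^esub> k') [^]\<^bsub>E\<^esub> i = z [^]\<^bsub>E\<^esub> (k * s * i)" for i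
  proof -
    have "(z [^]\<^bsub>E\<^esub> k') [^]\<^bsub>E\<^esub> i = (z [^]\<^bsub>E\<^esub> (k * s)) [^]\<^bsub>E\<^esub> i"
      unfolding k'_def E.root_of_unity_pow_mod[OF z] ..
    then show ?thesis using zc by (simp add: E.nat_pow_pow)
  qed
  have congz: "z [^]\<^bsub>E\<^esub> i = z [^]\<^bsub>E\<^esub> j" if "[i = j] (mod m)" for i j
    using E.root_of_unity_pow_mod[OF z, of i] E.root_of_unity_pow_mod[OF z, of j] that by (simp add: cong_def)
  \<comment> \<open>As \<open>m\<close> divides \<open>q - 1\<close>, powers of \<open>z\<close> are
    fixed by the \<open>q\<close>-th power map, which therefore moves only the conjugates of
    \<open>x\<close>.\<close>
  have q1: "[q ^ j = 1] (mod m)" for j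
  proof -
    have "[q = 1] (mod m)" using m(3) q_gt_1 by (metis cong_altdef_nat less_imp_le)
    then show ?thesis using cong_pow[of q 1 m j] by simp
  qed
  let ?f = "\<lambda>t. z [^]\<^bsub>E\<^esub> (k * s * t) \<otimes>\<^bsub>E\<^esub> h x [^]\<^bsub>E\<^esub> (q ^ t)"
  let ?g = "\<lambda>i. z [^]\<^bsub>E\<^esub> (l' * k * i) \<otimes>\<^bsub>E\<^esub> h x [^]\<^bsub>E\<^esub> (q ^ (l * i))"
  have zero': "(\<Oplus>\<^bsub>E\<^esub>i\<in>{..<N}. ?g i) = \<zero>\<^bsub>E\<^esub>"
    using zero zc by (simp add: frob_sum_def Nl E.nat_pow_pow)
  have "frob_sum 1 (z [^]\<^bsub>E\<^esub> k') x = (\<Oplus>\<^bsub>E\<^esub>t\<in>{..<n}. ?f t)"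
    by (simp add: frob_sum_def zk')
  also have "{..<n} = {..<l * N}" using l(2) by simp
  also have "(\<Oplus>\<^bsub>E\<^esub>t\<in>{..<l * N}. ?f t) = (\<Oplus>\<^bsub>E\<^esub>j\<in>{..<l}. \<Oplus>\<^bsub>E\<^esub>i\<in>{..<N}. ?f (j + i * l))"
    using zc x by (intro E.finsum_lessThan_mult) auto
  also have "\<dots> = (\<Oplus>\<^bsub>E\<^esub>j\<in>{..<l}. \<zero>\<^bsub>E\<^esub>)"
  proof (intro E.finsum_cong')
    fix j
    have "(\<Oplus>\<^bsub>E\<^esub>i\<in>{..<N}. ?f (j + i * l)) = (\<Oplus>\<^bsub>E\<^esub>i\<in>{..<N}. z [^]\<^bsub>E\<^esub> (k * s * j) \<otimes>\<^bsub>E\<^esub> ?g i [^]\<^bsub>E\<^esub> (q ^ j))"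
    proof (intro E.finsum_cong')
      fix i
      have "[k * s * (j + i * l) = k * s * j + l' * k * i * q ^ j] (mod m)"
      proof -
        have "[k * s * j + l' * k * i * (p ^ b * s) = k * s * j + l' * k * i * q ^ j] (mod m)"
          using s q1[of j] by (intro cong_add cong_mult) (auto simp: cong_def)
        then show ?thesis by (simp add: l(3) algebra_simps)
      qed
      then have "z [^]\<^bsub>E\<^esub> (k * s * (j + i * l)) = z [^]\<^bsub>E\<^esub> (k * s * j) \<otimes>\<^bsub>E\<^esub> (z [^]\<^bsub>E\<^esub> (l' * k * i)) [^]\<^bsub>E\<^esub> (q ^ j)"
        using congz zc by (simp add: E.nat_pow_pow E.nat_pow_mult)
      moreover have "h x [^]\<^bsub>E\<^esub> (q ^ (j + i * l)) = (h x [^]\<^bsub>E\<^esub> (q ^ (l * i))) [^]\<^bsub>E\<^esub> (q ^ j)"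
        using x by (simp add: E.nat_pow_pow power_add mult.commute)
      ultimately show "?f (j + i * l) = z [^]\<^bsub>E\<^esub> (k * s * j) \<otimes>\<^bsub>E\<^esub> ?g i [^]\<^bsub>E\<^esub> (q ^ j)"
        using zc x by (simp add: E.nat_pow_distrib E.m_assoc)
    qed (use zc x in auto)
    also have "\<dots> = z [^]\<^bsub>E\<^esub> (k * s * j) \<otimes>\<^bsub>E\<^esub> (\<Oplus>\<^bsub>E\<^esub>i\<in>{..<N}. ?g i [^]\<^bsub>E\<^esub> (q ^ j))"
      using zc x by (intro E.finsum_rdistr[symmetric]) auto
    also have "(\<Oplus>\<^bsub>E\<^esub>i\<in>{..<N}. ?g i [^]\<^bsub>E\<^esub> (q ^ j)) = (\<Oplus>\<^bsub>E\<^esub>i\<in>{..<N}. ?g i) [^]\<^bsub>E\<^esub> (q ^ j)"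
      using zc x by (intro finsum_E_frob[symmetric]) auto
    also have "\<dots> = \<zero>\<^bsub>E\<^esub>" unfolding zero' using q_gt_1 by (simp add: E.nat_pow_zero)
    finally show "(\<Oplus>\<^bsub>E\<^esub>i\<in>{..<N}. ?f (j + i * l)) = \<zero>\<^bsub>E\<^esub>" using zc by simp
  qed auto
  also have "\<dots> = \<zero>\<^bsub>E\<^esub>" by simp
  finally show ?thesis using m by (intro exI[of _ k']) (simp add: k'_def)
qed

end

subsection \<open>Character sums over hyperplanes\<close>

context finite_field_ext
begin

definition subspace_over :: "nat \<Rightarrow> 'a set \<Rightarrow> bool" where
  "subspace_over l V \<longleftrightarrow> V \<subseteq> carrier R \<and> \<zero> \<in> V \<and> (\<forall>x\<in>V. \<forall>y\<in>V. x \<oplus> y \<in> V) \<and>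
     (\<forall>a\<in>fixed_field l. \<forall>x\<in>V. a \<otimes> x \<in> V)"

lemma fixed_field_closed:
  assumes "l > 0" "l dvd n" "a \<in> fixed_field l" "b \<in> fixed_field l"
  shows "a \<oplus> b \<in> fixed_field l" "a \<ominus> b \<in> fixed_field l" "a \<otimes> b \<in> fixed_field l"
    "\<ominus> a \<in> fixed_field l" "a \<noteq> \<zero> \<Longrightarrow> inv a \<in> fixed_field l" "a \<in> carrier R"
    "\<zero> \<in> fixed_field l" "\<one> \<in> fixed_field l"
proof -
  note S = subfield_fixed_field[OF assms(1,2)]
  show "a \<oplus> b \<in> fixed_field l" "a \<otimes> b \<in> fixed_field l" "\<ominus> a \<in> fixed_field l"
     "\<zero> \<in> fixed_field l" "\<one> \<in> fixed_field l"
    using subringE[OF subfieldE(1)[OF S]] assms(3,4) by auto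
  then show "a \<ominus> b \<in> fixed_field l"
    using subringE[OF subfieldE(1)[OF S]] assms(3,4) by (auto simp: minus_eq)
  show "a \<in> carrier R" using assms(3) by (simp add: fixed_field_def)
  show "a \<noteq> \<zero> \<Longrightarrow> inv a \<in> fixed_field l"
    using subfield_m_inv(1)[OF S, of a] assms(3) by auto
qed

lemma subspace_over_closed:
  assumes "l > 0" "l dvd n" "subspace_over l V"
  shows "x \<in> V \<Longrightarrow> x \<in> carrier R" "\<zero> \<in> V" "x \<in> V \<Longrightarrow> y \<in> V \<Longrightarrow> x \<oplus> y \<in> V"
    "a \<in> fixed_field l \<Longrightarrow> x \<in> V \<Longrightarrow> a \<otimes> x \<in> V" "x \<in> V \<Longrightarrow> \<ominus> x \<in> V"
    "x \<in> V \<Longrightarrow> y \<in> V \<Longrightarrow> x \<ominus> y \<in> V"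
proof -
  show 1: "x \<in> V \<Longrightarrow> x \<in> carrier R" "\<zero> \<in> V" "x \<in> V \<Longrightarrow> y \<in> V \<Longrightarrow> x \<oplus> y \<in> V"
    "a \<in> fixed_field l \<Longrightarrow> x \<in> V \<Longrightarrow> a \<otimes> x \<in> V" for x y a
    using assms(3) by (auto simp: subspace_over_def)
  have m1: "\<ominus> \<one> \<in> fixed_field l"
    using fixed_field_closed(4,8)[OF assms(1,2)] fixed_field_closed(7)[OF assms(1,2)]
    subfield_fixed_field[OF assms(1,2)] subringE(3,5)[OF subfieldE(1)] by blast
  show 2: "x \<in> V \<Longrightarrow> \<ominus> x \<in> V" for x
    using 1(4)[OF m1, of x] 1(1)[of x] by (simp add: l_minus)
  show "x \<in> V \<Longrightarrow> y \<in> V \<Longrightarrow> x \<ominus> y \<in> V"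
    using 1(3)[of x "\<ominus> y"] 2[of y] by (simp add: minus_eq)
qed

text \<open>The map from \<open>U\<close> times the scalars sending \<open>(w, k)\<close> to
  \<open>w \<oplus> k \<otimes> u\<close> is a bijection onto \<open>V\<close>: two coefficients for
  one vector would put \<open>u\<close> into \<open>U\<close>, and \<open>ex\<close> gives
  surjectivity.\<close>

lemma card_subspace_step:
  assumes l: "l > 0" "l dvd n" and U: "subspace_over l U" and V: "subspace_over l V"
    and "U \<subseteq> V" and u: "u \<in> V" "u \<notin> U"
    and ex: "\<And>v. v \<in> V \<Longrightarrow> \<exists>k\<in>fixed_field l. v \<ominus> k \<otimes> u \<in> U"
  shows "card V = card U * q ^ l"
proof -
  let ?K = "fixed_field l"
  let ?f = "\<lambda>(w, k). w \<oplus> k \<otimes> u"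
  note cU = subspace_over_closed[OF l U] and cV = subspace_over_closed[OF l V]
    and cK = fixed_field_closed[OF l]
  have uR: "u \<in> carrier R" using u cV by blast
  have inj: "inj_on ?f (U \<times> ?K)"
  proof (rule inj_onI, clarsimp)
    fix w k w' k' assume a: "w \<in> U" "k \<in> ?K" "w' \<in> U" "k' \<in> ?K" and eq: "w \<oplus> k \<otimes> u = w' \<oplus> k' \<otimes> u"
    have car: "w \<in> carrier R" "w' \<in> carrier R" "k \<in> carrier R" "k' \<in> carrier R"
      using a cU(1) cK(6) by blast+
    have kk: "(k \<ominus> k') \<otimes> u = w' \<ominus> w"
    proof -
      have "k \<otimes> u = (w' \<oplus> k' \<otimes> u) \<ominus> w"
        using car uR unfolding eq[symmetric] by (simp add: minus_eq a_ac r_neg1 r_neg2)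
      then have "k \<otimes> u \<ominus> k' \<otimes> u = w' \<ominus> w"
        using car uR by (simp add: minus_eq a_ac r_neg)
      then show ?thesis using car uR by (simp add: minus_eq l_distr l_minus)
    qed
    have "k = k'"
    proof (rule ccontr)
      assume "k \<noteq> k'"
      define d where "d = k \<ominus> k'"
      have d: "d \<in> ?K" "d \<in> carrier R" "d \<noteq> \<zero>"
        using cK(2)[OF a(2,4)] car \<open>k \<noteq> k'\<close> by (auto simp: d_def)
      then have dU: "d \<in> Units R" by (simp add: field_Units)
      have "u = inv d \<otimes> (d \<otimes> u)" using dU uR d(2) by (simp add: m_assoc[symmetric])
      also have "d \<otimes> u = w' \<ominus> w" using kk by (simp add: d_def)
      finally have "u = inv d \<otimes> (w' \<ominus> w)" .
      then have "u \<in> U" using cU(4)[OF cK(5)[OF d(1) d(1) d(3)] cU(6)[OF a(3,1)]] by simp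
      then show False using u by simp
    qed
    moreover then have "w = w'" using eq car uR by simp
    ultimately show "w = w' \<and> k = k'" by simp
  qed
  have "?f ` (U \<times> ?K) = V"
  proof
    show "?f ` (U \<times> ?K) \<subseteq> V" using u \<open>U \<subseteq> V\<close> cV by auto
    show "V \<subseteq> ?f ` (U \<times> ?K)"
    proof
      fix v assume v: "v \<in> V"
      then obtain k where k: "k \<in> ?K" "v \<ominus> k \<otimes> u \<in> U" using ex by blast
      have "v = (v \<ominus> k \<otimes> u) \<oplus> k \<otimes> u"
        using v cV(1) cK(6)[OF k(1) k(1)] uR by (simp add: minus_eq a_assoc l_neg)
      then show "v \<in> ?f ` (U \<times> ?K)" using k by (intro image_eqI[of _ _ "(v \<ominus> k \<otimes> u, k)"]) auto
    qed
  qed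
  then have "card V = card (U \<times> ?K)" using card_image[OF inj] by simp
  then show ?thesis using card_fixed_field[OF l] by (simp add: card_cartesian_product)
qed

text \<open>A single vector \<open>y\<close> whose multiples complete \<open>H\<close> expresses
  codimension one without functionals or dimensions, in the very form that
  \<open>card_subspace_step\<close> needs.\<close>

definition hyperplane_over :: "nat \<Rightarrow> 'a set \<Rightarrow> bool" where
  "hyperplane_over l H \<longleftrightarrow> subspace_over l H \<and>
     (\<exists>y\<in>carrier R - H. \<forall>x\<in>carrier R. \<exists>k\<in>fixed_field l. x \<ominus> k \<otimes> y \<in> H)"

text \<open>A proper subspace of maximal cardinality above \<open>V\<close> works, since adjoining
  any missing vector to it must give the whole field.\<close>

lemma ex_hyperplane:
  assumes l: "l > 0" "l dvd n" and V: "subspace_over l V" "V \<noteq> carrier R"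
  shows "\<exists>H. V \<subseteq> H \<and> hyperplane_over l H"
proof -
  note cK = fixed_field_closed[OF l]
  define A where "A = {H. V \<subseteq> H \<and> subspace_over l H \<and> H \<noteq> carrier R}"
  have "A \<subseteq> Pow (carrier R)" by (auto simp: A_def subspace_over_def)
  then have "finite A" using finite_carrier finite_subset by blast
  moreover have "A \<noteq> {}" using V by (auto simp: A_def)
  ultimately obtain H where H: "H \<in> A" and max: "\<And>H'. H' \<in> A \<Longrightarrow> card H' \<le> card H"
    using obtains_MAX[of A card] by (metis Max_ge finite_imageI imageI)
  have HS: "subspace_over l H" and HV: "V \<subseteq> H" "H \<noteq> carrier R" using H by (auto simp: A_def)
  note cH = subspace_over_closed[OF l HS]
  obtain y where y: "y \<in> carrier R" "y \<notin> H" using HV HS by (auto simp: subspace_over_def)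
  define W where "W = {w \<oplus> k \<otimes> y | w k. w \<in> H \<and> k \<in> fixed_field l}"
  have KR: "k \<in> carrier R" if "k \<in> fixed_field l" for k using that by (simp add: fixed_field_def)
  have WS: "subspace_over l W"
    unfolding subspace_over_def
  proof (intro conjI ballI)
    show "W \<subseteq> carrier R" using y cH(1) KR by (auto simp: W_def)
    have "\<zero> = \<zero> \<oplus> \<zero> \<otimes> y" using y by simp
    then show "\<zero> \<in> W" unfolding W_def using cH(2) cK(7) V(1) subfield_fixed_field[OF l]
      subringE(2)[OF subfieldE(1)] by blast
  next
    fix a b assume "a \<in> W" "b \<in> W"
    then obtain w k w' k' where a: "a = w \<oplus> k \<otimes> y" "w \<in> H" "k \<in> fixed_field l"
      and b: "b = w' \<oplus> k' \<otimes> y" "w' \<in> H" "k' \<in> fixed_field l" unfolding W_def by blast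
    have "a \<oplus> b = (w \<oplus> w') \<oplus> (k \<oplus> k') \<otimes> y"
      using a b y cH(1) KR by (simp add: l_distr a_ac)
    then show "a \<oplus> b \<in> W" unfolding W_def using cH(3)[OF a(2) b(2)] cK(1)[OF a(3) b(3)] by blast
  next
    fix c a assume c: "c \<in> fixed_field l" and "a \<in> W"
    then obtain w k where a: "a = w \<oplus> k \<otimes> y" "w \<in> H" "k \<in> fixed_field l" unfolding W_def by blast
    have "c \<otimes> a = (c \<otimes> w) \<oplus> (c \<otimes> k) \<otimes> y"
      using a y cH(1) KR c by (simp add: r_distr m_assoc)
    then show "c \<otimes> a \<in> W" unfolding W_def using cH(4)[OF c a(2)] cK(3)[OF c a(3)] by blast
  qed
  have z: "\<zero> \<in> fixed_field l" and o: "\<one> \<in> fixed_field l"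
    using subringE(2,3)[OF subfieldE(1)[OF subfield_fixed_field[OF l]]] by auto
  have HW: "H \<subseteq> W"
  proof
    fix w assume w: "w \<in> H"
    then have "w = w \<oplus> \<zero> \<otimes> y" using y cH(1) by simp
    then show "w \<in> W" unfolding W_def using w z by blast
  qed
  have "y = \<zero> \<oplus> \<one> \<otimes> y" using y by simp
  then have yW: "y \<in> W" unfolding W_def using cH(2) o by blast
  have WR: "W \<subseteq> carrier R" using WS by (simp add: subspace_over_def)
  have "W = carrier R"
  proof (rule ccontr)
    assume "W \<noteq> carrier R"
    then have "card W \<le> card H" using HW HV WS by (intro max) (auto simp: A_def)
    moreover have "card H < card W"
      using HW yW y WR finite_carrier by (intro psubset_card_mono) (auto intro: finite_subset)
    ultimately show False by simp
  qed
  have "\<exists>k\<in>fixed_field l. x \<ominus> k \<otimes> y \<in> H" if x: "x \<in> carrier R" for x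
  proof -
    obtain w k where wk: "x = w \<oplus> k \<otimes> y" "w \<in> H" "k \<in> fixed_field l"
      using x \<open>W = carrier R\<close> unfolding W_def by blast
    have "x \<ominus> k \<otimes> y = w"
      using wk cH(1) KR y by (simp add: minus_eq a_assoc r_neg)
    then show ?thesis using wk by blast
  qed
  then show ?thesis using HV HS y unfolding hyperplane_over_def by blast
qed

lemma card_hyperplane:
  assumes "l > 0" "l dvd n" "hyperplane_over l H"
  shows "card H * q ^ l = q ^ n"
proof -
  obtain y where y: "y \<in> carrier R - H" "\<forall>x\<in>carrier R. \<exists>k\<in>fixed_field l. x \<ominus> k \<otimes> y \<in> H"
    and H: "subspace_over l H"
    using assms(3) by (auto simp: hyperplane_over_def)
  have "subspace_over l (carrier R)"
    using fixed_field_closed(6)[OF assms(1,2)] by (auto simp: subspace_over_def fixed_field_def)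
  from card_subspace_step[OF assms(1,2) H this, of y] y H show ?thesis
    by (auto simp: card_carrier subspace_over_def)
qed

text \<open>This is the difference set property. A factor \<open>c\<close> outside
  \<open>K\<^sub>l\<close> does not map \<open>H\<close> into itself, so the condition
  \<open>c \<otimes> x \<in> H\<close> is one nontrivial linear condition on
  \<open>H\<close>.\<close>

lemma card_hyperplane_Int_translate:
  assumes l: "l > 0" "l dvd n" and H: "hyperplane_over l H" and c: "c \<in> carrier R - fixed_field l"
  shows "card {x \<in> H. c \<otimes> x \<in> H} * q ^ l = card H"
proof -
  note cK = fixed_field_closed[OF l]
  obtain y where y: "y \<in> carrier R" "y \<notin> H" "\<forall>x\<in>carrier R. \<exists>k\<in>fixed_field l. x \<ominus> k \<otimes> y \<in> H"
    and HS: "subspace_over l H"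
    using H by (auto simp: hyperplane_over_def)
  note cH = subspace_over_closed[OF l HS]
  have KR: "k \<in> carrier R" if "k \<in> fixed_field l" for k using that by (simp add: fixed_field_def)
  have cR: "c \<in> carrier R" using c by simp
  define W where "W = {x \<in> H. c \<otimes> x \<in> H}"
  have WS: "subspace_over l W"
    unfolding subspace_over_def W_def
    using cH cR KR by (auto simp: r_distr m_lcomm)
  have "W \<noteq> H"
  proof
    assume "W = H"
    then have cHH: "c \<otimes> x \<in> H" if "x \<in> H" for x using that by (auto simp: W_def)
    \<comment> \<open>If \<open>H\<close> were stable under \<open>c\<close>, the nonzero factor
      \<open>c \<ominus> k\<close> would map \<open>insert y H\<close> injectively into
      \<open>H\<close>.\<close>
    obtain k where k: "k \<in> fixed_field l" "c \<otimes> y \<ominus> k \<otimes> y \<in> H" using y cR by blast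
    define d where "d = c \<ominus> k"
    have d: "d \<in> carrier R" "d \<noteq> \<zero>" using c k KR by (auto simp: d_def)
    have dy: "d \<otimes> y \<in> H" using k(2) cR KR[OF k(1)] y by (simp add: d_def minus_eq l_distr l_minus)
    have dH: "d \<otimes> x \<in> H" if "x \<in> H" for x
      using cH(6)[OF cHH[OF that] cH(4)[OF k(1) that]] cR KR[OF k(1)] cH(1)[OF that]
      by (simp add: d_def minus_eq l_distr l_minus)
    have "inj_on (\<lambda>x. d \<otimes> x) (insert y H)"
      using d y cH(1) by (intro inj_onI) (auto simp: m_lcancel)
    then have "card (insert y H) = card ((\<lambda>x. d \<otimes> x) ` insert y H)" by (rule card_image[symmetric])
    also have "\<dots> \<le> card H"
      using dy dH finite_subset[OF _ finite_carrier, of H] cH(1) by (intro card_mono) auto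
    finally have "card (insert y H) \<le> card H" .
    moreover have "finite H" using cH(1) by (intro finite_subset[OF _ finite_carrier]) auto
    ultimately show False using y(2) by simp
  qed
  then obtain u where u: "u \<in> H" "c \<otimes> u \<notin> H" by (auto simp: W_def)
  have uR: "u \<in> carrier R" using u cH(1) by blast
  obtain k0 where k0: "k0 \<in> fixed_field l" "c \<otimes> u \<ominus> k0 \<otimes> y \<in> H" using y uR cR by blast
  have k0n: "k0 \<noteq> \<zero>"
  proof
    assume "k0 = \<zero>"
    then have "c \<otimes> u \<in> H" using k0 cR uR y by (simp add: minus_eq)
    then show False using u by simp
  qed
  have k0R: "k0 \<in> carrier R" "k0 \<in> Units R" using KR k0 k0n by (auto simp: field_Units)
  have "card H = card W * q ^ l"
  proof (rule card_subspace_step[OF l WS HS])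
    show "W \<subseteq> H" by (auto simp: W_def)
    show "u \<in> H" by fact
    show "u \<notin> W" using u by (auto simp: W_def)
    fix v assume v: "v \<in> H"
    have vR: "v \<in> carrier R" using v cH(1) by blast
    obtain k where k: "k \<in> fixed_field l" "c \<otimes> v \<ominus> k \<otimes> y \<in> H" using y vR cR by blast
    have kR: "k \<in> carrier R" using KR k by blast
    \<comment> \<open>With this \<open>t\<close> the components along \<open>y\<close> of
      \<open>c \<otimes> v\<close> and \<open>t \<otimes> (c \<otimes> u)\<close> cancel.\<close>
    define t where "t = k \<otimes> inv k0"
    have t: "t \<in> fixed_field l" using cK(3)[OF k(1) cK(5)[OF k0(1) k0(1) k0n]] by (simp add: t_def)
    have tR: "t \<in> carrier R" using KR t by blast
    have tk: "t \<otimes> k0 = k" using kR k0R by (simp add: t_def m_assoc)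
    have 1: "v \<ominus> t \<otimes> u \<in> H" using cH(6)[OF v cH(4)[OF t u(1)]] .
    have "(c \<otimes> v \<ominus> k \<otimes> y) \<ominus> t \<otimes> (c \<otimes> u \<ominus> k0 \<otimes> y) \<in> H"
      using cH(6)[OF k(2) cH(4)[OF t k0(2)]] .
    also have "(c \<otimes> v \<ominus> k \<otimes> y) \<ominus> t \<otimes> (c \<otimes> u \<ominus> k0 \<otimes> y) = c \<otimes> (v \<ominus> t \<otimes> u)"
    proof -
      have "t \<otimes> (c \<otimes> u \<ominus> k0 \<otimes> y) = c \<otimes> (t \<otimes> u) \<ominus> k \<otimes> y"
        using tR cR uR k0R y kR tk by (simp add: minus_eq r_distr r_minus m_assoc[symmetric]) (simp add: m_comm[of t c])
      then show ?thesis
        using tR cR uR k0R y kR vR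
        by (simp add: minus_eq r_distr r_minus minus_add a_ac) (simp add: a_assoc[symmetric] r_neg l_neg)
    qed
    finally have 2: "c \<otimes> (v \<ominus> t \<otimes> u) \<in> H" .
    show "\<exists>k\<in>fixed_field l. v \<ominus> k \<otimes> u \<in> W" using 1 2 t by (auto simp: W_def)
  qed
  then show ?thesis by (simp add: W_def)
qed

text \<open>Values at \<open>\<zero>\<close> are left open, so all sums run over nonzero elements.
  Norm one makes \<open>cnj (c y)\<close> the inverse of \<open>c y\<close>, which lets quotients be
  formed.\<close>

definition mult_char :: "('a \<Rightarrow> complex) \<Rightarrow> bool" where
  "mult_char c \<longleftrightarrow> (\<forall>x\<in>carrier R - {\<zero>}. norm (c x) = 1) \<and>
     (\<forall>x\<in>carrier R - {\<zero>}. \<forall>y\<in>carrier R - {\<zero>}. c (x \<otimes> y) = c x * c y)"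

lemma sum_mult_char:
  assumes c: "mult_char c" and a: "a \<in> carrier R - {\<zero>}" "c a \<noteq> 1"
  shows "(\<Sum>x\<in>carrier R - {\<zero>}. c x) = 0"
proof -
  let ?G = "carrier R - {\<zero>}"
  have "bij_betw (\<lambda>x. a \<otimes> x) ?G ?G"
  proof (rule bij_betwI[where g = "\<lambda>x. inv a \<otimes> x"])
    have "inv a \<in> ?G" using a Units_inv_Units[of a] unfolding field_Units by blast
    then show "(\<lambda>x. inv a \<otimes> x) \<in> ?G \<rightarrow> ?G" using a integral by auto
    show "(\<lambda>x. a \<otimes> x) \<in> ?G \<rightarrow> ?G" using a integral by auto
  qed (use a in \<open>auto simp: m_assoc[symmetric] field_Units\<close>)
  then have "(\<Sum>x\<in>?G. c x) = (\<Sum>x\<in>?G. c (a \<otimes> x))" by (rule sum.reindex_bij_betw[symmetric])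
  also have "\<dots> = c a * (\<Sum>x\<in>?G. c x)"
    using c a by (auto simp: mult_char_def sum_distrib_left intro!: sum.cong)
  finally have "(1 - c a) * (\<Sum>x\<in>?G. c x) = 0" by (simp add: algebra_simps)
  then show ?thesis using a by auto
qed

text \<open>The squared modulus of the sum is the sum of \<open>c b\<close> over nonzero
  \<open>b\<close>, weighted by the number of nonzero \<open>y\<close> in \<open>H\<close> with
  \<open>b \<otimes> y \<in> H\<close>. That weight depends only on whether \<open>b\<close> lies in
  \<open>K\<^sub>l\<close>. Its constant part cancels by orthogonality, and the rest is a sum over
  \<open>K\<^sub>l\<close> alone, at most \<open>card K\<^sub>l * card H = q ^ n\<close>.\<close>

lemma hyperplane_char_bound:
  assumes l: "l > 0" "l dvd n" and H: "hyperplane_over l H"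
    and c: "mult_char c" and a: "a \<in> carrier R - {\<zero>}" "c a \<noteq> 1"
  shows "norm (\<Sum>x\<in>H - {\<zero>}. c x) \<le> sqrt (real (q ^ n))"
proof -
  let ?G = "carrier R - {\<zero>}"
  let ?K = "fixed_field l"
  define S where "S = (\<Sum>x\<in>H - {\<zero>}. c x)"
  \<comment> \<open>The size of \<open>{y \<in> H. b \<otimes> y \<in> H}\<close> for
    \<open>b\<close> outside \<open>K\<^sub>l\<close>. It is taken as a real number because for
    \<open>l = n\<close> the quotient is not an integer; then no such \<open>b\<close>
    exists.\<close>
  define B where "B = real (card H) / real (q ^ l)"
  have HS: "subspace_over l H" using H by (simp add: hyperplane_over_def)
  note cH = subspace_over_closed[OF l HS]
  have HR: "H \<subseteq> carrier R" using cH(1) by blast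
  have fH: "finite H" using finite_subset[OF HR finite_carrier] .
  have fG: "finite ?G" using finite_carrier by simp
  have KR: "?K \<subseteq> carrier R" by (auto simp: fixed_field_def)
  have ql: "real (q ^ l) > 0" using q_gt_1 by simp
  have c1: "c x * cnj (c x) = 1" if "x \<in> ?G" for x
    using that c complex_norm_square[of "c x"] by (simp add: mult_char_def)
  have cnt: "(of_nat (card {y \<in> H - {\<zero>}. b \<otimes> y \<in> H}) :: complex) =
      of_real (B - 1) + (if b \<in> ?K then of_real (real (card H) - B) else 0)" if b: "b \<in> ?G" for b
  proof -
    have sp: "{y \<in> H - {\<zero>}. b \<otimes> y \<in> H} = {y \<in> H. b \<otimes> y \<in> H} - {\<zero>}" by auto
    have z: "\<zero> \<in> {y \<in> H. b \<otimes> y \<in> H}" using b cH(2) by simp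
    have pos: "card {y \<in> H. b \<otimes> y \<in> H} \<ge> 1"
      using card_mono[of "{y \<in> H. b \<otimes> y \<in> H}" "{\<zero>}"] z fH by simp
    have "card {y \<in> H - {\<zero>}. b \<otimes> y \<in> H} = card {y \<in> H. b \<otimes> y \<in> H} - 1"
      unfolding sp using z fH by (intro card_Diff_singleton) auto
    then have 1: "real (card {y \<in> H - {\<zero>}. b \<otimes> y \<in> H}) = real (card {y \<in> H. b \<otimes> y \<in> H}) - 1"
      using pos by simp
    have "real (card {y \<in> H. b \<otimes> y \<in> H}) = (if b \<in> ?K then real (card H) else B)"
    proof (cases "b \<in> ?K")
      case True
      then have "{y \<in> H. b \<otimes> y \<in> H} = H" using cH(4) by blast
      then show ?thesis using True by simp
    next
      case False
      have "real (card {y \<in> H. b \<otimes> y \<in> H}) * real (q ^ l) = real (card H)"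
        using card_hyperplane_Int_translate[OF l H, of b] b False by (metis DiffD1 DiffI of_nat_mult)
      then show ?thesis using False ql by (simp add: B_def field_simps)
    qed
    then have "real (card {y \<in> H - {\<zero>}. b \<otimes> y \<in> H}) = (B - 1) + (if b \<in> ?K then real (card H) - B else 0)"
      using 1 by simp
    then have "complex_of_real (real (card {y \<in> H - {\<zero>}. b \<otimes> y \<in> H})) =
      complex_of_real ((B - 1) + (if b \<in> ?K then real (card H) - B else 0))" by simp
    then show ?thesis by (simp split: if_splits)
  qed
  have "S * cnj S = (\<Sum>x\<in>H - {\<zero>}. \<Sum>y\<in>H - {\<zero>}. c x * cnj (c y))"
    unfolding S_def by (simp add: sum_product)
  also have "\<dots> = (\<Sum>y\<in>H - {\<zero>}. \<Sum>x\<in>H - {\<zero>}. c x * cnj (c y))" by (rule sum.swap)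
  also have "\<dots> = (\<Sum>y\<in>H - {\<zero>}. \<Sum>b\<in>?G. if b \<otimes> y \<in> H then c b else 0)"
  proof (rule sum.cong[OF refl])
    fix y assume y: "y \<in> H - {\<zero>}"
    then have yG: "y \<in> ?G" using HR by blast
    then have yU: "y \<in> Units R" by (simp add: field_Units)
    have iy: "inv y \<in> ?G" using yU Units_inv_Units field_Units by blast
    have yc: "y \<in> carrier R" "inv y \<in> carrier R" "inv y \<otimes> y = \<one>" "y \<otimes> inv y = \<one>"
      using yG iy yU by auto
    have "(\<Sum>x\<in>H - {\<zero>}. c x * cnj (c y)) = (\<Sum>b\<in>{b \<in> ?G. b \<otimes> y \<in> H}. c b)"
    proof (rule sum.reindex_bij_witness[where i = "\<lambda>b. b \<otimes> y" and j = "\<lambda>x. x \<otimes> inv y"])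
      fix x assume x: "x \<in> H - {\<zero>}"
      then have xG: "x \<in> ?G" using HR by blast
      show "x \<otimes> inv y \<otimes> y = x" using xG yc by (simp add: m_assoc)
      then show "x \<otimes> inv y \<in> {b \<in> ?G. b \<otimes> y \<in> H}" using x xG iy integral by auto
      then have "c (x \<otimes> inv y \<otimes> y) = c (x \<otimes> inv y) * c y" using c yG unfolding mult_char_def by blast
      then have "c x = c (x \<otimes> inv y) * c y" using xG yc by (simp add: m_assoc)
      then show "c (x \<otimes> inv y) = c x * cnj (c y)" using c1[OF yG] by (simp add: mult.assoc)
    next
      fix b assume b: "b \<in> {b \<in> ?G. b \<otimes> y \<in> H}"
      show "b \<otimes> y \<otimes> inv y = b" using b yc by (simp add: m_assoc)
      show "b \<otimes> y \<in> H - {\<zero>}" using b yG integral by auto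
    qed
    also have "\<dots> = (\<Sum>b\<in>?G. if b \<otimes> y \<in> H then c b else 0)"
      using fG by (intro sum.inter_filter)
    finally show "(\<Sum>x\<in>H - {\<zero>}. c x * cnj (c y)) = (\<Sum>b\<in>?G. if b \<otimes> y \<in> H then c b else 0)" .
  qed
  also have "\<dots> = (\<Sum>b\<in>?G. \<Sum>y\<in>H - {\<zero>}. if b \<otimes> y \<in> H then c b else 0)" by (rule sum.swap)
  also have "\<dots> = (\<Sum>b\<in>?G. c b * of_nat (card {y \<in> H - {\<zero>}. b \<otimes> y \<in> H}))"
  proof (rule sum.cong[OF refl])
    fix b
    have "(\<Sum>y\<in>H - {\<zero>}. if b \<otimes> y \<in> H then c b else 0) = (\<Sum>y\<in>{y \<in> H - {\<zero>}. b \<otimes> y \<in> H}. c b)"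
      using fH by (intro sum.inter_filter[symmetric]) auto
    then show "(\<Sum>y\<in>H - {\<zero>}. if b \<otimes> y \<in> H then c b else 0) = c b * of_nat (card {y \<in> H - {\<zero>}. b \<otimes> y \<in> H})"
      by (simp add: mult.commute)
  qed
  also have "\<dots> = (\<Sum>b\<in>?G. c b * of_real (B - 1) + (if b \<in> ?K then c b * of_real (real (card H) - B) else 0))"
    using cnt by (intro sum.cong[OF refl]) (simp add: distrib_left)
  also have "\<dots> = (\<Sum>b\<in>?G. c b) * of_real (B - 1) + (\<Sum>b\<in>?G. if b \<in> ?K then c b * of_real (real (card H) - B) else 0)"
    by (simp add: sum.distrib sum_distrib_right)
  also have "(\<Sum>b\<in>?G. c b) = 0" by (rule sum_mult_char[OF c a])
  also have "(\<Sum>b\<in>?G. if b \<in> ?K then c b * of_real (real (card H) - B) else 0) =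
      (\<Sum>b\<in>?K - {\<zero>}. c b * of_real (real (card H) - B))"
  proof -
    have "{b \<in> ?G. b \<in> ?K} = ?K - {\<zero>}" using KR by blast
    then show ?thesis using sum.inter_filter[OF fG, of "\<lambda>b. c b * of_real (real (card H) - B)" "\<lambda>b. b \<in> ?K"] by simp
  qed
  finally have SS: "S * cnj S = (\<Sum>b\<in>?K - {\<zero>}. c b * of_real (real (card H) - B))" by simp
  have HB: "real (card H) - B \<ge> 0" "real (card H) - B \<le> real (card H)"
  proof -
    have "real (q ^ l) \<ge> 1" using q_gt_1 by (simp flip: of_nat_power)
    then have "B \<le> real (card H)" using ql by (simp add: B_def divide_le_eq mult_le_cancel_left1)
    then show "real (card H) - B \<ge> 0" by simp
    show "real (card H) - B \<le> real (card H)" by (simp add: B_def)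
  qed
  have "norm S ^ 2 = norm (S * cnj S)" by (simp add: norm_mult power2_eq_square)
  also have "\<dots> \<le> (\<Sum>b\<in>?K - {\<zero>}. norm (c b * of_real (real (card H) - B)))"
    unfolding SS by (rule norm_sum)
  also have "\<dots> \<le> (\<Sum>b\<in>?K - {\<zero>}. real (card H))"
  proof (rule sum_mono)
    fix b assume "b \<in> ?K - {\<zero>}"
    then have "norm (c b) = 1" using c KR by (auto simp: mult_char_def)
    then show "norm (c b * of_real (real (card H) - B)) \<le> real (card H)"
      using HB by (simp add: norm_mult del: of_real_diff)
  qed
  also have "\<dots> \<le> real (card ?K) * real (card H)"
    using card_mono[of ?K "?K - {\<zero>}"] finite_subset[OF KR finite_carrier] by (simp add: mult_right_mono)
  also have "\<dots> = real (q ^ n)"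
    using card_hyperplane[OF l H] card_fixed_field[OF l] by (metis mult.commute of_nat_mult)
  finally show ?thesis unfolding S_def[symmetric] by (simp add: real_le_rsqrt)
qed

end

subsection \<open>A sieve for primitive elements\<close>

definition unity_root :: "nat \<Rightarrow> complex" where
  "unity_root r = cis (2 * pi / real r)"

lemma unity_root_pow_eq_one_iff:
  assumes "r > 0"
  shows "unity_root r ^ k = 1 \<longleftrightarrow> r dvd k"
proof -
  have "unity_root r ^ k = cis (2 * pi * real k / real r)"
    by (simp add: unity_root_def DeMoivre mult_ac)
  also have "\<dots> = 1 \<longleftrightarrow> (\<exists>i::int. 2 * pi * real k / real r = of_int i * 2 * pi)"
  proof
    assume "cis (2 * pi * real k / real r) = 1"
    then have "cos (2 * pi * real k / real r) = 1" by (metis cis.simps(1) one_complex.simps(1))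
    then show "\<exists>i::int. 2 * pi * real k / real r = of_int i * 2 * pi" by (simp add: cos_one_2pi_int)
  next
    assume "\<exists>i::int. 2 * pi * real k / real r = of_int i * 2 * pi"
    then obtain i :: int where "2 * pi * real k / real r = 2 * pi * of_int i" by (auto simp: mult_ac)
    then show "cis (2 * pi * real k / real r) = 1" by (simp add: cis_multiple_2pi)
  qed
  also have "\<dots> \<longleftrightarrow> (\<exists>i::int. real k = of_int i * real r)"
    using assms by (simp add: field_simps)
  also have "\<dots> \<longleftrightarrow> (\<exists>i::int. int k = i * int r)"
  proof -
    have "real k = of_int i * real r \<longleftrightarrow> int k = i * int r" for i :: int
      by (metis of_int_eq_iff of_int_mult of_int_of_nat_eq)
    then show ?thesis by simp
  qed
  also have "\<dots> \<longleftrightarrow> r dvd k"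
    by (metis dvd_def int_dvd_int_iff mult.commute)
  finally show ?thesis .
qed

lemma norm_unity_root: "norm (unity_root r) = 1"
  by (simp add: unity_root_def)

lemma unity_root_pow_cong:
  assumes "r > 0" "[i = j] (mod r)"
  shows "unity_root r ^ i = unity_root r ^ j"
proof -
  have mod: "unity_root r ^ k = unity_root r ^ (k mod r)" for k
  proof -
    have "unity_root r ^ k = (unity_root r ^ r) ^ (k div r) * unity_root r ^ (k mod r)"
      by (simp add: power_mult[symmetric] power_add[symmetric])
    then show ?thesis using unity_root_pow_eq_one_iff[OF assms(1), of r] by simp
  qed
  show ?thesis using mod[of i] mod[of j] assms(2) by (simp add: cong_def)
qed

text \<open>Orthogonality of the characters of order dividing \<open>r\<close>, normalised so that
  the \<open>r - 1\<close> nontrivial ones have coefficients of total modulus one. This is why each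
  set of primes in the sieve counts only once.\<close>

lemma coprime_indicator_expansion:
  assumes "prime r"
  shows "(if r dvd k then 0 else 1) =
    of_real (1 - 1 / real r) * (1 + of_real (- 1 / (real r - 1)) * (\<Sum>a\<in>{1..<r}. unity_root r ^ (a * k)))"
proof -
  have r: "r > 1" using assms by (rule prime_gt_1_nat)
  let ?w = "unity_root r ^ k"
  have split: "(\<Sum>a<r. ?w ^ a) = 1 + (\<Sum>a\<in>{1..<r}. unity_root r ^ (a * k))"
  proof -
    have "{..<r} = insert 0 {1..<r}" using r by auto
    then show ?thesis by (simp add: power_mult[symmetric] mult.commute)
  qed
  have w1: "?w = 1 \<longleftrightarrow> r dvd k" using unity_root_pow_eq_one_iff[of r k] r by simp
  have r0: "complex_of_real (real r) \<noteq> 0" "complex_of_real (real r - 1) \<noteq> 0" using r by auto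
  show ?thesis
  proof (cases "r dvd k")
    case True
    then have "(\<Sum>a<r. ?w ^ a) = of_nat r" using w1 by simp
    then have "(\<Sum>a\<in>{1..<r}. unity_root r ^ (a * k)) = of_real (real r - 1)" using split by (simp add: algebra_simps)
    then show ?thesis using True r0 by (simp del: of_real_diff flip: of_real_mult)
  next
    case False
    have "?w ^ r = 1" using unity_root_pow_eq_one_iff[of r "k * r"] r by (simp add: power_mult)
    then have "(\<Sum>a<r. ?w ^ a) = 0" using False w1 geometric_sum[of ?w r] by simp
    then have s: "(\<Sum>a\<in>{1..<r}. unity_root r ^ (a * k)) = -1"
      using split by (metis add.commute eq_neg_iff_add_eq_0)
    have "(1 - 1 / real r) * (1 + (- 1 / (real r - 1)) * (-1)) = 1" using r by (simp add: field_simps)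
    then have "complex_of_real ((1 - 1 / real r) * (1 + (- 1 / (real r - 1)) * (-1))) = 1" by simp
    then show ?thesis unfolding s using False by simp
  qed
qed

section \<open>Discrete logarithms and the sieve\<close>

context finite_field_ext
begin

definition dlog :: "'a \<Rightarrow> nat" where
  "dlog x = (LEAST k. x = gen [^] k)"

lemma gen_pow_dlog: "x \<in> carrier R - {\<zero>} \<Longrightarrow> gen [^] dlog x = x"
proof -
  assume "x \<in> carrier R - {\<zero>}"
  then have "\<exists>k::nat. x = gen [^] k" using ex_gen_pow[of x] by auto
  from LeastI_ex[OF this] show ?thesis unfolding dlog_def by simp
qed

lemma dlog_gen_pow: "[dlog (gen [^] k) = k] (mod (q ^ n - 1))"
proof -
  have "gen [^] k \<in> carrier R - {\<zero>}" using gen gen_pow_nonzero by simp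
  then have "gen [^] dlog (gen [^] k) = gen [^] k" by (rule gen_pow_dlog)
  then show ?thesis by (simp add: gen_pow_eq_iff cong_def)
qed

lemma dlog_mult:
  assumes "x \<in> carrier R - {\<zero>}" "y \<in> carrier R - {\<zero>}"
  shows "[dlog (x \<otimes> y) = dlog x + dlog y] (mod (q ^ n - 1))"
proof -
  have "gen [^] (dlog x + dlog y) = x \<otimes> y"
    using gen_pow_dlog[OF assms(1)] gen_pow_dlog[OF assms(2)] gen by (simp add: nat_pow_mult[symmetric])
  then show ?thesis using dlog_gen_pow[of "dlog x + dlog y"] by simp
qed

text \<open>\<open>dlog\<close> is additive only modulo \<open>q ^ n - 1\<close>, which suffices
  since every \<open>r\<close> divides that number.\<close>

lemma mult_char_prod:
  assumes "finite S" "\<And>r. r \<in> S \<Longrightarrow> r dvd q ^ n - 1"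
  shows "mult_char (\<lambda>x. \<Prod>r\<in>S. unity_root r ^ (f r * dlog x))"
  unfolding mult_char_def
proof (intro conjI ballI)
  fix x y assume xy: "x \<in> carrier R - {\<zero>}" "y \<in> carrier R - {\<zero>}"
  have "unity_root r ^ (f r * dlog (x \<otimes> y)) = unity_root r ^ (f r * dlog x) * unity_root r ^ (f r * dlog y)"
    if r: "r \<in> S" for r
  proof -
    have rq: "r dvd q ^ n - 1" using assms r by blast
    then have "r > 0" using qn_gt_1 by (intro Nat.gr0I) auto
    moreover have "[f r * dlog (x \<otimes> y) = f r * (dlog x + dlog y)] (mod r)"
      using cong_dvd_modulus_nat[OF dlog_mult[OF xy] rq] by (intro cong_mult) auto
    ultimately have "unity_root r ^ (f r * dlog (x \<otimes> y)) = unity_root r ^ (f r * (dlog x + dlog y))"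
      by (rule unity_root_pow_cong)
    then show ?thesis by (simp add: distrib_left power_add)
  qed
  then show "(\<Prod>r\<in>S. unity_root r ^ (f r * dlog (x \<otimes> y))) =
     (\<Prod>r\<in>S. unity_root r ^ (f r * dlog x)) * (\<Prod>r\<in>S. unity_root r ^ (f r * dlog y))"
    by (simp add: prod.distrib[symmetric])
qed (simp add: prod_norm[symmetric] norm_power norm_unity_root)

text \<open>The witness is \<open>gen [^] t\<close> with \<open>t\<close> the product of the primes
  other than \<open>s\<close>: it turns every factor into \<open>1\<close> except the one at
  \<open>s\<close>, whose exponent \<open>f s * t\<close> is prime to \<open>s\<close>.\<close>

lemma mult_char_prod_nontrivial:
  assumes S: "finite S" "S \<noteq> {}" "\<And>r. r \<in> S \<Longrightarrow> prime r" "\<And>r. r \<in> S \<Longrightarrow> r dvd q ^ n - 1"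
    and f: "\<And>r. r \<in> S \<Longrightarrow> 1 \<le> f r \<and> f r < r"
  shows "\<exists>a\<in>carrier R - {\<zero>}. (\<Prod>r\<in>S. unity_root r ^ (f r * dlog a)) \<noteq> 1"
proof -
  obtain s where s: "s \<in> S" using S by blast
  define t where "t = \<Prod>(S - {s})"
  have a: "gen [^] t \<in> carrier R - {\<zero>}" using gen gen_pow_nonzero by simp
  have pw: "unity_root r ^ (f r * dlog (gen [^] t)) = unity_root r ^ (f r * t)" if r: "r \<in> S" for r
    using S(3)[OF r] prime_gt_0_nat cong_dvd_modulus_nat[OF dlog_gen_pow S(4)[OF r]]
    by (intro unity_root_pow_cong cong_mult) auto
  have "(\<Prod>r\<in>S. unity_root r ^ (f r * dlog (gen [^] t))) = (\<Prod>r\<in>S. unity_root r ^ (f r * t))"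
    by (rule prod.cong[OF refl]) (rule pw)
  also have "\<dots> = unity_root s ^ (f s * t) * (\<Prod>r\<in>S - {s}. unity_root r ^ (f r * t))"
    using S s by (simp add: prod.remove)
  also have "(\<Prod>r\<in>S - {s}. unity_root r ^ (f r * t)) = 1"
  proof (rule prod.neutral, rule ballI)
    fix r assume r: "r \<in> S - {s}"
    then have "r dvd t" unfolding t_def using S by (intro dvd_prodI[where f = "\<lambda>x. x", simplified]) auto
    then show "unity_root r ^ (f r * t) = 1"
      using unity_root_pow_eq_one_iff[of r "f r * t"] S(3)[of r] r prime_gt_0_nat by auto
  qed
  finally have eq: "(\<Prod>r\<in>S. unity_root r ^ (f r * dlog (gen [^] t))) = unity_root s ^ (f s * t)" by simp
  have ps: "prime s" using S s by blast
  have "\<not> s dvd f s" using f[OF s] by (auto dest: dvd_imp_le)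
  moreover have "\<not> s dvd t"
  proof
    assume "s dvd t"
    then obtain r where r: "r \<in> S - {s}" "s dvd r"
      unfolding t_def using prime_dvd_prod_iff[of "S - {s}" s "\<lambda>x. x"] S ps by auto
    then show False using S(3)[of r] ps primes_dvd_imp_eq by auto
  qed
  ultimately have "\<not> s dvd f s * t" using ps by (simp add: prime_dvd_mult_iff)
  then have "unity_root s ^ (f s * t) \<noteq> 1"
    using unity_root_pow_eq_one_iff[of s] ps prime_gt_0_nat by simp
  then show ?thesis using a eq by (intro bexI[of _ "gen [^] t"]) auto
qed

text \<open>The product of the indicators is expanded over subsets of \<open>P\<close>. The empty
  set gives the main term, and each of the other \<open>2 ^ card P - 1\<close> sets gives an average
  of nontrivial characters, hence at most \<open>B\<close>. The factor \<open>\<rho>\<close> in the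
  error cancels against the one in the main term later.\<close>

lemma sieve_estimate:
  assumes P: "finite P" "\<And>r. r \<in> P \<Longrightarrow> prime r" "\<And>r. r \<in> P \<Longrightarrow> r dvd q ^ n - 1"
    and A: "A \<subseteq> carrier R - {\<zero>}"
    and B: "\<And>c a. mult_char c \<Longrightarrow> a \<in> carrier R - {\<zero>} \<Longrightarrow> c a \<noteq> 1 \<Longrightarrow> norm (\<Sum>x\<in>A. c x) \<le> B"
  shows "\<bar>real (card {x \<in> A. \<forall>r\<in>P. \<not> r dvd dlog x}) - (\<Prod>r\<in>P. 1 - 1 / real r) * real (card A)\<bar>
    \<le> (\<Prod>r\<in>P. 1 - 1 / real r) * ((2 ^ card P - 1) * B)"
proof -
  define \<rho> where "\<rho> = (\<Prod>r\<in>P. 1 - 1 / real r)"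
  have fA: "finite A" using A finite_carrier by (meson finite_Diff finite_subset)
  define g where "g r x = of_real (- 1 / (real r - 1)) * (\<Sum>a\<in>{1..<r}. unity_root r ^ (a * dlog x))" for r x
  have \<rho>0: "\<rho> \<ge> 0" unfolding \<rho>_def
    using P(2) prime_gt_0_nat by (intro prod_nonneg) (auto simp: Suc_leI)
  have ind: "(if \<forall>r\<in>P. \<not> r dvd dlog x then 1 else 0) = of_real \<rho> * (\<Sum>S\<in>Pow P. \<Prod>r\<in>S. g r x)" for x
  proof -
    have "(if \<forall>r\<in>P. \<not> r dvd dlog x then 1 else 0) = (\<Prod>r\<in>P. if r dvd dlog x then 0 else (1::complex))"
      using P(1) by (auto simp: prod_zero_iff)
    also have "\<dots> = (\<Prod>r\<in>P. of_real (1 - 1 / real r) * (1 + g r x))"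
      unfolding g_def using P by (intro prod.cong[OF refl] coprime_indicator_expansion) auto
    also have "\<dots> = of_real \<rho> * (\<Prod>r\<in>P. g r x + 1)"
      by (simp add: prod.distrib \<rho>_def add.commute)
    also have "(\<Prod>r\<in>P. g r x + 1) = (\<Sum>S\<in>Pow P. \<Prod>r\<in>S. g r x)"
      using P by (simp add: prod_add)
    finally show ?thesis .
  qed
  have bound: "norm (\<Sum>x\<in>A. \<Prod>r\<in>S. g r x) \<le> B" if S: "S \<subseteq> P" "S \<noteq> {}" for S
  proof -
    have fS: "finite S" using S P finite_subset by blast
    define c where "c = (\<Prod>r\<in>S. - 1 / (real r - 1))"
    let ?F = "PiE S (\<lambda>r. {1..<r})"
    have "(\<Prod>r\<in>S. g r x) = of_real c * (\<Sum>f\<in>?F. \<Prod>r\<in>S. unity_root r ^ (f r * dlog x))" for x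
      unfolding g_def c_def by (simp only: prod.distrib prod_sum_PiE[OF fS finite_atLeastLessThan] of_real_prod)
    then have "(\<Sum>x\<in>A. \<Prod>r\<in>S. g r x) = of_real c * (\<Sum>x\<in>A. \<Sum>f\<in>?F. \<Prod>r\<in>S. unity_root r ^ (f r * dlog x))"
      by (simp only: sum_distrib_left)
    also have "(\<Sum>x\<in>A. \<Sum>f\<in>?F. \<Prod>r\<in>S. unity_root r ^ (f r * dlog x)) =
        (\<Sum>f\<in>?F. \<Sum>x\<in>A. \<Prod>r\<in>S. unity_root r ^ (f r * dlog x))" by (rule sum.swap)
    finally have "(\<Sum>x\<in>A. \<Prod>r\<in>S. g r x) = of_real c * (\<Sum>f\<in>?F. \<Sum>x\<in>A. \<Prod>r\<in>S. unity_root r ^ (f r * dlog x))" .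
    then have "norm (\<Sum>x\<in>A. \<Prod>r\<in>S. g r x) = \<bar>c\<bar> * norm (\<Sum>f\<in>?F. \<Sum>x\<in>A. \<Prod>r\<in>S. unity_root r ^ (f r * dlog x))"
      by (simp add: norm_mult)
    also have "\<dots> \<le> \<bar>c\<bar> * (\<Sum>f\<in>?F. B)"
    proof (rule mult_left_mono, rule sum_norm_le)
      fix f assume f: "f \<in> ?F"
      have mc: "mult_char (\<lambda>x. \<Prod>r\<in>S. unity_root r ^ (f r * dlog x))"
        using fS P S by (intro mult_char_prod) auto
      have "\<exists>a\<in>carrier R - {\<zero>}. (\<Prod>r\<in>S. unity_root r ^ (f r * dlog a)) \<noteq> 1"
        using fS S P f by (intro mult_char_prod_nontrivial) (auto simp: PiE_iff)
      then show "norm (\<Sum>x\<in>A. \<Prod>r\<in>S. unity_root r ^ (f r * dlog x)) \<le> B" using B[OF mc] by blast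
    qed simp
    also have "\<dots> = (\<bar>c\<bar> * (\<Prod>r\<in>S. real r - 1)) * B"
    proof -
      have "real (card ?F) = (\<Prod>r\<in>S. real r - 1)"
        using S P(2) prime_gt_0_nat by (auto simp: card_PiE[OF fS] of_nat_diff Suc_leI intro!: prod.cong)
      then show ?thesis by simp
    qed
    also have "\<bar>c\<bar> * (\<Prod>r\<in>S. real r - 1) = (\<Prod>r\<in>S. \<bar>- 1 / (real r - 1)\<bar> * (real r - 1))"
      unfolding c_def abs_prod by (rule prod.distrib[symmetric])
    also have "\<dots> = 1"
    proof (rule prod.neutral, rule ballI)
      fix r assume "r \<in> S"
      then have "r > 1" using S P(2) prime_gt_1_nat by blast
      then show "\<bar>- 1 / (real r - 1)\<bar> * (real r - 1) = 1" by simp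
    qed
    finally show ?thesis by simp
  qed
  have "complex_of_real (real (card {x \<in> A. \<forall>r\<in>P. \<not> r dvd dlog x})) =
      (\<Sum>x\<in>A. if \<forall>r\<in>P. \<not> r dvd dlog x then 1 else 0)"
    using fA by (simp add: sum.inter_filter[symmetric])
  also have "\<dots> = of_real \<rho> * (\<Sum>x\<in>A. \<Sum>S\<in>Pow P. \<Prod>r\<in>S. g r x)"
    unfolding ind by (rule sum_distrib_left[symmetric])
  also have "(\<Sum>x\<in>A. \<Sum>S\<in>Pow P. \<Prod>r\<in>S. g r x) = (\<Sum>S\<in>Pow P. \<Sum>x\<in>A. \<Prod>r\<in>S. g r x)"
    by (rule sum.swap)
  also have "(\<Sum>S\<in>Pow P. \<Sum>x\<in>A. \<Prod>r\<in>S. g r x) =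
      of_nat (card A) + (\<Sum>S\<in>Pow P - {{}}. \<Sum>x\<in>A. \<Prod>r\<in>S. g r x)"
    using P(1) by (subst sum.remove[of _ "{}"]) auto
  finally have "complex_of_real (real (card {x \<in> A. \<forall>r\<in>P. \<not> r dvd dlog x})) =
      of_real \<rho> * (of_nat (card A) + (\<Sum>S\<in>Pow P - {{}}. \<Sum>x\<in>A. \<Prod>r\<in>S. g r x))" .
  then have "complex_of_real (real (card {x \<in> A. \<forall>r\<in>P. \<not> r dvd dlog x}) - \<rho> * real (card A)) =
      of_real \<rho> * (\<Sum>S\<in>Pow P - {{}}. \<Sum>x\<in>A. \<Prod>r\<in>S. g r x)"
    unfolding of_real_diff of_real_mult of_real_of_nat_eq by (simp only: distrib_left add_diff_cancel_left')
  from arg_cong[OF this, of norm]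
  have "\<bar>real (card {x \<in> A. \<forall>r\<in>P. \<not> r dvd dlog x}) - \<rho> * real (card A)\<bar> =
      norm (of_real \<rho> * (\<Sum>S\<in>Pow P - {{}}. \<Sum>x\<in>A. \<Prod>r\<in>S. g r x))"
    unfolding norm_of_real .
  also have "\<dots> = \<rho> * norm (\<Sum>S\<in>Pow P - {{}}. \<Sum>x\<in>A. \<Prod>r\<in>S. g r x)"
    using \<rho>0 by (simp add: norm_mult)
  also have "\<dots> \<le> \<rho> * (\<Sum>S\<in>Pow P - {{}}. B)"
    by (rule mult_left_mono, rule sum_norm_le) (use \<rho>0 bound in auto)
  also have "(\<Sum>S\<in>Pow P - {{}}. B) = (2 ^ card P - 1) * B"
    using P(1) by (simp add: card_Pow card_Diff_singleton of_nat_diff)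
  finally show ?thesis by (simp add: \<rho>_def)
qed

text \<open>
  The order of the multiplicative group modulo that of the ground field. Primes not dividing it can
  be ignored: a factor from the ground field makes \<open>x\<close> a non-residue for them.
\<close>

definition norm_index :: nat where
  "norm_index = (q ^ n - 1) div (q - 1)"

lemma norm_index_mult: "norm_index * (q - 1) = q ^ n - 1"
proof -
  have "[q ^ n = 1 ^ n] (mod (q - 1))"
    using q_gt_1 by (intro cong_pow) (simp add: cong_altdef_nat)
  then have "q - 1 dvd q ^ n - 1" using qn_gt_1 by (simp add: cong_altdef_nat)
  then show ?thesis by (simp add: norm_index_def)
qed

definition norm_free :: "'a \<Rightarrow> bool" where
  "norm_free x \<longleftrightarrow> x \<in> carrier R - {\<zero>} \<and> (\<forall>r\<in>prime_factors norm_index. \<not> r dvd dlog x)"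

text \<open>Otherwise the hyperplanes cover all norm-free elements. There are exactly
  \<open>\<rho> * (Q - 1)\<close> of these, and a hyperplane of level \<open>l\<close> holds at most
  \<open>\<rho> * (Q / q ^ l - 1 + W * sqrt Q)\<close>; division by \<open>\<rho>\<close>
  contradicts \<open>main\<close>.\<close>

lemma ex_norm_free_avoiding:
  assumes J: "finite J" and l: "\<And>j. j \<in> J \<Longrightarrow> l j > 0 \<and> l j dvd n"
    and V: "\<And>j. j \<in> J \<Longrightarrow> subspace_over (l j) (V j) \<and> V j \<noteq> carrier R"
    and main: "(2 ^ card (prime_factors norm_index) - 1) * real (card J)
       < sqrt (real (q ^ n)) * (1 - (\<Sum>j\<in>J. 1 / real (q ^ l j)))"
  shows "\<exists>x. norm_free x \<and> (\<forall>j\<in>J. x \<notin> V j)"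
proof (rule ccontr)
  assume contra: "\<not> ?thesis"
  define P where "P = prime_factors norm_index"
  define W where "W = (2::real) ^ card P - 1"
  define \<rho> where "\<rho> = (\<Prod>r\<in>P. 1 - 1 / real r)"
  define Q where "Q = real (q ^ n)"
  let ?G = "carrier R - {\<zero>}"
  let ?free = "\<lambda>A. {x \<in> A. \<forall>r\<in>P. \<not> r dvd dlog x}"
  have P: "finite P" "\<And>r. r \<in> P \<Longrightarrow> prime r" "\<And>r. r \<in> P \<Longrightarrow> r dvd q ^ n - 1"
    using dvd_trans[OF _ dvdI[OF norm_index_mult[symmetric]]] by (auto simp: P_def in_prime_factors_iff)
  have \<rho>0: "\<rho> > 0" unfolding \<rho>_def
  proof (rule prod_pos)
    fix r assume "r \<in> P"
    then have "r > 1" using P(2) prime_gt_1_nat by blast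
    then show "0 < 1 - 1 / real r" by simp
  qed
  have Q1: "Q > 1" unfolding Q_def using qn_gt_1 by (simp del: of_nat_power)
  have "\<exists>H. V j \<subseteq> H \<and> hyperplane_over (l j) H" if "j \<in> J" for j
    using l[OF that] V[OF that] by (intro ex_hyperplane) simp_all
  then have "\<forall>j\<in>J. \<exists>H. V j \<subseteq> H \<and> hyperplane_over (l j) H" by blast
  from bchoice[OF this] obtain H
    where H: "\<And>j. j \<in> J \<Longrightarrow> V j \<subseteq> H j" "\<And>j. j \<in> J \<Longrightarrow> hyperplane_over (l j) (H j)"
    by blast
  have HR: "H j \<subseteq> carrier R" "\<zero> \<in> H j" if "j \<in> J" for j
    using H(2)[OF that] by (auto simp: hyperplane_over_def subspace_over_def)
  have finH: "finite (?free (H j - {\<zero>}))" if "j \<in> J" for j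
    using finite_subset[OF HR(1)[OF that] finite_carrier] by simp
  \<comment> \<open>On the whole group nontrivial character sums vanish, so the sieve is
    exact.\<close>
  have "\<bar>real (card (?free ?G)) - \<rho> * real (card ?G)\<bar> \<le> \<rho> * ((2 ^ card P - 1) * 0)"
    unfolding \<rho>_def by (rule sieve_estimate[OF P subset_refl]) (use sum_mult_char in auto)
  then have tot: "real (card (?free ?G)) = \<rho> * (Q - 1)"
    using card_carrier qn_gt_1 by (simp add: Q_def of_nat_diff)
  have part: "real (card (?free (H j - {\<zero>}))) \<le> \<rho> * (Q / real (q ^ l j) - 1 + W * sqrt Q)" if j: "j \<in> J" for j
  proof -
    have "\<bar>real (card (?free (H j - {\<zero>}))) - \<rho> * real (card (H j - {\<zero>}))\<bar> \<le> \<rho> * ((2 ^ card P - 1) * sqrt Q)"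
      unfolding \<rho>_def Q_def
    proof (rule sieve_estimate[OF P])
      show "H j - {\<zero>} \<subseteq> carrier R - {\<zero>}" using HR j by blast
      fix c a assume "mult_char c" "a \<in> carrier R - {\<zero>}" "c a \<noteq> 1"
      then show "norm (\<Sum>x\<in>H j - {\<zero>}. c x) \<le> sqrt (real (q ^ n))"
        using l[OF j] H(2)[OF j] by (intro hyperplane_char_bound) simp_all
    qed
    moreover have "real (card (H j - {\<zero>})) = Q / real (q ^ l j) - 1"
    proof -
      have fin: "finite (H j)" using HR j finite_carrier finite_subset by blast
      have "real (card (H j)) * real (q ^ l j) = Q"
        using card_hyperplane[of "l j" "H j"] l[OF j] H(2)[OF j] unfolding Q_def by (metis of_nat_mult)
      then have 1: "real (card (H j)) = Q / real (q ^ l j)" using q_gt_1 by (simp add: field_simps)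
      have "card (H j) \<ge> 1" using card_mono[of "H j" "{\<zero>}"] HR j fin by simp
      then show ?thesis using HR(2)[OF j] fin 1 by (simp add: card_Diff_singleton of_nat_diff)
    qed
    ultimately show ?thesis by (simp add: W_def algebra_simps)
  qed
  have sub: "?free ?G \<subseteq> (\<Union>j\<in>J. ?free (H j - {\<zero>}))"
  proof
    fix x assume x: "x \<in> ?free ?G"
    then have "norm_free x" by (auto simp: norm_free_def P_def)
    then obtain j where j: "j \<in> J" "x \<in> V j" using contra by blast
    then have "x \<in> H j" using H(1)[OF j(1)] by blast
    then show "x \<in> (\<Union>j\<in>J. ?free (H j - {\<zero>}))" using x j by blast
  qed
  have "\<rho> * (Q - 1) \<le> real (card (\<Union>j\<in>J. ?free (H j - {\<zero>})))"
    unfolding tot[symmetric] using sub finH J by (intro of_nat_mono card_mono finite_UN_I) auto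
  also have "\<dots> \<le> real (\<Sum>j\<in>J. card (?free (H j - {\<zero>})))"
    using J by (intro of_nat_mono card_UN_le)
  also have "\<dots> \<le> (\<Sum>j\<in>J. \<rho> * (Q / real (q ^ l j) - 1 + W * sqrt Q))"
    unfolding of_nat_sum by (rule sum_mono) (rule part)
  also have "\<dots> = \<rho> * (Q * (\<Sum>j\<in>J. 1 / real (q ^ l j)) - real (card J) + W * sqrt Q * real (card J))"
    by (simp add: sum_distrib_left[symmetric] sum.distrib sum_subtractf divide_inverse algebra_simps)
  finally have "Q - 1 \<le> Q * (\<Sum>j\<in>J. 1 / real (q ^ l j)) - real (card J) + W * sqrt Q * real (card J)"
    using \<rho>0 by simp
  then have le: "Q * (1 - (\<Sum>j\<in>J. 1 / real (q ^ l j))) \<le> 1 - real (card J) + sqrt Q * (W * real (card J))"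
    by (simp add: algebra_simps)
  show False
  proof (cases "card J = 0")
    case True
    then have "J = {}" using J by simp
    then show False using le Q1 by simp
  next
    case False
    then have "Q * (1 - (\<Sum>j\<in>J. 1 / real (q ^ l j))) \<le> sqrt Q * (W * real (card J))" using le by linarith
    also have "\<dots> < sqrt Q * (sqrt Q * (1 - (\<Sum>j\<in>J. 1 / real (q ^ l j))))"
      using main Q1 q_gt_1 unfolding W_def P_def Q_def by (intro mult_strict_left_mono) auto
    also have "\<dots> = Q * (1 - (\<Sum>j\<in>J. 1 / real (q ^ l j)))"
      using Q1 by (simp add: mult.assoc[symmetric])
    finally show False by simp
  qed
qed

lemma norm_free_scale_primitive:
  assumes x: "norm_free x"
  shows "\<exists>c\<in>fixed_field 1. c \<noteq> \<zero> \<and> primitive_element R (c \<otimes> x)"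
proof -
  define k where "k = dlog x"
  have xk: "gen [^] k = x" using x gen_pow_dlog by (simp add: norm_free_def k_def)
  \<comment> \<open>The exponent \<open>k + norm_index * j\<close> must avoid every prime factor
    \<open>r\<close> of \<open>q ^ n - 1\<close>. Factors of \<open>norm_index\<close> avoid
    \<open>k\<close> already. Any other \<open>r\<close> should divide exactly one of
    \<open>k\<close> and \<open>j\<close>, which fixes \<open>j\<close> as the product of those not
    dividing \<open>k\<close>.\<close>
  define T where "T = {r \<in> prime_factors (q ^ n - 1). \<not> r dvd norm_index \<and> \<not> r dvd k}"
  have finT: "finite T" by (simp add: T_def)
  define j where "j = \<Prod>T"
  have Q0: "q ^ n - 1 > 0" using qn_gt_1 by simp
  have M0: "norm_index > 0" using norm_index_mult Q0 by (cases norm_index) auto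
  have cop: "coprime (k + norm_index * j) (q ^ n - 1)"
  proof (rule ccontr)
    assume "\<not> ?thesis"
    then have "gcd (k + norm_index * j) (q ^ n - 1) \<noteq> 1" unfolding coprime_iff_gcd_eq_1 .
    from prime_factor_nat[OF this] obtain r
      where r0: "prime r" "r dvd gcd (k + norm_index * j) (q ^ n - 1)" by blast
    note r = r0(1) dvd_trans[OF r0(2) gcd_dvd1] dvd_trans[OF r0(2) gcd_dvd2]
    show False
    proof (cases "r dvd norm_index")
      case True
      then have "r dvd k" using r(2) by (simp add: dvd_add_left_iff)
      moreover have "r \<in> prime_factors norm_index" using True r M0 by (simp add: in_prime_factors_iff)
      ultimately show False using x by (auto simp: norm_free_def k_def)
    next
      case M: False
      show False
      proof (cases "r dvd k")
        case True
        then have "r dvd norm_index * j" using r(2) by (simp add: dvd_add_right_iff)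
        then have "r dvd j" using M r by (simp add: prime_dvd_mult_iff)
        then obtain s where s: "s \<in> T" "r dvd s"
          unfolding j_def using prime_dvd_prod_iff[OF finT, of r "\<lambda>x. x"] r by auto
        then have "r = s" using r by (auto simp: T_def in_prime_factors_iff primes_dvd_imp_eq)
        then show False using s True by (simp add: T_def)
      next
        case False
        then have "r \<in> T" using M r Q0 by (simp add: T_def in_prime_factors_iff)
        then have "r dvd j" unfolding j_def using finT by (intro dvd_prodI[where f = "\<lambda>x. x", simplified])
        then have "r dvd k" using r(2) by (simp add: dvd_add_left_iff)
        then show False using False by simp
      qed
    qed
  qed
  \<comment> \<open>Exponents divisible by \<open>norm_index\<close> belong to the ground
    field.\<close>
  have "[norm_index * j * q = norm_index * j] (mod (q ^ n - 1))"
  proof -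
    have "norm_index * j * q = norm_index * j + j * (norm_index * (q - 1))"
      using q_gt_1 by (simp add: algebra_simps)
    then show ?thesis unfolding norm_index_mult by (simp add: cong_def)
  qed
  then have "gen [^] (norm_index * j) \<in> fixed_field 1"
    using gen by (simp add: fixed_field_def nat_pow_pow gen_pow_eq_iff cong_def)
  moreover have "gen [^] (norm_index * j) \<otimes> x = gen [^] (k + norm_index * j)"
    using gen unfolding xk[symmetric] by (simp add: nat_pow_mult add.commute)
  ultimately show ?thesis using primitive_element_gen_pow[OF cop] gen_pow_nonzero by metis
qed

end

subsection \<open>Roots of unity in an algebraically closed field\<close>

lemma (in algebraically_closed) ex_root:
  assumes "set p \<subseteq> carrier L" "length p > 1" "hd p \<noteq> \<zero>"
  shows "\<exists>x\<in>carrier L. eval p x = \<zero>"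
proof -
  have p: "p \<in> carrier (poly_ring L)"
    using assms by (auto simp: univ_poly_carrier[symmetric] polynomial_def)
  then have "size (roots p) = degree p" using roots_over_carrier by (simp add: splitted_def)
  then have "roots p \<noteq> {#}" using assms(2) by auto
  then obtain x where "x \<in># roots p" by blast
  then show ?thesis using roots_mem_iff_is_root[OF p] by (auto simp: is_root_def)
qed

lemma (in algebraically_closed) ex_nth_root:
  assumes "c \<in> carrier L" "m > 0"
  shows "\<exists>x\<in>carrier L. x [^] (m::nat) = c"
proof -
  \<comment> \<open>The polynomial \<open>X ^ m - c\<close>, listed from the leading coefficient
    down.\<close>
  let ?p = "(\<one> # replicate (m - 1) \<zero>) @ [\<ominus> c]"
  have "set ?p \<subseteq> carrier L" "hd ?p \<noteq> \<zero>" "length ?p > 1" using assms by auto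
  from ex_root[OF this(1,3,2)] obtain x where x: "x \<in> carrier L" "eval ?p x = \<zero>" by blast
  have "eval ?p x = eval (monom \<one> (m - 1)) x \<otimes> x \<oplus> \<ominus> c"
    unfolding monom_def using x assms by (intro eval_append_aux) auto
  also have "\<dots> = x [^] (m - 1) \<otimes> x \<ominus> c" using x by (simp add: eval_monom minus_eq)
  also have "x [^] (m - 1) \<otimes> x = x [^] m" using assms(2) by (cases m) auto
  finally have "x [^] m = c" using x assms by simp
  then show ?thesis using x by blast
qed

lemma (in ring) eval_replicate_one:
  assumes "x \<in> carrier R"
  shows "eval (replicate r \<one>) x = (\<Oplus>i\<in>{..<r}. x [^] i)"
proof (induction r)
  case (Suc r)
  then show ?case using assms by (simp add: finsum_lessThan_Suc)
qed simp

text \<open>A root of \<open>1 + X + ... + X ^ (r - 1)\<close> is an \<open>r\<close>-th root of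
  unity, and it differs from \<open>1\<close> because the value at \<open>1\<close> is
  \<open>r\<close>. As \<open>r\<close> is prime, its order is exactly \<open>r\<close>.\<close>

lemma (in algebraically_closed) ex_prime_root_of_unity:
  assumes r: "prime (r::nat)" and nz: "[r] \<cdot> \<one> \<noteq> \<zero>"
  shows "\<exists>y. root_of_unity r y"
proof -
  have r1: "r > 1" using r by (rule prime_gt_1_nat)
  have "hd (replicate r \<one>) = \<one>" using r1 by (cases r) auto
  then obtain y where y: "y \<in> carrier L" "eval (replicate r \<one>) y = \<zero>"
    using ex_root[of "replicate r \<one>"] r1 by auto
  let ?S = "\<lambda>k::nat. \<Oplus>i\<in>{..<k}. y [^] i"
  have S0: "?S r = \<zero>" using y eval_replicate_one by simp
  have Sc: "?S k \<in> carrier L" for k using y by (auto intro!: finsum_closed)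
  have tel: "y \<otimes> ?S k \<oplus> \<one> = y [^] k \<oplus> ?S k" for k
  proof (induction k)
    case (Suc k)
    have "y \<otimes> ?S (Suc k) \<oplus> \<one> = y [^] Suc k \<oplus> (y \<otimes> ?S k \<oplus> \<one>)"
      using y Sc by (simp add: finsum_lessThan_Suc r_distr a_assoc m_comm)
    also have "\<dots> = y [^] Suc k \<oplus> ?S (Suc k)"
      unfolding Suc using y by (simp add: finsum_lessThan_Suc)
    finally show ?case .
  qed (use y in simp)
  have yr: "y [^] r = \<one>" using tel[of r] S0 y by simp
  have y1: "y \<noteq> \<one>"
  proof
    assume "y = \<one>"
    then have "?S r = [r] \<cdot> \<one>" using add.finprod_const[of \<one> "{..<r}"] by simp
    then show False using S0 nz by simp
  qed
  have "y [^] i \<noteq> \<one>" if i: "0 < i" "i < r" for i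
  proof
    assume yi: "y [^] i = \<one>"
    have "coprime i r"
      using r i by (metis coprime_commute nat_dvd_not_less prime_imp_coprime_nat)
    then obtain a b where ab: "i * a = r * b + 1" using bezout_nat[of i r] i by auto
    have "y [^] (i * a) = \<one>" using yi y by (simp add: nat_pow_pow[symmetric])
    moreover have "y [^] (r * b + 1) = y" using yr y by (simp add: nat_pow_pow[symmetric])
    ultimately show False using y1 ab by metis
  qed
  then show ?thesis using y yr by (auto simp: root_of_unity_def)
qed

text \<open>One prime \<open>r\<close> is split off at a time, \<open>m = r * m'\<close>. If
  \<open>r\<close> divides \<open>m'\<close>, an \<open>r\<close>-th root of a root of order
  \<open>m'\<close> has order \<open>m\<close>; otherwise the orders \<open>m'\<close> and
  \<open>r\<close> are coprime and the two roots are multiplied.\<close>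

lemma (in algebraically_closed) ex_root_of_unity:
  assumes "m > 0" "\<And>r. prime r \<Longrightarrow> r dvd m \<Longrightarrow> [r] \<cdot> \<one> \<noteq> \<zero>"
  shows "\<exists>z. root_of_unity m z"
  using assms
proof (induction m rule: less_induct)
  case (less m)
  show ?case
  proof (cases "m = 1")
    case True
    then show ?thesis by (intro exI[of _ \<one>]) (auto simp: root_of_unity_def)
  next
    case False
    then obtain r where r: "prime r" "r dvd m" using prime_factor_nat by blast
    then obtain m' where m': "m = r * m'" by blast
    have m'0: "m' > 0" using m' less.prems(1) by (cases m') auto
    have r1: "r > 1" using r prime_gt_1_nat by blast
    have "\<exists>z. root_of_unity m' z"
      using r1 m'0 less.prems(2) by (intro less.IH) (auto simp: m')
    then obtain b where b: "root_of_unity m' b" by blast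
    have bc: "b \<in> carrier L" using b by (simp add: root_of_unity_def)
    note biff = root_of_unity_pow_eq_one_iff[OF b m'0]
    show ?thesis
    proof (cases "r dvd m'")
      case True
      obtain z where z: "z \<in> carrier L" "z [^] r = b" using ex_nth_root[OF bc, of r] r1 by auto
      have zb: "z [^] (r * i) = b [^] i" for i using z by (simp add: nat_pow_pow[symmetric])
      have "z [^] i \<noteq> \<one>" if i: "0 < i" "i < m" for i
      proof
        assume zi: "z [^] i = \<one>"
        have "z [^] (r * i) = \<one>"
          using zi z by (simp add: mult.commute[of r] nat_pow_pow[symmetric])
        then have "m' dvd i" using zb biff by simp
        \<comment> \<open>\<open>r\<close> divides \<open>m'\<close> and hence \<open>i\<close>, so
          \<open>z [^] i\<close> is itself a power of \<open>b\<close> and its exponent must be a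
          multiple of \<open>m'\<close> once more.\<close>
        then obtain i' where i': "i = r * i'" using True by (meson dvd_def dvd_trans)
        then have "m' dvd i'" using zi zb biff by simp
        then have "m dvd i" unfolding m' i' by simp
        then show False using i by (auto dest: dvd_imp_le)
      qed
      moreover have "z [^] m = \<one>" using zb[of m'] biff by (simp add: m')
      ultimately show ?thesis using z by (auto simp: root_of_unity_def)
    next
      case False
      obtain y where y: "root_of_unity r y"
        using ex_prime_root_of_unity[OF r(1)] less.prems(2)[OF r] by blast
      have yc: "y \<in> carrier L" using y by (simp add: root_of_unity_def)
      have r0: "r > 0" using r1 by simp
      note yiff = root_of_unity_pow_eq_one_iff[OF y r0]
      have "(b \<otimes> y) [^] i \<noteq> \<one>" if i: "0 < i" "i < m" for i
      proof
        assume zi: "(b \<otimes> y) [^] i = \<one>"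
        then have 1: "b [^] i \<otimes> y [^] i = \<one>" using bc yc by (simp add: nat_pow_distrib)
        have "b [^] (i * r) = (b [^] i \<otimes> y [^] i) [^] r"
          using bc yc yiff[of "i * r"] by (simp add: nat_pow_distrib nat_pow_pow)
        then have "m' dvd i * r" using 1 biff by simp
        moreover have "coprime m' r" using prime_imp_coprime[OF r(1) False] by (simp only: coprime_commute)
        ultimately have "m' dvd i" by (simp add: coprime_dvd_mult_left_iff)
        then have "b [^] i = \<one>" using biff by simp
        then have "y [^] i = \<one>" using 1 yc by simp
        then have "r dvd i" using yiff by simp
        from semiring_gcd_class.divides_mult[OF \<open>m' dvd i\<close> this \<open>coprime m' r\<close>]
        have "m dvd i" unfolding m' by (simp only: mult.commute)
        then show False using i by (auto dest: dvd_imp_le)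
      qed
      moreover have "(b \<otimes> y) [^] m = \<one>"
        using bc yc biff[of m] yiff[of m] by (simp add: nat_pow_distrib m')
      ultimately show ?thesis using bc yc by (auto simp: root_of_unity_def)
    qed
  qed
qed

subsection \<open>Criteria for the existence of primitive completely normal elements\<close>

context finite_field_ext
begin

definition prime_to_p :: "nat \<Rightarrow> nat" where
  "prime_to_p m = m div p ^ multiplicity p m"

lemma prime_to_p:
  assumes "m > 0"
  shows "m = prime_to_p m * p ^ multiplicity p m" "coprime (prime_to_p m) p" "prime_to_p m > 0"
    "prime_to_p m \<le> m"
proof -
  have "\<not> is_unit p" using prime_p by (metis not_prime_unit)
  then obtain m' where m': "m = p ^ multiplicity p m * m'" "\<not> p dvd m'"
    using multiplicity_decompose'[of m p] assms by auto
  have p0: "p ^ multiplicity p m > 0" using prime_p prime_gt_0_nat by simp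
  have eq: "prime_to_p m = m'" unfolding prime_to_p_def using m'(1) p0
    by (metis nonzero_mult_div_cancel_left less_irrefl)
  show 1: "m = prime_to_p m * p ^ multiplicity p m" using m' eq by (simp add: mult.commute)
  show "coprime (prime_to_p m) p"
    using prime_imp_coprime[OF prime_p m'(2)] unfolding eq by (simp only: coprime_commute)
  show "prime_to_p m > 0" using 1 assms by (intro Nat.gr0I) auto
  show "prime_to_p m \<le> m" by (simp add: prime_to_p_def)
qed

lemma prime_to_p_unique:
  assumes "m = a * p ^ b" "coprime a p" "m > 0"
  shows "prime_to_p m = a"
proof -
  have "\<not> p dvd a" using assms prime_p by (metis coprime_absorb_right not_prime_unit)
  then have "multiplicity p m = b"
    using assms prime_p by (intro multiplicity_eqI) (auto simp: mult.commute)
  then show ?thesis using assms prime_p prime_gt_0_nat[of p] by (simp add: prime_to_p_def)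
qed

lemma prime_to_p_mult:
  assumes "a > 0" "b > 0"
  shows "prime_to_p (a * b) = prime_to_p a * prime_to_p b"
proof (rule prime_to_p_unique)
  show "a * b = prime_to_p a * prime_to_p b * p ^ (multiplicity p a + multiplicity p b)"
    using prime_to_p(1)[OF assms(1)] prime_to_p(1)[OF assms(2)] by (simp add: power_add mult_ac)
  show "coprime (prime_to_p a * prime_to_p b) p"
    using prime_to_p(2)[OF assms(1)] prime_to_p(2)[OF assms(2)] by simp
qed (use assms in simp)

end

section \<open>Kernels of resolvents and the two existence criteria\<close>

context finite_field_hom
begin

definition frob_kernel :: "nat \<Rightarrow> 'c \<Rightarrow> 'a set" where
  "frob_kernel l z = {x \<in> carrier R. frob_sum l z x = \<zero>\<^bsub>E\<^esub>}"

lemma frob_kernel_subspace: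
  assumes "l > 0" "l dvd n" "z \<in> carrier E"
  shows "subspace_over l (frob_kernel l z)" "frob_kernel l z \<noteq> carrier R"
proof -
  have "frob_sum l z \<zero> = \<zero>\<^bsub>E\<^esub>"
    using frob_sum_scale[of z \<zero> \<zero> l] assms frob_sum_closed[of z \<zero> l]
      subringE(2)[OF subfieldE(1)[OF subfield_fixed_field[OF assms(1,2)]]] by simp
  then show "subspace_over l (frob_kernel l z)"
    using assms frob_sum_add[of z] frob_sum_scale[of z]
    by (auto simp: subspace_over_def frob_kernel_def fixed_field_def)
  show "frob_kernel l z \<noteq> carrier R"
    using frob_sum_nonzero[OF assms] by (auto simp: frob_kernel_def)
qed

text \<open>The ground field lies in every \<open>fixed_field l\<close>, so a factor from it
  preserves nonvanishing at all levels at once. This allows primitivity to be arranged last.\<close>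

lemma frob_kernel_scale:
  assumes "z \<in> carrier E" "c \<in> fixed_field 1" "c \<noteq> \<zero>" "x \<in> carrier R" "x \<notin> frob_kernel l z"
  shows "c \<otimes> x \<notin> frob_kernel l z"
proof -
  have c: "c \<in> fixed_field l" "c \<in> carrier R"
    using fixed_field_mono[of 1 l] assms by (auto simp: fixed_field_def)
  have "h c \<noteq> \<zero>\<^bsub>E\<^esub>" using assms c h_eq_zero_iff by simp
  then show ?thesis
    using assms c frob_sum_scale[of z x c l] frob_sum_closed[of z x l] E.integral[of "h c" "frob_sum l z x"]
    by (auto simp: frob_kernel_def)
qed

text \<open>At level \<open>l\<close> the primitive root of unity is chosen as \<open>z\<close> to
  the power \<open>prime_to_p l\<close>, so that a vanishing resolvent there has the shape from
  which \<open>frob_sum_level_one\<close> descends to level one.\<close>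

lemma completely_normal_of_level_one:
  assumes m: "m = prime_to_p n" "m dvd q - 1" and z: "E.root_of_unity m z" and x: "x \<in> carrier R"
    and nz: "\<And>k. k < m \<Longrightarrow> frob_sum 1 (z [^]\<^bsub>E\<^esub> k) x \<noteq> \<zero>\<^bsub>E\<^esub>"
  shows "completely_normal_element R q n x"
  unfolding completely_normal_element_def
proof (intro allI impI, elim conjE)
  fix l assume l: "l > 0" "l dvd n"
  define N where "N = n div l"
  have n: "n = l * N" using l by (simp add: N_def)
  have N0: "N > 0" using n n_pos by (cases N) auto
  have zc: "z \<in> carrier E" using z by (simp add: E.root_of_unity_def)
  have mm: "m = prime_to_p l * prime_to_p N" using prime_to_p_mult[OF l(1) N0] n m by simp
  have m0: "m > 0" using prime_to_p(3)[OF n_pos] m by simp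
  have l'0: "prime_to_p l > 0" using prime_to_p(3) l by blast
  have root: "E.root_of_unity (prime_to_p N) (z [^]\<^bsub>E\<^esub> prime_to_p l)"
    unfolding E.root_of_unity_def
  proof (intro conjI allI impI)
    show "(z [^]\<^bsub>E\<^esub> prime_to_p l) [^]\<^bsub>E\<^esub> prime_to_p N = \<one>\<^bsub>E\<^esub>"
      using zc E.root_of_unity_pow_eq_one_iff[OF z m0, of m] by (simp add: E.nat_pow_pow mm)
    fix i assume i: "0 < i \<and> i < prime_to_p N"
    then have "\<not> m dvd prime_to_p l * i"
      unfolding mm using l'0 by (auto dest: dvd_imp_le)
    then show "(z [^]\<^bsub>E\<^esub> prime_to_p l) [^]\<^bsub>E\<^esub> i \<noteq> \<one>\<^bsub>E\<^esub>"
      using zc E.root_of_unity_pow_eq_one_iff[OF z m0] by (simp add: E.nat_pow_pow)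
  qed (use zc in simp)
  show "normal_element R q n l x"
  proof (rule normal_elementI[OF l _ _ _ root x])
    show "n div l = prime_to_p N * p ^ multiplicity p N" using prime_to_p(1)[OF N0] by (simp add: N_def)
    show "prime_to_p N > 0" "coprime (prime_to_p N) p" using prime_to_p[OF N0] by auto
    fix k assume "k < prime_to_p N"
    show "frob_sum l ((z [^]\<^bsub>E\<^esub> prime_to_p l) [^]\<^bsub>E\<^esub> k) x \<noteq> \<zero>\<^bsub>E\<^esub>"
    proof
      assume "frob_sum l ((z [^]\<^bsub>E\<^esub> prime_to_p l) [^]\<^bsub>E\<^esub> k) x = \<zero>\<^bsub>E\<^esub>"
      then have "frob_sum l (z [^]\<^bsub>E\<^esub> (prime_to_p l * k)) x = \<zero>\<^bsub>E\<^esub>" using zc by (simp add: E.nat_pow_pow)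
      from frob_sum_level_one[OF l(1) n prime_to_p(1)[OF l(1)] m0 _ m(2) z x this]
      show False using nz prime_to_p(2)[OF n_pos] m(1) by blast
    qed
  qed
qed

end

context finite_field_ext
begin

lemma algebraic_closure_hom:
  shows "finite_field_hom R q n p e alg_closure indexed_const"
    and "algebraically_closed alg_closure"
proof -
  interpret A: algebraic_closure alg_closure "indexed_const ` carrier R" by (rule alg_closureE(1))
  show "algebraically_closed alg_closure" by (rule A.algebraically_closed_axioms)
  show "finite_field_hom R q n p e alg_closure indexed_const"
    by (intro finite_field_hom.intro finite_field_hom_axioms.intro finite_field_ext_axioms
        A.field_axioms alg_closureE(2))
qed

lemma ex_root_of_unity_closure:
  assumes "m > 0" "coprime m p"
  shows "\<exists>z. ring.root_of_unity alg_closure m z"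
proof -
  interpret H: finite_field_hom R q n p e alg_closure indexed_const by (rule algebraic_closure_hom)
  interpret A: algebraically_closed alg_closure by (rule algebraic_closure_hom)
  have "[r] \<cdot>\<^bsub>alg_closure\<^esub> \<one>\<^bsub>alg_closure\<^esub> \<noteq> \<zero>\<^bsub>alg_closure\<^esub>" if "prime r" "r dvd m" for r
    by (rule H.nat_E_nonzero[OF coprime_divisors[OF that(2) dvd_refl assms(2)]])
  then show ?thesis by (rule A.ex_root_of_unity[OF assms(1)])
qed

definition pcn_exists :: bool where
  "pcn_exists \<longleftrightarrow> (\<exists>x\<in>carrier R. primitive_element R x \<and> completely_normal_element R q n x)"

text \<open>Only \<open>m\<close> hyperplanes, all of index \<open>q\<close>, have to be
  avoided.\<close>

lemma pcn_exists_level_one: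
  assumes m: "m = prime_to_p n" "m dvd q - 1"
    and main: "(2 ^ card (prime_factors norm_index) - 1) * real m < sqrt (real (q ^ n)) * (1 - real m / real q)"
  shows pcn_exists
proof -
  interpret H: finite_field_hom R q n p e alg_closure indexed_const by (rule algebraic_closure_hom)
  have m0: "m > 0" "coprime m p" using prime_to_p[OF n_pos] m by auto
  obtain z where z: "H.E.root_of_unity m z" using ex_root_of_unity_closure[OF m0] by blast
  have zc: "z \<in> carrier alg_closure" using z by (simp add: H.E.root_of_unity_def)
  have "\<exists>x. norm_free x \<and> (\<forall>k\<in>{..<m}. x \<notin> H.frob_kernel 1 (z [^]\<^bsub>alg_closure\<^esub> k))"
    using H.frob_kernel_subspace[of 1] zc main
    by (intro ex_norm_free_avoiding[of _ "\<lambda>_. 1"]) auto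
  then obtain x where x: "norm_free x" "\<And>k. k < m \<Longrightarrow> x \<notin> H.frob_kernel 1 (z [^]\<^bsub>alg_closure\<^esub> k)" by auto
  have xR: "x \<in> carrier R" using x by (simp add: norm_free_def)
  obtain c where c: "c \<in> fixed_field 1" "c \<noteq> \<zero>" "primitive_element R (c \<otimes> x)"
    using norm_free_scale_primitive[OF x(1)] by blast
  have cx: "c \<otimes> x \<in> carrier R" using c xR by (simp add: fixed_field_def)
  have "completely_normal_element R q n (c \<otimes> x)"
  proof (rule H.completely_normal_of_level_one[OF m z cx])
    fix k assume "k < m"
    then have "c \<otimes> x \<notin> H.frob_kernel 1 (z [^]\<^bsub>alg_closure\<^esub> k)"
      using zc c xR x(2) by (intro H.frob_kernel_scale) auto
    then show "H.frob_sum 1 (z [^]\<^bsub>alg_closure\<^esub> k) (c \<otimes> x) \<noteq> \<zero>\<^bsub>alg_closure\<^esub>"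
      using cx by (simp add: H.frob_kernel_def)
  qed
  then show ?thesis using c cx by (auto simp: pcn_exists_def)
qed

text \<open>Level \<open>n\<close> is left out of \<open>D\<close>: its only condition is that the
  element is nonzero, and norm-free elements are.\<close>

lemma pcn_exists_all_levels:
  assumes D: "D = {l. l dvd n \<and> l < n}"
    and main: "(2 ^ card (prime_factors norm_index) - 1) * (\<Sum>l\<in>D. real (n div l))
      < sqrt (real (q ^ n)) * (1 - (\<Sum>l\<in>D. real (n div l) / real (q ^ l)))"
  shows pcn_exists
proof -
  interpret H: finite_field_hom R q n p e alg_closure indexed_const by (rule algebraic_closure_hom)
  let ?m = "\<lambda>l. prime_to_p (n div l)"
  have finD: "finite D" unfolding D by simp
  have lD: "l > 0" "l dvd n" "n div l > 0" if "l \<in> D" for l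
    using that n_pos unfolding D by (auto simp: div_greater_zero_iff intro: Nat.gr0I)
  have "\<exists>z. H.E.root_of_unity (?m l) z" if "l dvd n" for l
    using that n_pos by (intro ex_root_of_unity_closure prime_to_p) (auto simp: div_greater_zero_iff dvd_imp_le)
  then have "\<forall>l\<in>{l. l dvd n}. \<exists>z. H.E.root_of_unity (?m l) z" by blast
  from bchoice[OF this] obtain z where z: "\<And>l. l dvd n \<Longrightarrow> H.E.root_of_unity (?m l) (z l)" by blast
  have zc: "z l \<in> carrier alg_closure" if "l dvd n" for l using z[OF that] by (simp add: H.E.root_of_unity_def)
  define J where "J = (SIGMA l:D. {..<?m l})"
  have finJ: "finite J" unfolding J_def using finD by auto
  have cardJ: "real (card J) = (\<Sum>l\<in>D. real (?m l))" unfolding J_def using finD by simp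
  have sumJ: "(\<Sum>j\<in>J. 1 / real (q ^ fst j)) = (\<Sum>l\<in>D. real (?m l) / real (q ^ l))"
  proof -
    have "(\<Sum>j\<in>J. 1 / real (q ^ fst j)) = (\<Sum>l\<in>D. \<Sum>k\<in>{..<?m l}. 1 / real (q ^ l))"
      unfolding J_def using finD by (subst sum.Sigma) (auto simp: case_prod_beta)
    then show ?thesis by simp
  qed
  have "\<exists>x. norm_free x \<and> (\<forall>j\<in>J. x \<notin> H.frob_kernel (fst j) (z (fst j) [^]\<^bsub>alg_closure\<^esub> snd j))"
  proof (rule ex_norm_free_avoiding[OF finJ])
    fix j assume "j \<in> J"
    then have "fst j \<in> D" by (auto simp: J_def)
    then show "fst j > 0 \<and> fst j dvd n" using lD by auto
    show "subspace_over (fst j) (H.frob_kernel (fst j) (z (fst j) [^]\<^bsub>alg_closure\<^esub> snd j)) \<and>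
        H.frob_kernel (fst j) (z (fst j) [^]\<^bsub>alg_closure\<^esub> snd j) \<noteq> carrier R"
      using lD \<open>fst j \<in> D\<close> zc by (intro conjI H.frob_kernel_subspace) auto
  next
    \<comment> \<open>Counting \<open>n div l\<close> resolvents instead of those prime to the
      characteristic weakens the criterion but makes it independent of \<open>p\<close>.\<close>
    have m: "real (?m l) \<le> real (n div l)" if "l \<in> D" for l
      using prime_to_p(4)[OF lD(3)[OF that]] by simp
    have "(2 ^ card (prime_factors norm_index) - 1) * real (card J)
      \<le> (2 ^ card (prime_factors norm_index) - 1) * (\<Sum>l\<in>D. real (n div l))"
      unfolding cardJ by (intro mult_left_mono sum_mono m) auto
    also note main
    also have "sqrt (real (q ^ n)) * (1 - (\<Sum>l\<in>D. real (n div l) / real (q ^ l)))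
       \<le> sqrt (real (q ^ n)) * (1 - (\<Sum>j\<in>J. 1 / real (q ^ fst j)))"
      unfolding sumJ by (intro mult_left_mono diff_left_mono sum_mono divide_right_mono m) auto
    finally show "(2 ^ card (prime_factors norm_index) - 1) * real (card J)
       < sqrt (real (q ^ n)) * (1 - (\<Sum>j\<in>J. 1 / real (q ^ fst j)))" .
  qed
  then obtain x where x: "norm_free x"
    "\<And>l k. l \<in> D \<Longrightarrow> k < ?m l \<Longrightarrow> x \<notin> H.frob_kernel l (z l [^]\<^bsub>alg_closure\<^esub> k)"
    by (force simp: J_def)
  have xR: "x \<in> carrier R" "x \<noteq> \<zero>" using x by (auto simp: norm_free_def)
  obtain c where c: "c \<in> fixed_field 1" "c \<noteq> \<zero>" "primitive_element R (c \<otimes> x)"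
    using norm_free_scale_primitive[OF x(1)] by blast
  have cR: "c \<in> carrier R" using c by (simp add: fixed_field_def)
  have cx: "c \<otimes> x \<in> carrier R" "c \<otimes> x \<noteq> \<zero>" using c cR xR integral by auto
  have "completely_normal_element R q n (c \<otimes> x)"
    unfolding completely_normal_element_def
  proof (intro allI impI, elim conjE)
    fix l assume l: "l > 0" "l dvd n"
    have N0: "n div l > 0" using l n_pos by (auto simp: div_greater_zero_iff dvd_imp_le)
    show "normal_element R q n l (c \<otimes> x)"
    proof (rule H.normal_elementI[OF l prime_to_p(1)[OF N0] prime_to_p(3)[OF N0] prime_to_p(2)[OF N0] z[OF l(2)] cx(1)])
      fix k assume k: "k < ?m l"
      show "H.frob_sum l (z l [^]\<^bsub>alg_closure\<^esub> k) (c \<otimes> x) \<noteq> \<zero>\<^bsub>alg_closure\<^esub>"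
      proof (cases "l = n")
        case True
        have "H.frob_sum l (z l [^]\<^bsub>alg_closure\<^esub> k) (c \<otimes> x) = indexed_const (c \<otimes> x)"
          unfolding H.frob_sum_def using True n_pos cx(1) zc[OF l(2)]
          by (simp add: H.E.finsum_lessThan_Suc lessThan_Suc del: H.h.hom_mult)
        then show ?thesis using H.h_eq_zero_iff[OF cx(1)] cx(2) by simp
      next
        case False
        then have "l \<in> D" using l n_pos by (auto simp: D dest: dvd_imp_le)
        then have "c \<otimes> x \<notin> H.frob_kernel l (z l [^]\<^bsub>alg_closure\<^esub> k)"
          using zc[OF l(2)] c xR x(2) k by (intro H.frob_kernel_scale) auto
        then show ?thesis using cx by (simp add: H.frob_kernel_def)
      qed
    qed
  qed
  then show ?thesis using c cx by (auto simp: pcn_exists_def)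
qed

end

subsection \<open>Numerical verification\<close>

lemma prod_prime_factors_le:
  assumes "M > (0::nat)"
  shows "\<Prod>(prime_factors M) \<le> M"
proof -
  have "\<Prod>(prime_factors M) \<le> (\<Prod>r\<in>prime_factors M. r ^ multiplicity r M)"
  proof (rule prod_mono)
    fix r assume r: "r \<in> prime_factors M"
    then have "multiplicity r M \<ge> 1" by (simp add: prime_factors_multiplicity Suc_le_eq)
    moreover have "r \<ge> 1" using r by (auto simp: in_prime_factors_iff prime_ge_Suc_0_nat)
    ultimately show "0 \<le> r \<and> r \<le> r ^ multiplicity r M" by (simp add: self_le_power)
  qed
  also have "\<dots> = M" using prod_prime_factors[of M] assms by simp
  finally show ?thesis .
qed

text \<open>Each prime factor above \<open>16\<close> contributes more to \<open>M\<close> than the factor \<open>2\<^sup>4\<close> on the left.\<close>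

lemma two_pow_omega_bound:
  assumes M: "M > (0::nat)" and B: "finite B" "\<And>r. r \<in> B \<Longrightarrow> r \<le> 16"
    and small: "\<And>r. r \<in> prime_factors M \<Longrightarrow> r < 16 \<Longrightarrow> r \<in> B"
  shows "(2 ^ card (prime_factors M)) ^ 4 * \<Prod>B \<le> 16 ^ card B * M"
proof -
  define P where "P = prime_factors M"
  define S where "S = P \<inter> B"
  define T where "T = P - B"
  have fin: "finite P" "finite S" "finite T" using B by (auto simp: P_def S_def T_def)
  have cP: "card P = card S + card T"
  proof -
    have "P = S \<union> T" "S \<inter> T = {}" by (auto simp: S_def T_def)
    then show ?thesis using card_Un_disjoint[OF fin(2,3)] by simp
  qed
  \<comment> \<open>Elements of \<open>B\<close> that do not divide \<open>M\<close> do no harm: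
    each is at most 16 on the left and contributes 16 on the right.\<close>
  have "\<Prod>(B - S) \<le> 16 ^ card (B - S)"
    using prod_mono[of "B - S" "\<lambda>x. x" "\<lambda>_. 16"] B by simp
  moreover have "\<Prod>B = \<Prod>(B - S) * \<Prod>S"
    using B prod.subset_diff[of S B "\<lambda>x. x"] by (simp add: S_def)
  moreover have "16 ^ card T \<le> \<Prod>T"
    using prod_mono[of T "\<lambda>_. 16" "\<lambda>x. x"] small fin by (force simp: T_def P_def not_less)
  ultimately have "16 ^ card T * \<Prod>B \<le> \<Prod>T * (16 ^ card (B - S) * \<Prod>S)"
    by (simp add: mult_le_mono)
  then have "16 ^ card S * (16 ^ card T * \<Prod>B) \<le> 16 ^ card S * (\<Prod>T * (16 ^ card (B - S) * \<Prod>S))"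
    by (rule mult_le_mono2)
  also have "\<dots> = 16 ^ (card S + card (B - S)) * (\<Prod>T * \<Prod>S)" by (simp add: power_add mult_ac)
  also have "\<Prod>T * \<Prod>S = \<Prod>P"
    using fin prod.subset_diff[of S P "\<lambda>x. x"] by (simp add: S_def T_def Diff_Int)
  also have "card S + card (B - S) = card B"
    using B by (subst card_Diff_subset) (auto simp: S_def card_mono)
  also have "16 ^ card S * (16 ^ card T * \<Prod>B) = (2 ^ card P) ^ 4 * \<Prod>B"
  proof -
    have "((2::nat) ^ card P) ^ 4 = (2 ^ 4) ^ card P" by (simp only: power_mult[symmetric] mult.commute)
    then show ?thesis by (simp add: cP power_add mult_ac)
  qed
  also have "16 ^ card B * \<Prod>P \<le> 16 ^ card B * M"
    using prod_prime_factors_le[OF M] by (simp add: P_def)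
  finally show ?thesis by (simp add: P_def)
qed

lemma prime_less_16:
  assumes "prime (r::nat)" "r < 16"
  shows "r \<in> {2, 3, 5, 7, 11, 13}"
proof -
  have "r = 0 \<or> r = 1 \<or> r = 2 \<or> r = 3 \<or> r = 4 \<or> r = 5 \<or> r = 6 \<or> r = 7 \<or> r = 8 \<or> r = 9 \<or> r = 10
    \<or> r = 11 \<or> r = 12 \<or> r = 13 \<or> r = 14 \<or> r = 15" using assms(2) by presburger
  then show ?thesis using assms(1) by (elim disjE) simp_all
qed

text \<open>The constants are the product of the primes below 16 and \<open>16 ^ 6\<close>.\<close>

lemma two_pow_omega_bound_13:
  assumes "M > (0::nat)"
  shows "(2 ^ card (prime_factors M)) ^ 4 * 30030 \<le> 16777216 * M"
proof -
  have "(2 ^ card (prime_factors M)) ^ 4 * \<Prod>{2, 3, 5, 7, 11, 13} \<le> 16 ^ card {2, 3, 5, 7, 11, 13::nat} * M"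
  proof (rule two_pow_omega_bound[OF assms])
    fix r assume "r \<in> prime_factors M" "r < 16"
    then show "r \<in> {2, 3, 5, 7, 11, 13}" using prime_less_16 by (simp add: in_prime_factors_iff)
  qed auto
  then show ?thesis by simp
qed

lemma prime_dvd_prod_list_primes:
  assumes "prime (r::nat)" "r dvd prod_list xs" "\<forall>s\<in>set xs. prime s"
  shows "r \<in> set xs"
proof -
  from assms(1,2) obtain s where "s \<in> set xs" "r dvd s"
    by (induction xs) (auto simp: prime_dvd_mult_iff)
  then show ?thesis using assms primes_dvd_imp_eq by blast
qed

lemma card_prime_factors_prod_list:
  assumes "M = prod_list xs" "\<forall>r\<in>set xs. prime (r::nat)"
  shows "card (prime_factors M) \<le> card (set xs)"
  using assms prime_dvd_prod_list_primes by (intro card_mono) (auto simp: in_prime_factors_iff)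

text \<open>If \<open>M\<close> had more than \<open>w\<close> prime factors,
  \<open>two_pow_omega_bound\<close> would contradict \<open>lt\<close>. So knowing the small prime
  divisors bounds the number of prime factors without factoring \<open>M\<close>.\<close>

lemma card_prime_factors_le:
  assumes "M > (0::nat)" "finite B" "\<forall>r\<in>{2, 3, 5, 7, 11, 13}. r dvd M \<longrightarrow> r \<in> B" "\<forall>r\<in>B. r \<le> 16 \<and> 0 < r"
    and lt: "16 ^ card B * M < 16 ^ Suc w * \<Prod>B"
  shows "card (prime_factors M) \<le> w"
proof -
  have "(2 ^ card (prime_factors M)) ^ 4 * \<Prod>B \<le> 16 ^ card B * M"
    using assms(2-4) prime_less_16 by (intro two_pow_omega_bound assms(1)) (auto simp: in_prime_factors_iff)
  also note lt
  finally have "(2 ^ card (prime_factors M)) ^ 4 < (16::nat) ^ Suc w" using assms(4) by simp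
  also have "(2 ^ card (prime_factors M)) ^ 4 = (16::nat) ^ card (prime_factors M)"
  proof -
    have "((2::nat) ^ card (prime_factors M)) ^ 4 = (2 ^ 4) ^ card (prime_factors M)"
      by (simp only: power_mult[symmetric] mult.commute)
    then show ?thesis by simp
  qed
  finally have "card (prime_factors M) < Suc w" by (rule power_less_imp_less_exp[rotated]) simp
  then show ?thesis by simp
qed

text \<open>Squaring leaves a rational inequality, which simplification can decide for
  numerals.\<close>

lemma mult_sqrt_less:
  assumes "0 \<le> A" "((2 ^ w - 1) * B)\<^sup>2 < Q * A\<^sup>2" "w' \<le> w" "0 \<le> B" "0 \<le> Q"
  shows "(2 ^ w' - 1) * B < sqrt Q * (A::real)"
proof -
  have "(2 ^ w - 1) * B < sqrt (Q * A\<^sup>2)" using assms(2) by (rule real_less_rsqrt)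
  also have "\<dots> = sqrt Q * A" using assms by (simp add: real_sqrt_mult)
  finally have "(2 ^ w - 1) * B < sqrt Q * A" .
  moreover have "(2 ^ w' - 1) * B \<le> (2 ^ w - 1) * (B::real)"
    using assms by (intro mult_right_mono diff_right_mono power_increasing) auto
  ultimately show ?thesis by simp
qed

lemma proper_divisors_eq: "n > 0 \<Longrightarrow> {l::nat. l dvd n \<and> l < n} = set (filter (\<lambda>l. l dvd n) [1..<n])"
  by (auto intro: Nat.gr0I simp: Suc_le_eq)

section \<open>Reducing the criteria to inequalities in \<open>q\<close>\<close>

context finite_field_ext
begin

lemma norm_index_pos: "norm_index > 0"
  using norm_index_mult qn_gt_1 by (cases "norm_index = 0") auto

text \<open>Both sides are compared in fourth powers, where the bound on the number of prime factors
  is linear in \<open>norm_index\<close> and the square root becomes the square of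
  \<open>q ^ n\<close>. One factor \<open>q ^ n\<close> cancels because
  \<open>norm_index * (q - 1) < q ^ n\<close>, and \<open>main\<close> is what remains.\<close>

lemma large_bound:
  assumes W: "(2 ^ card (prime_factors norm_index)) ^ 4 * c2 \<le> c1 * norm_index" and c2: "c2 > (0::nat)"
    and A: "A > (0::real)" and B: "B \<ge> 0"
    and main: "real c1 * B ^ 4 \<le> real c2 * real q ^ n * (real q - 1) * A ^ 4"
  shows "(2 ^ card (prime_factors norm_index) - 1) * B < sqrt (real (q ^ n)) * A"
proof -
  define w where "w = (2::real) ^ card (prime_factors norm_index)"
  define Q where "Q = real q ^ n"
  have w: "w ^ 4 * real c2 \<le> real c1 * real norm_index"
  proof -
    have "real ((2 ^ card (prime_factors norm_index)) ^ 4 * c2) \<le> real (c1 * norm_index)"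
      using W by (simp only: of_nat_le_iff)
    then show ?thesis by (simp add: w_def)
  qed
  have Q0: "Q > 0" using q_gt_1 by (simp add: Q_def)
  have q1: "real q - 1 > 0" using q_gt_1 by simp
  have M: "real norm_index * (real q - 1) < Q"
  proof -
    have "real (norm_index * (q - 1)) = real (q ^ n) - 1"
      unfolding norm_index_mult using qn_gt_1 by (subst of_nat_diff) auto
    then show ?thesis using q_gt_1 by (simp add: Q_def of_nat_diff)
  qed
  have w0: "w \<ge> 1" by (simp add: w_def)
  \<comment> \<open>The rule is stated with \<open>Suc\<close>, so the \<open>3\<close> below means
    fourth powers.\<close>
  have "w * B \<le> sqrt Q * A"
  proof (rule power_le_imp_le_base[of _ 3])
    have "real c2 * (real q - 1) * (w * B) ^ 4 = (w ^ 4 * real c2) * ((real q - 1) * B ^ 4)"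
      by (simp add: power_mult_distrib mult_ac)
    also have "\<dots> \<le> (real c1 * real norm_index) * ((real q - 1) * B ^ 4)"
      using w q1 B by (intro mult_right_mono) auto
    also have "\<dots> = (real norm_index * (real q - 1)) * (real c1 * B ^ 4)" by (simp add: mult_ac)
    also have "\<dots> \<le> Q * (real c1 * B ^ 4)" using M B by (intro mult_right_mono) auto
    also have "\<dots> \<le> Q * (real c2 * Q * (real q - 1) * A ^ 4)"
      using main Q0 by (intro mult_left_mono) (auto simp: Q_def)
    also have "\<dots> = real c2 * (real q - 1) * (sqrt Q * A) ^ 4"
    proof -
      have "sqrt Q ^ 4 = (sqrt Q ^ 2) ^ 2" by (simp only: power_mult[symmetric]) simp
      then have "sqrt Q ^ 4 = Q * Q" using Q0 by (simp add: power2_eq_square)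
      then show ?thesis by (simp add: power_mult_distrib mult_ac)
    qed
    finally have "(w * B) ^ 4 \<le> (sqrt Q * A) ^ 4" using c2 q1 by simp
    then show "(w * B) ^ Suc 3 \<le> (sqrt Q * A) ^ Suc 3" by (simp add: numeral_eq_Suc)
  qed (use Q0 A in simp)
  moreover have "(w - 1) * B < w * B \<or> B = 0" using B by (auto simp: algebra_simps)
  moreover have "0 < sqrt Q * A" using Q0 A by simp
  ultimately have "(w - 1) * B < sqrt Q * A" by auto
  then show ?thesis by (simp add: w_def Q_def)
qed

lemma pcn_exists_all_levels_direct:
  assumes D: "D = {l. l dvd n \<and> l < n}" and w: "card (prime_factors norm_index) \<le> w"
    and A: "0 \<le> A" "A \<le> 1 - (\<Sum>l\<in>D. real (n div l) / real (q ^ l))"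
    and main: "((2 ^ w - 1) * (\<Sum>l\<in>D. real (n div l)))\<^sup>2 < real (q ^ n) * A\<^sup>2"
  shows pcn_exists
proof (rule pcn_exists_all_levels[OF D])
  have "(2 ^ card (prime_factors norm_index) - 1) * (\<Sum>l\<in>D. real (n div l)) < sqrt (real (q ^ n)) * A"
    using A main w by (intro mult_sqrt_less[where w = w]) (auto intro: sum_nonneg)
  also have "\<dots> \<le> sqrt (real (q ^ n)) * (1 - (\<Sum>l\<in>D. real (n div l) / real (q ^ l)))"
    using A by (intro mult_left_mono) auto
  finally show "(2 ^ card (prime_factors norm_index) - 1) * (\<Sum>l\<in>D. real (n div l))
      < sqrt (real (q ^ n)) * (1 - (\<Sum>l\<in>D. real (n div l) / real (q ^ l)))" .
qed

lemma pcn_exists_level_one_direct: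
  assumes "m = prime_to_p n" "m dvd q - 1" and w: "card (prime_factors norm_index) \<le> w"
    and "m \<le> q" "((2 ^ w - 1) * real m)\<^sup>2 < real (q ^ n) * (1 - real m / real q)\<^sup>2"
  shows pcn_exists
  by (rule pcn_exists_level_one[OF assms(1,2)])
    (use assms(4,5) w in \<open>auto intro!: mult_sqrt_less[where w = w] simp: divide_le_eq\<close>)

text \<open>The sum over \<open>D\<close> decreases with \<open>q\<close> and the right side
  increases, so the inequality need only be checked at the threshold \<open>q0\<close>.\<close>

lemma pcn_exists_all_levels_large:
  assumes D: "D = {l. l dvd n \<and> l < n}"
    and W: "(2 ^ card (prime_factors norm_index)) ^ 4 * c2 \<le> c1 * norm_index" "c2 > (0::nat)"
    and q0: "q \<ge> q0" "q0 \<ge> 2"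
    and A: "A > 0" "A \<le> 1 - (\<Sum>l\<in>D. real (n div l) / real q0 ^ l)"
    and main: "real c1 * (\<Sum>l\<in>D. real (n div l)) ^ 4 \<le> real c2 * real q0 ^ n * (real q0 - 1) * A ^ 4"
  shows pcn_exists
proof (rule pcn_exists_all_levels[OF D], rule large_bound[OF W])
  have "(\<Sum>l\<in>D. real (n div l) / real (q ^ l)) \<le> (\<Sum>l\<in>D. real (n div l) / real q0 ^ l)"
    using q0 by (intro sum_mono divide_left_mono) (auto intro!: power_mono)
  then have AA: "A \<le> 1 - (\<Sum>l\<in>D. real (n div l) / real (q ^ l))" using A by linarith
  then show "0 < 1 - (\<Sum>l\<in>D. real (n div l) / real (q ^ l))" using A by linarith
  show "0 \<le> (\<Sum>l\<in>D. real (n div l))" by (auto intro: sum_nonneg)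
  note main
  also have "real c2 * real q0 ^ n * (real q0 - 1) * A ^ 4 \<le>
      real c2 * real q ^ n * (real q - 1) * (1 - (\<Sum>l\<in>D. real (n div l) / real (q ^ l))) ^ 4"
    using q0 A AA by (intro mult_mono power_mono) auto
  finally show "real c1 * (\<Sum>l\<in>D. real (n div l)) ^ 4 \<le>
      real c2 * real q ^ n * (real q - 1) * (1 - (\<Sum>l\<in>D. real (n div l) / real (q ^ l))) ^ 4" .
qed

lemma omega_bound: "(2 ^ card (prime_factors norm_index)) ^ 4 * 30030 \<le> 16777216 * norm_index"
  by (rule two_pow_omega_bound_13[OF norm_index_pos])

text \<open>For \<open>n = 3\<close> all prime factors of \<open>q\<^sup>2 + q + 1\<close> other than \<open>3\<close> are congruent to \<open>1\<close> modulo \<open>3\<close>;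
  in particular \<open>2\<close>, \<open>5\<close> and \<open>11\<close> do not occur.\<close>

lemma omega_bound_cubic:
  assumes n: "n = 3"
  shows "(2 ^ card (prime_factors norm_index)) ^ 4 * 273 \<le> 4096 * norm_index"
proof -
  have M: "norm_index = q\<^sup>2 + q + 1"
  proof -
    have "q ^ 3 - 1 = (q\<^sup>2 + q + 1) * (q - 1)"
      using q_gt_1 by (simp add: algebra_simps power2_eq_square power3_eq_cube diff_mult_distrib2)
    then have "q ^ n - 1 = (q\<^sup>2 + q + 1) * (q - 1)" by (simp only: n)
    then have "norm_index * (q - 1) = (q\<^sup>2 + q + 1) * (q - 1)" by (simp only: norm_index_mult)
    moreover have "q - 1 \<noteq> 0" using q_gt_1 by simp
    ultimately show ?thesis using mult_right_cancel[of "q - 1" norm_index "q\<^sup>2 + q + 1"] by blast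
  qed
  \<comment> \<open>Divisibility of \<open>q\<^sup>2 + q + 1\<close> by \<open>r\<close> depends
    only on \<open>q mod r\<close>, so finitely many evaluations decide it.\<close>
  have step: "\<not> r dvd norm_index" if "r > 0" "\<forall>k\<in>set [0..<r]. (k\<^sup>2 + k + 1) mod r \<noteq> 0" for r
  proof
    assume d: "r dvd norm_index"
    have "(q\<^sup>2 + q + 1) mod r = ((q mod r)\<^sup>2 + q mod r + 1) mod r" by (metis mod_add_cong mod_mod_trivial power_mod)
    then have zero: "((q mod r)\<^sup>2 + q mod r + 1) mod r = 0" using d unfolding M by (simp only: dvd_eq_mod_eq_0)
    have mem: "q mod r \<in> set [0..<r]" using that by simp
    show False using bspec[OF that(2) mem] zero by (rule notE)
  qed
  have "\<forall>r\<in>{2, 5, 11}. \<forall>k\<in>set [0..<r]. (k\<^sup>2 + k + 1) mod r \<noteq> (0::nat)" by code_simp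
  then have nd: "\<not> r dvd norm_index" if "r \<in> {2, 5, 11}" for r
    using step[of r] that by auto
  show ?thesis
  proof -
    have "(2 ^ card (prime_factors norm_index)) ^ 4 * \<Prod>{3, 7, 13} \<le> 16 ^ card {3, 7, 13::nat} * norm_index"
    proof (rule two_pow_omega_bound[OF norm_index_pos])
      fix r assume "r \<in> prime_factors norm_index" "r < 16"
      then have "r \<in> {2, 3, 5, 7, 11, 13}" "r dvd norm_index"
        using prime_less_16 by (auto simp: in_prime_factors_iff)
      then show "r \<in> {3, 7, 13}" using nd by blast
    qed auto
    then show ?thesis by simp
  qed
qed

lemma prime_dvd_q_eq:
  assumes "prime r" "r dvd q"
  shows "r = p"
  using assms prime_p unfolding q_eq by (metis prime_dvd_power primes_dvd_imp_eq)

text \<open>It removes the values 6, 10, 12, 14, 15 and 18 of \<open>q\<close> from the case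
  analysis.\<close>

lemma two_primes_not_dvd_q: "prime r \<Longrightarrow> prime s \<Longrightarrow> r \<noteq> s \<Longrightarrow> \<not> (r dvd q \<and> s dvd q)"
  using prime_dvd_q_eq by metis

end

lemma proper_divisors_numerals:
  "{l::nat. l dvd 3 \<and> l < 3} = {1}"
  "{l::nat. l dvd 4 \<and> l < 4} = {1, 2}"
  "{l::nat. l dvd 5 \<and> l < 5} = {1}"
  "{l::nat. l dvd 6 \<and> l < 6} = {1, 2, 3}"
  "{l::nat. l dvd 7 \<and> l < 7} = {1}"
  "{l::nat. l dvd 8 \<and> l < 8} = {1, 2, 4}"
  "{l::nat. l dvd 9 \<and> l < 9} = {1, 3}"
  "{l::nat. l dvd 10 \<and> l < 10} = {1, 2, 5}"
  "{l::nat. l dvd 11 \<and> l < 11} = {1}"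
  "{l::nat. l dvd 12 \<and> l < 12} = {1, 2, 3, 4, 6}"
  by (subst proper_divisors_eq, simp, code_simp)+

section \<open>The degrees from 3 to 12\<close>

context finite_field_ext
begin

lemma pcn_exists_level_one_large:
  assumes m: "m = prime_to_p n" "m dvd q - 1"
    and main: "16777216 * real m ^ 4 \<le> 30030 * real q ^ n * (real q - 1) * (1 - real m / real q) ^ 4"
  shows pcn_exists
proof (rule pcn_exists_level_one[OF m], rule large_bound[OF omega_bound])
  have "m \<le> q - 1" using m q_gt_1 by (intro dvd_imp_le) auto
  then show "0 < 1 - real m / real q" using q_gt_1 by (simp add: divide_less_eq)
qed (use main in auto)

lemma prime_to_p_eqI:
  assumes "prime r" "r dvd q" "n = m * r ^ b" "coprime m r"
  shows "m = prime_to_p n"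
  using prime_to_p_unique[of n m b] prime_dvd_q_eq[OF assms(1,2)] assms(3,4) n_pos by simp

text \<open>All premises on \<open>n'\<close> and \<open>q'\<close> become numeral goals.
  \<open>B\<close> contains the primes below 16 dividing the norm index, and \<open>w\<close> is the
  bound on the number of its prime factors that its size then allows.\<close>

lemma pcn_exists_all_levels_small:
  assumes nq: "n = n'" "q = q'" and D: "{l. l dvd n' \<and> l < n'} = D"
    and B: "finite B" "\<forall>r\<in>{2, 3, 5, 7, 11, 13}. r dvd (q' ^ n' - 1) div (q' - 1) \<longrightarrow> r \<in> B"
      "\<forall>r\<in>B. r \<le> 16 \<and> 0 < r" "16 ^ card B * ((q' ^ n' - 1) div (q' - 1)) < 16 ^ Suc w * \<Prod>B"
    and A: "0 \<le> 1 - (\<Sum>l\<in>D. real (n' div l) / real (q' ^ l))"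
      "((2 ^ w - 1) * (\<Sum>l\<in>D. real (n' div l)))\<^sup>2 < real (q' ^ n') * (1 - (\<Sum>l\<in>D. real (n' div l) / real (q' ^ l)))\<^sup>2"
  shows pcn_exists
proof (rule pcn_exists_all_levels_direct)
  show "D = {l. l dvd n \<and> l < n}" unfolding nq D ..
  have "norm_index = (q' ^ n' - 1) div (q' - 1)" using norm_index_def by (simp only: nq)
  then show "card (prime_factors norm_index) \<le> w"
    using B norm_index_pos by (intro card_prime_factors_le) simp_all
qed (use A in \<open>simp_all only: nq order_refl\<close>)

text \<open>Here \<open>r\<close> is the characteristic and \<open>m\<close> the part of the degree
  prime to it.\<close>

lemma pcn_exists_level_one_small:
  assumes nq: "n = n'" "q = q'" and m: "prime r" "r dvd q'" "n' = m * r ^ b" "coprime m r" "m dvd q' - 1"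
    and B: "finite B" "\<forall>r\<in>{2, 3, 5, 7, 11, 13}. r dvd (q' ^ n' - 1) div (q' - 1) \<longrightarrow> r \<in> B"
      "\<forall>r\<in>B. r \<le> 16 \<and> 0 < r" "16 ^ card B * ((q' ^ n' - 1) div (q' - 1)) < 16 ^ Suc w * \<Prod>B"
    and A: "m \<le> q'" "((2 ^ w - 1) * real m)\<^sup>2 < real (q' ^ n') * (1 - real m / real q')\<^sup>2"
  shows pcn_exists
proof (rule pcn_exists_level_one_direct)
  show "m = prime_to_p n" using m by (intro prime_to_p_eqI[of r m b]) (simp_all only: nq)
  have "norm_index = (q' ^ n' - 1) div (q' - 1)" using norm_index_def by (simp only: nq)
  then show "card (prime_factors norm_index) \<le> w"
    using B norm_index_pos by (intro card_prime_factors_le) simp_all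
qed (use m A in \<open>simp_all only: nq\<close>)

lemma pcn_exists_all_levels_ge:
  assumes n: "n = n'" and q: "q \<ge> q'" and D: "{l. l dvd n' \<and> l < n'} = D"
    and W: "(2 ^ card (prime_factors norm_index)) ^ 4 * c2 \<le> c1 * norm_index"
    and main: "c2 > (0::nat)" "q' \<ge> 2" "0 < 1 - (\<Sum>l\<in>D. real (n' div l) / real q' ^ l)"
     "real c1 * (\<Sum>l\<in>D. real (n' div l)) ^ 4
       \<le> real c2 * real q' ^ n' * (real q' - 1) * (1 - (\<Sum>l\<in>D. real (n' div l) / real q' ^ l)) ^ 4"
  shows pcn_exists
proof (rule pcn_exists_all_levels_large[OF _ W main(1) q main(2)])
  show "D = {l. l dvd n \<and> l < n}" unfolding n D ..
qed (use main in \<open>simp_all only: n order_refl\<close>)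

lemma pcn_exists_3_3: "n = 3 \<Longrightarrow> q = 3 \<Longrightarrow> pcn_exists"
  by (erule (1) pcn_exists_level_one_small[where r = 3 and m = 1 and b = 1 and B = "{13}" and w = 1])
    (simp_all add: power2_eq_square coprime_iff_gcd_eq_1 gcd_non_0_nat)

lemma pcn_exists_3_5: "n = 3 \<Longrightarrow> q = 5 \<Longrightarrow> pcn_exists"
  by (erule (1) pcn_exists_all_levels_small[OF _ _ proper_divisors_numerals(1), where B = "{}" and w = 1])
    (simp_all add: power2_eq_square)

lemma pcn_exists_3_7: "n = 3 \<Longrightarrow> q = 7 \<Longrightarrow> pcn_exists"
  by (erule (1) pcn_exists_all_levels_small[OF _ _ proper_divisors_numerals(1), where B = "{3}" and w = 2])
    (simp_all add: power2_eq_square)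

lemma pcn_exists_3_8: "n = 3 \<Longrightarrow> q = 8 \<Longrightarrow> pcn_exists"
  by (erule (1) pcn_exists_all_levels_small[OF _ _ proper_divisors_numerals(1), where B = "{}" and w = 1])
    (simp_all add: power2_eq_square)

lemma pcn_exists_3_9: "n = 3 \<Longrightarrow> q = 9 \<Longrightarrow> pcn_exists"
  by (erule (1) pcn_exists_all_levels_small[OF _ _ proper_divisors_numerals(1), where B = "{7, 13}" and w = 2])
    (simp_all add: power2_eq_square)

text \<open>With the constants of \<open>omega_bound\<close> the inequality would miss by a factor
  of about 20 at \<open>q = 10\<close>; the cubic refinement makes this threshold possible.\<close>

lemma pcn_exists_3_large:
  assumes "n = 3" "q \<ge> 10"
  shows pcn_exists
  by (rule pcn_exists_all_levels_ge[OF assms proper_divisors_numerals(1) omega_bound_cubic[OF assms(1)]])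
    (simp_all add: power_divide)

lemma pcn_exists_4_4: "n = 4 \<Longrightarrow> q = 4 \<Longrightarrow> pcn_exists"
  by (erule (1) pcn_exists_level_one_small[where r = 2 and m = 1 and b = 2 and B = "{5}" and w = 2])
    (simp_all add: power2_eq_square coprime_iff_gcd_eq_1 gcd_non_0_nat)

text \<open>The size of the norm index 400 only shows that it has at most 3 prime factors, and 3 is
  too many for the criterion. The square factors make the true number 2.\<close>

lemma pcn_exists_4_7:
  assumes nq: "n = 4" "q = 7"
  shows pcn_exists
proof (rule pcn_exists_all_levels_direct)
  show "{1, 2} = {l. l dvd n \<and> l < n}" unfolding nq proper_divisors_numerals ..
  have "card (prime_factors norm_index) \<le> card (set ([2, 2, 2, 2, 5, 5] :: nat list))"
    using norm_index_def by (intro card_prime_factors_prod_list) (simp_all add: nq)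
  then show "card (prime_factors norm_index) \<le> 2" by simp
  show "0 \<le> (19 / 49 :: real)" by simp
qed (simp_all add: nq power2_eq_square)

lemma pcn_exists_4_8: "n = 4 \<Longrightarrow> q = 8 \<Longrightarrow> pcn_exists"
  by (erule (1) pcn_exists_level_one_small[where r = 2 and m = 1 and b = 2 and B = "{3, 5, 13}" and w = 3])
    (simp_all add: power2_eq_square coprime_iff_gcd_eq_1 gcd_non_0_nat)

lemma pcn_exists_4_9: "n = 4 \<Longrightarrow> q = 9 \<Longrightarrow> pcn_exists"
  by (erule (1) pcn_exists_all_levels_small[OF _ _ proper_divisors_numerals(2), where B = "{2, 5}" and w = 3])
    (simp_all add: power2_eq_square)

lemma pcn_exists_4_11: "n = 4 \<Longrightarrow> q = 11 \<Longrightarrow> pcn_exists"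
  by (erule (1) pcn_exists_all_levels_small[OF _ _ proper_divisors_numerals(2), where B = "{2, 3}" and w = 3])
    (simp_all add: power2_eq_square)

lemma pcn_exists_4_13: "n = 4 \<Longrightarrow> q = 13 \<Longrightarrow> pcn_exists"
  by (erule (1) pcn_exists_all_levels_small[OF _ _ proper_divisors_numerals(2), where B = "{2, 5, 7}" and w = 4])
    (simp_all add: power2_eq_square)

lemma pcn_exists_4_16: "n = 4 \<Longrightarrow> q = 16 \<Longrightarrow> pcn_exists"
  by (erule (1) pcn_exists_all_levels_small[OF _ _ proper_divisors_numerals(2), where B = "{}" and w = 3])
    (simp_all add: power2_eq_square)

lemma pcn_exists_4_17: "n = 4 \<Longrightarrow> q = 17 \<Longrightarrow> pcn_exists"
  by (erule (1) pcn_exists_all_levels_small[OF _ _ proper_divisors_numerals(2), where B = "{2, 3, 5}" and w = 4])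
    (simp_all add: power2_eq_square)

lemma pcn_exists_4_large: "n = 4 \<Longrightarrow> q \<ge> 19 \<Longrightarrow> pcn_exists"
  by (erule (1) pcn_exists_all_levels_ge[OF _ _ proper_divisors_numerals(2) omega_bound]) (simp_all add: power_divide)

lemma pcn_exists_5_5: "n = 5 \<Longrightarrow> q = 5 \<Longrightarrow> pcn_exists"
  by (erule (1) pcn_exists_level_one_small[where r = 5 and m = 1 and b = 1 and B = "{11}" and w = 2])
    (simp_all add: power2_eq_square coprime_iff_gcd_eq_1 gcd_non_0_nat)

lemma pcn_exists_5_7: "n = 5 \<Longrightarrow> q = 7 \<Longrightarrow> pcn_exists"
  by (erule (1) pcn_exists_all_levels_small[OF _ _ proper_divisors_numerals(3), where B = "{}" and w = 2])
    (simp_all add: power2_eq_square)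

lemma pcn_exists_5_8: "n = 5 \<Longrightarrow> q = 8 \<Longrightarrow> pcn_exists"
  by (erule (1) pcn_exists_all_levels_small[OF _ _ proper_divisors_numerals(3), where B = "{}" and w = 3])
    (simp_all add: power2_eq_square)

lemma pcn_exists_5_9: "n = 5 \<Longrightarrow> q = 9 \<Longrightarrow> pcn_exists"
  by (erule (1) pcn_exists_all_levels_small[OF _ _ proper_divisors_numerals(3), where B = "{11}" and w = 3])
    (simp_all add: power2_eq_square)

lemma pcn_exists_5_11: "n = 5 \<Longrightarrow> q = 11 \<Longrightarrow> pcn_exists"
  by (erule (1) pcn_exists_all_levels_small[OF _ _ proper_divisors_numerals(3), where B = "{5}" and w = 3])
    (simp_all add: power2_eq_square)

lemma pcn_exists_5_large: "n = 5 \<Longrightarrow> q \<ge> 13 \<Longrightarrow> pcn_exists"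
  by (erule (1) pcn_exists_all_levels_ge[OF _ _ proper_divisors_numerals(3) omega_bound]) (simp_all add: power_divide)

text \<open>As before, the size of the norm index allows 4 prime factors, whereas the criterion
  needs the true number 3.\<close>

lemma pcn_exists_6_8:
  assumes nq: "n = 6" "q = 8"
  shows pcn_exists
proof (rule pcn_exists_all_levels_direct)
  show "{1, 2, 3} = {l. l dvd n \<and> l < n}" unfolding nq proper_divisors_numerals ..
  have "card (prime_factors norm_index) \<le> card (set ([3, 3, 3, 19, 73] :: nat list))"
    using norm_index_def by (intro card_prime_factors_prod_list) (simp_all add: nq)
  then show "card (prime_factors norm_index) \<le> 3" by simp
  show "0 \<le> (51 / 256 :: real)" by simp
qed (simp_all add: nq power2_eq_square)

lemma pcn_exists_6_9: "n = 6 \<Longrightarrow> q = 9 \<Longrightarrow> pcn_exists"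
  by (erule (1) pcn_exists_level_one_small[where r = 3 and m = 2 and b = 1 and B = "{2, 5, 7, 13}" and w = 5])
    (simp_all add: power2_eq_square coprime_iff_gcd_eq_1 gcd_non_0_nat)

text \<open>The size narrowly allows 6 prime factors; the true number 5 is needed.\<close>

lemma pcn_exists_6_11:
  assumes nq: "n = 6" "q = 11"
  shows pcn_exists
proof (rule pcn_exists_all_levels_direct)
  show "{1, 2, 3} = {l. l dvd n \<and> l < n}" unfolding nq proper_divisors_numerals ..
  have "card (prime_factors norm_index) \<le> card (set ([2, 2, 3, 3, 7, 19, 37] :: nat list))"
    using norm_index_def by (intro card_prime_factors_prod_list) (simp_all add: nq)
  then show "card (prime_factors norm_index) \<le> 5" by simp
  show "0 \<le> (570 / 1331 :: real)" by simp
qed (simp_all add: nq power2_eq_square)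

lemma pcn_exists_6_13: "n = 6 \<Longrightarrow> q = 13 \<Longrightarrow> pcn_exists"
  by (erule (1) pcn_exists_all_levels_small[OF _ _ proper_divisors_numerals(4), where B = "{2, 3, 7}" and w = 6])
    (simp_all add: power2_eq_square)

lemma pcn_exists_6_large: "n = 6 \<Longrightarrow> q \<ge> 14 \<Longrightarrow> pcn_exists"
  by (erule (1) pcn_exists_all_levels_ge[OF _ _ proper_divisors_numerals(4) omega_bound]) (simp_all add: power_divide)

lemma pcn_exists_7_7: "n = 7 \<Longrightarrow> q = 7 \<Longrightarrow> pcn_exists"
  by (erule (1) pcn_exists_level_one_small[where r = 7 and m = 1 and b = 1 and B = "{}" and w = 4])
    (simp_all add: power2_eq_square coprime_iff_gcd_eq_1 gcd_non_0_nat)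

lemma pcn_exists_7_8: "n = 7 \<Longrightarrow> q = 8 \<Longrightarrow> pcn_exists"
  by (erule (1) pcn_exists_all_levels_small[OF _ _ proper_divisors_numerals(5), where B = "{7}" and w = 4])
    (simp_all add: power2_eq_square)

lemma pcn_exists_7_9: "n = 7 \<Longrightarrow> q = 9 \<Longrightarrow> pcn_exists"
  by (erule (1) pcn_exists_all_levels_small[OF _ _ proper_divisors_numerals(5), where B = "{}" and w = 4])
    (simp_all add: power2_eq_square)

lemma pcn_exists_7_large: "n = 7 \<Longrightarrow> q \<ge> 11 \<Longrightarrow> pcn_exists"
  by (erule (1) pcn_exists_all_levels_ge[OF _ _ proper_divisors_numerals(5) omega_bound]) (simp_all add: power_divide)

lemma pcn_exists_8_8: "n = 8 \<Longrightarrow> q = 8 \<Longrightarrow> pcn_exists"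
  by (erule (1) pcn_exists_level_one_small[where r = 2 and m = 1 and b = 3 and B = "{3, 5, 13}" and w = 6])
    (simp_all add: power2_eq_square coprime_iff_gcd_eq_1 gcd_non_0_nat)

text \<open>The criterion with all levels fails here even with the exact number 5 of prime factors.
  Since \<open>8 = q - 1\<close>, level one suffices.\<close>

lemma pcn_exists_8_9: "n = 8 \<Longrightarrow> q = 9 \<Longrightarrow> pcn_exists"
  by (erule (1) pcn_exists_level_one_small[where r = 3 and m = 8 and b = 0 and B = "{2, 5}" and w = 6])
    (simp_all add: power2_eq_square coprime_iff_gcd_eq_1 gcd_non_0_nat)

lemma pcn_exists_8_11: "n = 8 \<Longrightarrow> q = 11 \<Longrightarrow> pcn_exists"
  by (erule (1) pcn_exists_all_levels_small[OF _ _ proper_divisors_numerals(6), where B = "{2, 3}" and w = 7])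
    (simp_all add: power2_eq_square)

lemma pcn_exists_8_large: "n = 8 \<Longrightarrow> q \<ge> 12 \<Longrightarrow> pcn_exists"
  by (erule (1) pcn_exists_all_levels_ge[OF _ _ proper_divisors_numerals(6) omega_bound]) (simp_all add: power_divide)

lemma pcn_exists_9_9: "n = 9 \<Longrightarrow> q = 9 \<Longrightarrow> pcn_exists"
  by (erule (1) pcn_exists_level_one_small[where r = 3 and m = 1 and b = 2 and B = "{7, 13}" and w = 6])
    (simp_all add: power2_eq_square coprime_iff_gcd_eq_1 gcd_non_0_nat)

lemma pcn_exists_9_large: "n = 9 \<Longrightarrow> q \<ge> 11 \<Longrightarrow> pcn_exists"
  by (erule (1) pcn_exists_all_levels_ge[OF _ _ proper_divisors_numerals(7) omega_bound]) (simp_all add: power_divide)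

lemma pcn_exists_10_11: "n = 10 \<Longrightarrow> q = 11 \<Longrightarrow> pcn_exists"
  by (rule pcn_exists_level_one_large, rule prime_to_p_eqI[of 11 10 0])
    (simp_all add: power_divide coprime_iff_gcd_eq_1 gcd_non_0_nat)

lemma pcn_exists_10_large: "n = 10 \<Longrightarrow> q \<ge> 12 \<Longrightarrow> pcn_exists"
  by (erule (1) pcn_exists_all_levels_ge[OF _ _ proper_divisors_numerals(8) omega_bound]) (simp_all add: power_divide)

lemma pcn_exists_11_11: "n = 11 \<Longrightarrow> q = 11 \<Longrightarrow> pcn_exists"
  by (rule pcn_exists_level_one_large, rule prime_to_p_eqI[of 11 1 1])
    (simp_all add: power_divide coprime_iff_gcd_eq_1 gcd_non_0_nat)

lemma pcn_exists_11_large: "n = 11 \<Longrightarrow> q \<ge> 12 \<Longrightarrow> pcn_exists"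
  by (erule (1) pcn_exists_all_levels_ge[OF _ _ proper_divisors_numerals(9) omega_bound]) (simp_all add: power_divide)

lemma pcn_exists_12_large: "n = 12 \<Longrightarrow> q \<ge> 13 \<Longrightarrow> pcn_exists"
  by (erule (1) pcn_exists_all_levels_ge[OF _ _ proper_divisors_numerals(10) omega_bound]) (simp_all add: power_divide)

lemma pcn_exists_degree_le_12:
  assumes "n \<ge> 3" "n \<le> 12" "q \<ge> n" "(n, q) \<notin> {(3, 4), (4, 5), (6, 7)}"
  shows pcn_exists
proof -
  note two = two_primes_not_dvd_q[of 2 3] two_primes_not_dvd_q[of 2 5] two_primes_not_dvd_q[of 2 7]
    two_primes_not_dvd_q[of 3 5]
  have "n = 3 \<or> n = 4 \<or> n = 5 \<or> n = 6 \<or> n = 7 \<or> n = 8 \<or> n = 9 \<or> n = 10 \<or> n = 11 \<or> n = 12"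
    using assms(1,2) by presburger
  then show ?thesis
  proof (elim disjE)
    assume n: "n = 3"
    then have "q \<ge> 10 \<or> q = 3 \<or> q = 4 \<or> q = 5 \<or> q = 6 \<or> q = 7 \<or> q = 8 \<or> q = 9"
      using assms(3) by presburger
    then show ?thesis using two assms(4) n
        pcn_exists_3_3[OF n] pcn_exists_3_5[OF n] pcn_exists_3_7[OF n] pcn_exists_3_8[OF n]
        pcn_exists_3_9[OF n] pcn_exists_3_large[OF n]
      by (elim disjE) simp_all
  next
    assume n: "n = 4"
    then have "q \<ge> 19 \<or> q = 4 \<or> q = 5 \<or> q = 6 \<or> q = 7 \<or> q = 8 \<or> q = 9 \<or> q = 10 \<or> q = 11 \<or> q = 12 \<or> q = 13 \<or> q = 14 \<or> q = 15 \<or> q = 16 \<or> q = 17 \<or> q = 18"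
      using assms(3) by presburger
    then show ?thesis using two assms(4) n
        pcn_exists_4_4[OF n] pcn_exists_4_7[OF n] pcn_exists_4_8[OF n] pcn_exists_4_9[OF n]
        pcn_exists_4_11[OF n] pcn_exists_4_13[OF n] pcn_exists_4_16[OF n] pcn_exists_4_17[OF n]
        pcn_exists_4_large[OF n]
      by (elim disjE) simp_all
  next
    assume n: "n = 5"
    then have "q \<ge> 13 \<or> q = 5 \<or> q = 6 \<or> q = 7 \<or> q = 8 \<or> q = 9 \<or> q = 10 \<or> q = 11 \<or> q = 12"
      using assms(3) by presburger
    then show ?thesis using two assms(4) n
        pcn_exists_5_5[OF n] pcn_exists_5_7[OF n] pcn_exists_5_8[OF n] pcn_exists_5_9[OF n]
        pcn_exists_5_11[OF n] pcn_exists_5_large[OF n]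
      by (elim disjE) simp_all
  next
    assume n: "n = 6"
    then have "q \<ge> 14 \<or> q = 6 \<or> q = 7 \<or> q = 8 \<or> q = 9 \<or> q = 10 \<or> q = 11 \<or> q = 12 \<or> q = 13"
      using assms(3) by presburger
    then show ?thesis using two assms(4) n
        pcn_exists_6_8[OF n] pcn_exists_6_9[OF n] pcn_exists_6_11[OF n] pcn_exists_6_13[OF n]
        pcn_exists_6_large[OF n]
      by (elim disjE) simp_all
  next
    assume n: "n = 7"
    then have "q \<ge> 11 \<or> q = 7 \<or> q = 8 \<or> q = 9 \<or> q = 10"
      using assms(3) by presburger
    then show ?thesis using two assms(4) n
        pcn_exists_7_7[OF n] pcn_exists_7_8[OF n] pcn_exists_7_9[OF n] pcn_exists_7_large[OF n]
      by (elim disjE) simp_all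
  next
    assume n: "n = 8"
    then have "q \<ge> 12 \<or> q = 8 \<or> q = 9 \<or> q = 10 \<or> q = 11"
      using assms(3) by presburger
    then show ?thesis using two assms(4) n
        pcn_exists_8_8[OF n] pcn_exists_8_9[OF n] pcn_exists_8_11[OF n] pcn_exists_8_large[OF n]
      by (elim disjE) simp_all
  next
    assume n: "n = 9"
    then have "q \<ge> 11 \<or> q = 9 \<or> q = 10"
      using assms(3) by presburger
    then show ?thesis using two assms(4) n
        pcn_exists_9_9[OF n] pcn_exists_9_large[OF n]
      by (elim disjE) simp_all
  next
    assume n: "n = 10"
    then have "q \<ge> 12 \<or> q = 10 \<or> q = 11"
      using assms(3) by presburger
    then show ?thesis using two assms(4) n
        pcn_exists_10_11[OF n] pcn_exists_10_large[OF n]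
      by (elim disjE) simp_all
  next
    assume n: "n = 11"
    then have "q \<ge> 12 \<or> q = 11"
      using assms(3) by presburger
    then show ?thesis using two assms(4) n
        pcn_exists_11_11[OF n] pcn_exists_11_large[OF n]
      by (elim disjE) simp_all
  next
    assume n: "n = 12"
    then have "q \<ge> 13 \<or> q = 12"
      using assms(3) by presburger
    then show ?thesis using two assms(4) n
        pcn_exists_12_large[OF n]
      by (elim disjE) simp_all
  qed
qed

end

section \<open>The degrees 1, 2 and at least 13\<close>

context finite_field_ext
begin

lemma pcn_exists_degree_1:
  assumes "n = 1"
  shows pcn_exists
proof (rule pcn_exists_all_levels[OF refl])
  have D: "{l. l dvd n \<and> l < n} = {}" using assms by auto
  show "(2 ^ card (prime_factors norm_index) - 1) * (\<Sum>l\<in>{l. l dvd n \<and> l < n}. real (n div l)) <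
      sqrt (real (q ^ n)) * (1 - (\<Sum>l\<in>{l. l dvd n \<and> l < n}. real (n div l) / real (q ^ l)))"
    unfolding D using q_gt_1 by simp
qed

text \<open>The generator itself works. A vanishing resolvent means that \<open>gen [^] q\<close>
  equals \<open>gen\<close> up to a factor of square one; squaring gives
  \<open>q ^ 2 - 1 dvd 2 * q - 2\<close>, which is impossible by size.\<close>

lemma pcn_exists_degree_2:
  assumes n2: "n = 2"
  shows pcn_exists
proof -
  interpret H: finite_field_hom R q n p e alg_closure indexed_const by (rule algebraic_closure_hom)
  define m where "m = prime_to_p n"
  have m0: "m > 0" "coprime m p" using prime_to_p[OF n_pos] by (auto simp: m_def)
  have m: "m dvd q - 1 \<and> m dvd 2"
  proof (cases "p = 2")
    case True
    then have "m = 1" unfolding m_def n2 by (intro prime_to_p_unique[of 2 1 1]) auto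
    then show ?thesis by simp
  next
    case False
    then have "coprime 2 p" using prime_p by (intro primes_coprime) auto
    then have "m = 2" unfolding m_def n2 by (intro prime_to_p_unique[of 2 2 0]) auto
    moreover have "odd q" using prime_p False prime_odd_nat[of p] prime_ge_2_nat[of p] by (auto simp: q_eq)
    ultimately show ?thesis by simp
  qed
  obtain z where z: "H.E.root_of_unity m z" using ex_root_of_unity_closure[OF m0] by blast
  have zc: "z \<in> carrier alg_closure" using z by (simp add: H.E.root_of_unity_def)
  have "completely_normal_element R q n gen"
  proof (rule H.completely_normal_of_level_one[OF m_def _ z gen(1)])
    show "m dvd q - 1" using m by simp
    fix k :: nat
    let ?w = "z [^]\<^bsub>alg_closure\<^esub> k" and ?g = "indexed_const gen"
    have wc: "?w \<in> carrier alg_closure" using zc by simp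
    have gc: "?g \<in> carrier alg_closure" using gen by simp
    have w2: "?w [^]\<^bsub>alg_closure\<^esub> (2::nat) = \<one>\<^bsub>alg_closure\<^esub>"
      using H.E.root_of_unity_pow_eq_one_iff[OF z m0(1), of "k * 2"] m zc by (simp add: H.E.nat_pow_pow)
    show "H.frob_sum 1 ?w gen \<noteq> \<zero>\<^bsub>alg_closure\<^esub>"
    proof
      let ?y = "?w \<otimes>\<^bsub>alg_closure\<^esub> ?g [^]\<^bsub>alg_closure\<^esub> q"
      assume "H.frob_sum 1 ?w gen = \<zero>\<^bsub>alg_closure\<^esub>"
      moreover have "H.frob_sum 1 ?w gen = ?y \<oplus>\<^bsub>alg_closure\<^esub> ?g"
      proof -
        have "{..<n div 1} = {0, 1}" using n2 by auto
        then show ?thesis unfolding H.frob_sum_def using wc gc by (simp add: H.E.a_comm)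
      qed
      ultimately have "?y = \<ominus>\<^bsub>alg_closure\<^esub> ?g" using wc gc by (intro H.E.minus_equality[symmetric]) simp_all
      then have "?y [^]\<^bsub>alg_closure\<^esub> (2::nat) = (\<ominus>\<^bsub>alg_closure\<^esub> ?g) [^]\<^bsub>alg_closure\<^esub> (2::nat)" by simp
      moreover have "?y [^]\<^bsub>alg_closure\<^esub> (2::nat) = ?g [^]\<^bsub>alg_closure\<^esub> (q * 2)"
        using wc gc w2 by (simp add: H.E.nat_pow_distrib H.E.nat_pow_pow)
      moreover have "(\<ominus>\<^bsub>alg_closure\<^esub> ?g) [^]\<^bsub>alg_closure\<^esub> (2::nat) = ?g [^]\<^bsub>alg_closure\<^esub> (2::nat)"
        using gc by (simp add: numeral_2_eq_2 H.E.l_minus H.E.r_minus)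
      ultimately have "?g [^]\<^bsub>alg_closure\<^esub> (q * 2) = ?g [^]\<^bsub>alg_closure\<^esub> (2::nat)" by simp
      then have "(indexed_const (gen [^] (q * 2)) :: ('a list \<times> nat) multiset \<Rightarrow> 'a) = indexed_const (gen [^] (2::nat))"
        unfolding H.h.hom_pow[OF gen(1)] .
      then have "gen [^] (q * 2) = gen [^] (2::nat)"
        using gen by (subst (asm) H.h_eq_iff) auto
      then have "(q * 2) mod (q ^ n - 1) = 2 mod (q ^ n - 1)" by (simp only: gen_pow_eq_iff)
      then have "q ^ 2 - 1 dvd q * 2 - 2"
        using mod_eq_dvd_iff_nat[of 2 "q * 2" "q ^ n - 1"] q_gt_1 by (simp add: n2)
      then have "q ^ 2 - 1 \<le> q * 2 - 2" using q_gt_1 by (intro dvd_imp_le) auto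
      moreover have "q * 2 \<le> q ^ 2" using q_gt_1 by (simp add: power2_eq_square)
      moreover have "q * 2 \<ge> 4" using q_gt_1 by simp
      ultimately show False by linarith
    qed
  qed
  moreover have "primitive_element R gen" using primitive_element_gen_pow[of 1] gen by simp
  ultimately show ?thesis using gen by (auto simp: pcn_exists_def)
qed

text \<open>From \<open>m <= q - 1\<close> the margin \<open>1 - m / q\<close> is at least
  \<open>1 / q\<close>. In fourth powers this and \<open>m ^ 4 <= q ^ 4\<close> cost a factor
  \<open>q ^ 8\<close>, which \<open>q ^ n\<close> more than repays.\<close>

lemma pcn_exists_level_one_large_degree:
  assumes n: "n \<ge> 13" "q \<ge> n" and m: "prime_to_p n dvd q - 1"
  shows pcn_exists
proof (rule pcn_exists_level_one[OF refl m], rule large_bound[OF omega_bound])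
  let ?m = "prime_to_p n"
  have "?m \<le> q - 1" using m q_gt_1 by (intro dvd_imp_le) auto
  then have "real ?m \<le> real q - 1" using q_gt_1 by linarith
  then have A: "1 / real q \<le> 1 - real ?m / real q" using q_gt_1 by (simp add: field_simps)
  have "0 < 1 / real q" using q_gt_1 by simp
  then show "0 < 1 - real ?m / real q" using A by linarith
  have qr: "real q \<ge> 13" "real q > 0" using n by auto
  have "16777216 * real ?m ^ 4 \<le> 16777216 * real q ^ 4"
    using \<open>?m \<le> q - 1\<close> by (intro mult_left_mono power_mono) auto
  also have "\<dots> \<le> 30030 * real q ^ 8 * 12 * 1"
  proof -
    have "(16777216::real) \<le> 30030 * 13 ^ 4 * 12" by simp
    also have "\<dots> \<le> 30030 * real q ^ 4 * 12" using qr by (intro mult_right_mono mult_left_mono power_mono) auto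
    finally have "16777216 * real q ^ 4 \<le> (30030 * real q ^ 4 * 12) * real q ^ 4" using qr by (intro mult_right_mono) auto
    then show ?thesis by (simp add: power_add[symmetric])
  qed
  also have "\<dots> \<le> 30030 * (real q ^ n * (1 / real q) ^ 4) * (real q - 1) * 1"
  proof -
    have "real q ^ 8 * real q ^ 4 \<le> real q ^ n" unfolding power_add[symmetric] using n qr by (intro power_increasing) auto
    then have "real q ^ 8 \<le> real q ^ n * (1 / real q) ^ 4" using qr by (simp add: field_simps)
    then show ?thesis using qr by (intro mult_mono) auto
  qed
  also have "\<dots> \<le> 30030 * real q ^ n * (real q - 1) * (1 - real ?m / real q) ^ 4"
  proof -
    have "30030 * real q ^ n * (real q - 1) * (1 / real q) ^ 4 \<le> 30030 * real q ^ n * (real q - 1) * (1 - real ?m / real q) ^ 4"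
      using A qr by (intro mult_left_mono power_mono) auto
    then show ?thesis by (simp add: mult_ac)
  qed
  finally show "real 16777216 * real ?m ^ 4 \<le> real 30030 * real q ^ n * (real q - 1) * (1 - real ?m / real q) ^ 4" by simp
qed simp_all

text \<open>The gap of two bounds the level one term by \<open>1 - 2 / q\<close>. Level two adds at
  most \<open>1 / (2 * q)\<close> and the higher levels together at most \<open>1 / (3 * q)\<close>,
  so a margin of \<open>1 / q\<close> remains.\<close>

lemma pcn_exists_all_levels_large_degree:
  assumes n: "n \<ge> 13" "q \<ge> n + 2"
  shows pcn_exists
proof (rule pcn_exists_all_levels[OF refl], rule large_bound[OF omega_bound])
  define D where "D = {l. l dvd n \<and> l < n}"
  have D1: "l \<ge> 1" "l < n" "l dvd n" if "l \<in> D" for l using that n_pos by (auto simp: D_def Suc_le_eq intro: Nat.gr0I)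
  have Dsub: "D \<subseteq> {1..<n}" using D1 by auto
  have finD: "finite D" using Dsub finite_subset by blast
  have qr: "real q \<ge> 15" "real q > 0" "real n \<le> real q - 2" using n by auto
  let ?f = "\<lambda>l. real (n div l) / real (q ^ l)"
  have div: "real (n div l) \<le> real n / real l" for l by (rule of_nat_div_le_of_nat)
  have "(\<Sum>l\<in>D. ?f l) \<le> (\<Sum>l\<in>D. real n / real l / real q ^ l)"
    unfolding of_nat_power by (intro sum_mono divide_right_mono div) simp
  also have "\<dots> \<le> (\<Sum>l\<in>{1..<n}. real n / real l / real q ^ l)"
    using Dsub by (intro sum_mono2) auto
  also have "{1..<n} = insert 1 (insert 2 {3..<n})" using n by auto
  also have "(\<Sum>l\<in>\<dots>. real n / real l / real q ^ l) = real n / real q + (real n / 2 / real q ^ 2 + (\<Sum>l\<in>{3..<n}. real n / real l / real q ^ l))"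
    by simp
  also have "(\<Sum>l\<in>{3..<n}. real n / real l / real q ^ l) \<le> (\<Sum>l\<in>{3..<n}. real n / 3 / real q ^ 3)"
  proof (rule sum_mono)
    fix l assume l: "l \<in> {3..<n}"
    have "real n / real l \<le> real n / 3" using l by (intro divide_left_mono) auto
    moreover have "real q ^ 3 \<le> real q ^ l" using l qr by (intro power_increasing) auto
    ultimately show "real n / real l / real q ^ l \<le> real n / 3 / real q ^ 3"
      using qr by (intro frac_le) auto
  qed
  also have "\<dots> \<le> real n * (real n / 3 / real q ^ 3)"
    using qr by (simp add: mult_right_mono divide_right_mono)
  also have "\<dots> \<le> real q * (real q / 3 / real q ^ 3)"
    using qr by (intro mult_mono divide_right_mono) auto
  also have "\<dots> = 1 / 3 / real q" using qr by (simp add: field_simps power3_eq_cube)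
  also have "real n / 2 / real q ^ 2 \<le> real q / 2 / real q ^ 2" using qr by (intro divide_right_mono) auto
  also have "\<dots> = 1 / 2 / real q" using qr by (simp add: field_simps power2_eq_square)
  also have "real n / real q \<le> (real q - 2) / real q" using qr by (intro divide_right_mono) auto
  finally have "(\<Sum>l\<in>D. ?f l) \<le> (real q - 2) / real q + (1 / 2 / real q + 1 / 3 / real q)" by simp
  also have "\<dots> \<le> 1 - 1 / real q" using qr by (simp add: field_simps)
  finally have A: "1 / real q \<le> 1 - (\<Sum>l\<in>D. ?f l)" by simp
  have "0 < 1 / real q" using qr by simp
  then show "0 < 1 - (\<Sum>l\<in>{l. l dvd n \<and> l < n}. ?f l)"
    unfolding D_def[symmetric] using A by linarith
  show B0: "0 \<le> (\<Sum>l\<in>{l. l dvd n \<and> l < n}. real (n div l))" by (auto intro: sum_nonneg)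
  \<comment> \<open>Distinct levels have distinct codivisors, so the number of hyperplanes is at
    most \<open>0 + 1 + ... + n\<close>.\<close>
  have "inj_on (\<lambda>l. n div l) D"
  proof (rule inj_onI)
    fix a b assume a: "a \<in> D" and b: "b \<in> D" and eq: "n div a = n div b"
    have an: "a * (n div a) = n" "b * (n div b) = n" using D1(3)[OF a] D1(3)[OF b] by simp_all
    then have "n div a > 0" using n_pos by (intro Nat.gr0I) simp
    moreover have "a * (n div a) = b * (n div a)" using an eq by simp
    ultimately show "a = b" by simp
  qed
  then have "(\<Sum>l\<in>D. n div l) = \<Sum>((\<lambda>l. n div l) ` D)" by (simp add: sum.reindex)
  also have "\<dots> \<le> \<Sum>{0..n}" by (intro sum_mono2) auto
  also have "\<dots> = n * (n + 1) div 2" by (simp add: gauss_sum_nat)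
  finally have B1: "(\<Sum>l\<in>D. n div l) \<le> n * (n + 1) div 2" .
  have "n * (n + 1) \<le> q * q" using n by (intro mult_mono) auto
  then have "2 * (\<Sum>l\<in>D. n div l) \<le> q * q" using B1 by linarith
  then have "real (2 * (\<Sum>l\<in>D. n div l)) \<le> real (q * q)" by (simp only: of_nat_le_iff)
  then have B: "(\<Sum>l\<in>D. real (n div l)) \<le> real q ^ 2 / 2" by (simp add: power2_eq_square)
  have "16777216 * (\<Sum>l\<in>D. real (n div l)) ^ 4 \<le> 16777216 * (real q ^ 2 / 2) ^ 4"
    using B B0 unfolding D_def[symmetric] by (intro mult_left_mono power_mono) auto
  also have "\<dots> = 1048576 * real q ^ 8" by (simp add: power_divide power_mult[symmetric])
  also have "\<dots> \<le> 30030 * (real q ^ 8 * 13) * 14" using qr by simp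
  also have "\<dots> \<le> 30030 * (real q ^ n * (1 / real q) ^ 4) * (real q - 1)"
  proof -
    have "real q ^ 8 * 13 * real q ^ 4 \<le> real q ^ 8 * real q * real q ^ 4" using qr by (intro mult_mono) auto
    also have "\<dots> = real q ^ 13" by (simp add: numeral_eq_Suc)
    also have "\<dots> \<le> real q ^ n" using n qr by (intro power_increasing) auto
    finally have "real q ^ 8 * 13 \<le> real q ^ n * (1 / real q) ^ 4" using qr by (simp add: field_simps)
    then have le: "30030 * (real q ^ 8 * 13) \<le> 30030 * (real q ^ n * (1 / real q) ^ 4)" by simp
    show ?thesis by (rule mult_mono[OF le]) (use qr in auto)
  qed
  also have "\<dots> = 30030 * real q ^ n * (real q - 1) * (1 / real q) ^ 4" by (simp add: mult_ac)
  also have "\<dots> \<le> 30030 * real q ^ n * (real q - 1) * (1 - (\<Sum>l\<in>D. ?f l)) ^ 4"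
    using A qr by (intro mult_left_mono power_mono) auto
  finally show "real 16777216 * (\<Sum>l\<in>{l. l dvd n \<and> l < n}. real (n div l)) ^ 4
    \<le> real 30030 * real q ^ n * (real q - 1) * (1 - (\<Sum>l\<in>{l. l dvd n \<and> l < n}. ?f l)) ^ 4"
    unfolding D_def[symmetric] by simp
qed simp_all

text \<open>The only values of \<open>q\<close> below \<open>n + 2\<close> are \<open>n\<close>,
  where \<open>prime_to_p n = 1\<close>, and \<open>n + 1\<close>, where
  \<open>prime_to_p n = q - 1\<close>. Both belong to the level one case.\<close>

lemma pcn_exists_degree_ge_13:
  assumes n: "n \<ge> 13" "q \<ge> n"
  shows pcn_exists
proof (cases "prime_to_p n dvd q - 1")
  case True
  then show ?thesis using pcn_exists_level_one_large_degree n by blast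
next
  case False
  have "n \<noteq> q"
  proof
    assume "n = q"
    then have "prime_to_p n = 1" using q_eq n_pos by (intro prime_to_p_unique[of n 1 e]) auto
    then show False using False by simp
  qed
  moreover have "n \<noteq> q - 1"
  proof
    assume nq: "n = q - 1"
    have "coprime (q - 1) q" using q_gt_1 by (intro coprime_diff_one_left_nat) simp
    then have "coprime n p" using nq q_eq e_pos by simp
    then have "prime_to_p n = n" using n_pos by (intro prime_to_p_unique[of n n 0]) auto
    then show False using False nq by simp
  qed
  ultimately show ?thesis using n pcn_exists_all_levels_large_degree by linarith
qed

end

subsection \<open>The three exceptional extensions\<close>

lemma (in cring) cyclotomic_three:
  assumes "w \<in> carrier R" and e: "\<one> \<oplus> w \<oplus> w \<otimes> w = \<zero>"
  shows "w \<otimes> (w \<otimes> w) = \<one>" "\<one> \<oplus> w = \<ominus> (w \<otimes> w)" "w \<oplus> w \<otimes> w = \<ominus> \<one>"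
proof -
  have "(w \<ominus> \<one>) \<otimes> (\<one> \<oplus> w \<oplus> w \<otimes> w) = w \<otimes> (w \<otimes> w) \<ominus> \<one>" using assms(1) by algebra
  then have "w \<otimes> (w \<otimes> w) \<ominus> \<one> = \<zero>" unfolding e using assms(1) by simp
  then show "w \<otimes> (w \<otimes> w) = \<one>" using assms(1) by simp
  show "\<one> \<oplus> w = \<ominus> (w \<otimes> w)" using e assms(1) by (intro minus_equality[symmetric]) auto
  show "w \<oplus> w \<otimes> w = \<ominus> \<one>" using e assms(1) by (intro minus_equality[symmetric]) (auto simp: a_ac)
qed

text \<open>The factorisation of \<open>u ^ 3 - 1\<close> over the cube roots of unity. It evaluates
  the norm of \<open>t - 1\<close>, with \<open>u = t\<close> in degree 3 and
  \<open>u = t ^ 2\<close> in degree 6.\<close>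

lemma (in cring) cyclotomic_three_product:
  assumes u: "u \<in> carrier R" and w: "w \<in> carrier R" and e: "\<one> \<oplus> w \<oplus> w \<otimes> w = \<zero>"
  shows "(u \<ominus> \<one>) \<otimes> (w \<otimes> u \<ominus> \<one>) \<otimes> (w \<otimes> w \<otimes> u \<ominus> \<one>) = u \<otimes> u \<otimes> u \<ominus> \<one>"
proof -
  define v where "v = w \<otimes> w"
  have v: "v \<in> carrier R" using w by (simp add: v_def)
  have wv: "w \<otimes> v = \<one>" "\<one> \<oplus> w = \<ominus> v" using cyclotomic_three[OF w e] by (simp_all add: v_def)
  have vv: "v \<otimes> v = w"
  proof -
    have "v \<otimes> v = w \<otimes> (w \<otimes> v)" using w by (simp add: v_def m_assoc)
    then show ?thesis using wv w by simp
  qed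
  have "(u \<ominus> \<one>) \<otimes> (w \<otimes> u \<ominus> \<one>) = w \<otimes> (u \<otimes> u) \<ominus> (\<one> \<oplus> w) \<otimes> u \<oplus> \<one>" using u w by algebra
  also have "\<dots> = w \<otimes> (u \<otimes> u) \<oplus> v \<otimes> u \<oplus> \<one>" unfolding wv(2) using u v w by algebra
  finally have "(u \<ominus> \<one>) \<otimes> (w \<otimes> u \<ominus> \<one>) \<otimes> (v \<otimes> u \<ominus> \<one>) = (w \<otimes> (u \<otimes> u) \<oplus> v \<otimes> u \<oplus> \<one>) \<otimes> (v \<otimes> u \<ominus> \<one>)" by simp
  also have "\<dots> = (w \<otimes> v) \<otimes> (u \<otimes> u \<otimes> u) \<oplus> (v \<otimes> v) \<otimes> (u \<otimes> u) \<ominus> w \<otimes> (u \<otimes> u) \<ominus> \<one>"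
    using u v w by algebra
  also have "\<dots> = u \<otimes> u \<otimes> u \<ominus> \<one>" unfolding wv(1) vv using u w by algebra
  finally show ?thesis by (simp add: v_def)
qed

text \<open>The difference of the cubes of \<open>b\<close> and \<open>a\<close> factors into
  \<open>b - a\<close>, \<open>b - w * a\<close> and \<open>b - w ^ 2 * a\<close>. The first two are
  \<open>(w - 1) * u\<close> and \<open>w - 1\<close>, hence nonzero, so the third vanishes.\<close>

lemma (in domain) cubes_eq_cyclotomic:
  assumes u: "u \<in> carrier R" "u \<noteq> \<zero>" and w: "w \<in> carrier R" "w \<noteq> \<one>" and e: "\<one> \<oplus> w \<oplus> w \<otimes> w = \<zero>"
    and eq: "(w \<otimes> u \<ominus> \<one>) [^] (3::nat) = (u \<ominus> \<one>) [^] (3::nat)"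
  shows "w \<otimes> u = \<one> \<oplus> w"
proof -
  define v where "v = w \<otimes> w"
  define a where "a = u \<ominus> \<one>"
  define b where "b = w \<otimes> u \<ominus> \<one>"
  have v: "v \<in> carrier R" and ab: "a \<in> carrier R" "b \<in> carrier R" using u w by (auto simp: v_def a_def b_def)
  have wv: "w \<otimes> v = \<one>" "w \<oplus> v = \<ominus> \<one>" using cyclotomic_three[OF w(1) e] by (simp_all add: v_def)
  have ba: "b \<ominus> a = (w \<ominus> \<one>) \<otimes> u" unfolding a_def b_def using u(1) w(1) by algebra
  have bwa: "b \<ominus> w \<otimes> a = w \<ominus> \<one>" unfolding a_def b_def using u(1) w(1) by algebra
  have bva: "b \<ominus> v \<otimes> a = (\<one> \<ominus> w) \<otimes> (w \<otimes> u \<ominus> (\<one> \<oplus> w))"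
    unfolding a_def b_def v_def using u(1) w(1) by algebra
  have "(b \<ominus> w \<otimes> a) \<otimes> (b \<ominus> v \<otimes> a) = b \<otimes> b \<ominus> (w \<oplus> v) \<otimes> (a \<otimes> b) \<oplus> (w \<otimes> v) \<otimes> (a \<otimes> a)"
    using ab w(1) v by algebra
  also have "\<dots> = b \<otimes> b \<oplus> a \<otimes> b \<oplus> a \<otimes> a" unfolding wv using ab by algebra
  finally have "(b \<ominus> a) \<otimes> ((b \<ominus> w \<otimes> a) \<otimes> (b \<ominus> v \<otimes> a)) = (b \<ominus> a) \<otimes> (b \<otimes> b \<oplus> a \<otimes> b \<oplus> a \<otimes> a)" by simp
  also have "\<dots> = b \<otimes> b \<otimes> b \<ominus> a \<otimes> a \<otimes> a" using ab by algebra
  also have "\<dots> = \<zero>" using eq ab unfolding a_def[symmetric] b_def[symmetric] by (simp add: numeral_3_eq_3)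
  finally have 0: "(b \<ominus> a) \<otimes> ((b \<ominus> w \<otimes> a) \<otimes> (b \<ominus> v \<otimes> a)) = \<zero>" .
  have w1: "w \<ominus> \<one> \<noteq> \<zero>" "\<one> \<ominus> w \<noteq> \<zero>" using w by auto
  then have "b \<ominus> a \<noteq> \<zero>" unfolding ba using u w integral[of "w \<ominus> \<one>" u] by auto
  then have "(b \<ominus> w \<otimes> a) \<otimes> (b \<ominus> v \<otimes> a) = \<zero>"
    using 0 ab w v integral[of "b \<ominus> a" "(b \<ominus> w \<otimes> a) \<otimes> (b \<ominus> v \<otimes> a)"] by auto
  then have "b \<ominus> v \<otimes> a = \<zero>"
    using w1 ab w v integral[of "b \<ominus> w \<otimes> a" "b \<ominus> v \<otimes> a"] unfolding bwa by auto
  then have "w \<otimes> u \<ominus> (\<one> \<oplus> w) = \<zero>"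
    using w1 u w integral[of "\<one> \<ominus> w" "w \<otimes> u \<ominus> (\<one> \<oplus> w)"] unfolding bva by auto
  then show ?thesis using u w by simp
qed

lemma (in domain) squares_eq_imp:
  assumes "a \<in> carrier R" "b \<in> carrier R" "a [^] (2::nat) = b [^] (2::nat)"
  shows "a \<ominus> b = \<zero> \<or> a \<oplus> b = \<zero>"
proof -
  have "(a \<ominus> b) \<otimes> (a \<oplus> b) = a \<otimes> a \<ominus> b \<otimes> b" using assms(1,2) by algebra
  also have "\<dots> = \<zero>" using assms by (simp add: numeral_2_eq_2)
  finally show ?thesis using integral[of "a \<ominus> b" "a \<oplus> b"] assms(1,2) by auto
qed

lemma (in domain) geometric_telescope:
  assumes y: "y \<in> carrier R"
  shows "(y \<ominus> \<one>) \<otimes> (\<Oplus>j\<in>{..<m}. y [^] j) = y [^] (m::nat) \<ominus> \<one>"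
proof (induction m)
  case (Suc m)
  have S: "(\<Oplus>j\<in>{..<m}. y [^] j) \<in> carrier R" using y by (auto intro!: finsum_closed)
  have "(y \<ominus> \<one>) \<otimes> (\<Oplus>j\<in>{..<Suc m}. y [^] j) = (y \<ominus> \<one>) \<otimes> y [^] m \<oplus> (y \<ominus> \<one>) \<otimes> (\<Oplus>j\<in>{..<m}. y [^] j)"
    using y S by (simp add: finsum_lessThan_Suc r_distr)
  also have "\<dots> = (y \<ominus> \<one>) \<otimes> y [^] m \<oplus> (y [^] m \<ominus> \<one>)" by (simp only: Suc)
  also have "\<dots> = y [^] m \<otimes> y \<ominus> \<one>"
  proof -
    have ym: "y [^] m \<in> carrier R" using y by simp
    show ?thesis using y ym by algebra
  qed
  finally show ?case by simp
qed (use y r_neg[OF one_closed] in \<open>simp add: minus_eq\<close>)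

section \<open>Kummer extensions of degree \<open>q - 1\<close>\<close>

context finite_field_ext
begin

lemma finite_field_hom_id: "finite_field_hom R q n p e R id"
  by (intro finite_field_hom.intro finite_field_hom_axioms.intro finite_field_ext_axioms field_axioms) (simp add: ring_hom_def)

lemma nat_one_nonzero: "coprime m p \<Longrightarrow> [m] \<cdot> \<one> \<noteq> \<zero>"
  using finite_field_hom.nat_E_nonzero[OF finite_field_hom_id] .

text \<open>Suppose \<open>r\<close> divides the logarithm of \<open>x = inv z\<close>. Then
  \<open>x [^] s\<close> lies in the ground field if \<open>norm_index = r * s\<close>, and the norm
  \<open>x [^] norm_index\<close> has \<open>s\<close>-th power \<open>\<one>\<close> if
  \<open>q - 1 = r * s\<close>. The second test is used for primes that also divide
  \<open>q - 1\<close>. Both are stated for \<open>z\<close>, whose powers are explicit polynomials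
  in \<open>t\<close>.\<close>

lemma norm_free_invI:
  assumes z: "z \<in> carrier R" "z \<noteq> \<zero>"
    and test: "\<And>r. prime r \<Longrightarrow> r dvd norm_index \<Longrightarrow>
      (\<exists>s. norm_index = r * s \<and> (z [^] s) [^] q \<noteq> z [^] s) \<or> (\<exists>s. q - 1 = r * s \<and> (z [^] norm_index) [^] s \<noteq> \<one>)"
  shows "norm_free (inv z)"
  unfolding norm_free_def
proof (intro conjI ballI notI)
  define x where "x = inv z"
  have zU: "z \<in> Units R" using z by (simp add: field_Units)
  then have xU: "x \<in> Units R" unfolding x_def by simp
  have x: "x \<in> carrier R - {\<zero>}" using xU field_Units by simp
  then show "inv z \<in> carrier R - {\<zero>}" by (simp add: x_def)
  have zx: "z [^] s \<otimes> x [^] s = \<one>" for s :: nat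
    using z x zU by (simp add: nat_pow_distrib[symmetric] x_def)
  fix r assume r: "r \<in> prime_factors norm_index" and "r dvd dlog (inv z)"
  then obtain k where k: "dlog x = r * k" unfolding x_def by blast
  have xk: "x = gen [^] (r * k)" using gen_pow_dlog[OF x] k by simp
  have Q: "norm_index * (q - 1) = q ^ n - 1" by (rule norm_index_mult)
  from test[of r] r consider s where "norm_index = r * s" "(z [^] s) [^] q \<noteq> z [^] s"
    | s where "q - 1 = r * s" "(z [^] norm_index) [^] s \<noteq> \<one>" by (auto simp: in_prime_factors_iff)
  then show False
  proof cases
    case 1
    have "x [^] (s * q) = x [^] s"
    proof -
      have "r * k * (s * q) = r * k * s + k * (norm_index * (q - 1))"
        unfolding 1(1) using q_gt_1 by (simp add: algebra_simps)
      then have "(r * k * (s * q)) mod (q ^ n - 1) = (r * k * s) mod (q ^ n - 1)"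
        unfolding Q by (simp only: mod_mult_self3 add.commute mod_mult_self1)
      then show ?thesis unfolding xk nat_pow_pow[OF gen(1)] gen_pow_eq_iff .
    qed
    then have "z [^] (s * q) \<otimes> x [^] s = z [^] s \<otimes> x [^] s" using zx[of "s * q"] zx[of s] by simp
    then have "z [^] (s * q) = z [^] s"
      using z x nat_pow_eq_zero_iff[of x s] by (subst (asm) m_rcancel) auto
    then show False using 1(2) z by (simp add: nat_pow_pow)
  next
    case 2
    have "x [^] (norm_index * s) = \<one>"
    proof -
      have "r * k * (norm_index * s) = k * (norm_index * (q - 1))" unfolding 2(1) by (simp add: mult_ac)
      then have eq: "r * k * (norm_index * s) = k * (q ^ n - 1)" unfolding Q .
      show ?thesis unfolding xk nat_pow_pow[OF gen(1)] gen_pow_eq_one_iff eq by (rule dvd_triv_right)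
    qed
    then have "z [^] (norm_index * s) = \<one>" using zx[of "norm_index * s"] z by simp
    then show False using 2(2) z by (simp add: nat_pow_pow)
  qed
qed

text \<open>An element of the ground field is a power of \<open>gen\<close> with exponent divisible
  by \<open>norm_index\<close>, hence by \<open>q - 1\<close>.\<close>

lemma ex_kummer_generator:
  assumes c: "c \<in> carrier R" "c \<noteq> \<zero>" "c [^] (q - 1) = \<one>" and d: "q - 1 dvd norm_index"
  shows "\<exists>t\<in>carrier R. t [^] (q - 1) = c"
proof -
  obtain k :: nat where k: "c = gen [^] k" using ex_gen_pow[OF c(1,2)] by blast
  have "gen [^] (k * (q - 1)) = \<one>" using c(3) gen by (simp add: k nat_pow_pow)
  then have "norm_index * (q - 1) dvd k * (q - 1)" by (simp only: gen_pow_eq_one_iff norm_index_mult)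
  then have "norm_index dvd k" using q_gt_1 by simp
  then obtain j where "k = (q - 1) * j" using d by (meson dvd_def dvd_trans)
  then have "(gen [^] j) [^] (q - 1) = c" using gen by (simp add: k nat_pow_pow mult.commute)
  then show ?thesis using gen by blast
qed

lemma kummer_conjugate:
  assumes c: "c \<in> carrier R" "c [^] q = c" and t: "t \<in> carrier R" "t [^] q = c \<otimes> t"
  shows "t [^] (q ^ i) = c [^] i \<otimes> t" "(t \<ominus> \<one>) [^] (q ^ i) = c [^] i \<otimes> t \<ominus> \<one>"
proof -
  show 1: "t [^] (q ^ i) = c [^] i \<otimes> t"
  proof (induction i)
    case (Suc i)
    have "t [^] (q ^ Suc i) = (t [^] (q ^ i)) [^] q" using t by (simp add: nat_pow_pow mult.commute)
    also have "\<dots> = (c [^] i) [^] q \<otimes> t [^] q"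
      unfolding Suc using c t by (simp add: nat_pow_distrib)
    also have "(c [^] i) [^] q = (c [^] q) [^] i" by (simp only: nat_pow_pow[OF c(1)] mult.commute)
    also have "\<dots> \<otimes> t [^] q = c [^] Suc i \<otimes> t" using c t by (simp add: m_assoc)
    finally show ?case .
  qed (use t in simp)
  have "(t \<ominus> \<one>) [^] (q ^ i) \<oplus> \<one> = ((t \<ominus> \<one>) \<oplus> \<one>) [^] (q ^ i)"
    using t frob_add[of "t \<ominus> \<one>" \<one> i] by simp
  also have "(t \<ominus> \<one>) \<oplus> \<one> = t" using t by algebra
  finally have "(t \<ominus> \<one>) [^] (q ^ i) \<oplus> \<one> = c [^] i \<otimes> t" using 1 by simp
  moreover have "(t \<ominus> \<one>) [^] (q ^ i) = ((t \<ominus> \<one>) [^] (q ^ i) \<oplus> \<one>) \<ominus> \<one>"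
  proof -
    have "(t \<ominus> \<one>) [^] (q ^ i) \<in> carrier R" using t by simp
    then show ?thesis by algebra
  qed
  ultimately show "(t \<ominus> \<one>) [^] (q ^ i) = c [^] i \<otimes> t \<ominus> \<one>" by simp
qed

text \<open>
  For \<open>n = q - 1\<close> the field is a Kummer extension generated by some \<open>t\<close> with \<open>t\<^sup>n = c\<close>, and
  \<open>1 / (t - 1) = (1 + t + \<dots> + t\<^sup>n\<^sup>-\<^sup>1) / (c - 1)\<close> has no vanishing coordinate in the basis of powers
  of \<open>t\<close>, which consists of eigenvectors of the Frobenius map.
\<close>

lemma pcn_exists_kummer:
  assumes n: "n = q - 1" "n \<ge> 2" and c: "root_of_unity n c" and t: "t \<in> carrier R" "t [^] n = c"
    and free: "norm_free (inv (t \<ominus> \<one>))"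
  shows pcn_exists
proof -
  interpret H: finite_field_hom R q n p e R id by (rule finite_field_hom_id)
  have cR: "c \<in> carrier R" "c [^] n = \<one>" using c by (auto simp: root_of_unity_def)
  have c1: "c \<noteq> \<one>"
  proof
    assume "c = \<one>"
    moreover have "c [^] (1::nat) \<noteq> \<one>" using c n unfolding root_of_unity_def by (metis One_nat_def Suc_1 Suc_le_lessD zero_less_one)
    ultimately show False by simp
  qed
  have qn: "q = Suc n" using n q_gt_1 by simp
  have cq: "c [^] q = c" unfolding qn using cR by simp
  have tq: "t [^] q = c \<otimes> t" unfolding qn using t by simp
  note conj = kummer_conjugate[OF cR(1) cq t(1) tq]
  have cop: "coprime n p"
  proof -
    have "coprime (q - 1) q" using q_gt_1 by (intro coprime_diff_one_left_nat) simp
    then show ?thesis using n q_eq e_pos by simp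
  qed
  have m: "n = prime_to_p n" using prime_to_p_unique[of n n 0] cop n_pos by simp
  define z where "z = t \<ominus> \<one>"
  define x where "x = inv z"
  have xR: "x \<in> carrier R" "x \<noteq> \<zero>" using free by (auto simp: norm_free_def x_def z_def)
  have z0: "z \<noteq> \<zero>"
  proof
    assume "z = \<zero>"
    then have "t = \<one>" using t by (simp add: z_def)
    then have "c = \<one>" using t by simp
    then show False using c1 by simp
  qed
  have zR: "z \<in> carrier R" "z \<in> Units R" using t z0 by (auto simp: z_def field_Units)
  \<comment> \<open>The geometric series in the conjugate \<open>c [^] i \<otimes> t\<close>, whose
    \<open>n\<close>-th power is again \<open>c\<close>.\<close>
  have cx: "(c \<ominus> \<one>) \<otimes> x [^] (q ^ i) = (\<Oplus>j\<in>{..<n}. (c [^] i \<otimes> t) [^] j)" for i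
  proof -
    let ?S = "\<Oplus>j\<in>{..<n}. (c [^] i \<otimes> t) [^] j"
    have S: "?S \<in> carrier R" using cR t by (auto intro!: finsum_closed)
    have "z [^] (q ^ i) \<otimes> x [^] (q ^ i) = (z \<otimes> x) [^] (q ^ i)"
      using zR xR by (simp add: nat_pow_distrib)
    also have "\<dots> = \<one>" using zR by (simp add: x_def)
    finally have zx: "z [^] (q ^ i) \<otimes> x [^] (q ^ i) = \<one>" .
    have "z [^] (q ^ i) \<otimes> ?S = (c [^] i \<otimes> t) [^] n \<ominus> \<one>"
      unfolding z_def conj(2) using cR t by (intro geometric_telescope) simp
    also have "(c [^] i \<otimes> t) [^] n = (c [^] n) [^] i \<otimes> t [^] n"
      using cR(1) t(1) by (simp add: nat_pow_distrib nat_pow_pow mult.commute)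
    also have "\<dots> = c" using cR t by simp
    finally have zS: "c \<ominus> \<one> = z [^] (q ^ i) \<otimes> ?S" by simp
    have "(c \<ominus> \<one>) \<otimes> x [^] (q ^ i) = ?S \<otimes> (z [^] (q ^ i) \<otimes> x [^] (q ^ i))"
      unfolding zS using S zR xR by (simp add: m_ac)
    then show ?thesis using zx S by simp
  qed
  have nz: "H.frob_sum 1 (c [^] k) x \<noteq> \<zero>" if k: "k < n" for k
  proof
    assume 0: "H.frob_sum 1 (c [^] k) x = \<zero>"
    have "H.frob_sum 1 (c [^] k) x = (\<Oplus>i\<in>{..<n}. c [^] (k * i) \<otimes> x [^] (q ^ i))"
      using cR by (simp add: H.frob_sum_def nat_pow_pow)
    then have "\<zero> = (c \<ominus> \<one>) \<otimes> (\<Oplus>i\<in>{..<n}. c [^] (k * i) \<otimes> x [^] (q ^ i))" using 0 cR by simp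
    also have "\<dots> = (\<Oplus>i\<in>{..<n}. (c \<ominus> \<one>) \<otimes> (c [^] (k * i) \<otimes> x [^] (q ^ i)))"
      using cR xR by (intro finsum_rdistr) auto
    also have "\<dots> = (\<Oplus>i\<in>{..<n}. \<Oplus>j\<in>{..<n}. c [^] (i * (k + j)) \<otimes> t [^] j)"
    proof (intro finsum_cong')
      fix i
      have "(c \<ominus> \<one>) \<otimes> (c [^] (k * i) \<otimes> x [^] (q ^ i)) = c [^] (k * i) \<otimes> (\<Oplus>j\<in>{..<n}. (c [^] i \<otimes> t) [^] j)"
        unfolding cx[symmetric] using cR xR by (simp add: m_lcomm)
      also have "\<dots> = (\<Oplus>j\<in>{..<n}. c [^] (k * i) \<otimes> (c [^] i \<otimes> t) [^] j)"
        using cR t by (intro finsum_rdistr) auto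
      also have "\<dots> = (\<Oplus>j\<in>{..<n}. c [^] (i * (k + j)) \<otimes> t [^] j)"
        using cR(1) t(1) by (intro finsum_cong')
          (auto simp: nat_pow_distrib nat_pow_pow m_assoc[symmetric] nat_pow_mult algebra_simps)
      finally show "(c \<ominus> \<one>) \<otimes> (c [^] (k * i) \<otimes> x [^] (q ^ i)) = \<dots>" .
    qed (use cR t in \<open>auto intro!: finsum_closed\<close>)
    also have "\<dots> = (\<Oplus>j\<in>{..<n}. \<Oplus>i\<in>{..<n}. c [^] (i * (k + j)) \<otimes> t [^] j)"
      using cR t by (intro finsum_swap) auto
    \<comment> \<open>Orthogonality leaves only the coordinate \<open>j\<close> congruent to
      \<open>- k\<close>. Its value, \<open>n\<close> times a power of \<open>t\<close>, is nonzero
      because \<open>n\<close> is prime to the characteristic.\<close>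
    also have "\<dots> = (\<Oplus>j\<in>{..<n}. if (n - k) mod n = j then [n] \<cdot> \<one> \<otimes> t [^] j else \<zero>)"
    proof (intro finsum_cong')
      fix j assume j: "j \<in> {..<n}"
      have "(\<Oplus>i\<in>{..<n}. c [^] (i * (k + j)) \<otimes> t [^] j) = (\<Oplus>i\<in>{..<n}. c [^] (i * (k + j))) \<otimes> t [^] j"
        using cR t by (intro finsum_ldistr[symmetric]) auto
      also have "\<dots> = (if (n - k) mod n = j then [n] \<cdot> \<one> \<otimes> t [^] j else \<zero>)"
      proof (cases "n dvd k + j")
        case True
        then obtain d where d: "k + j = n * d" by blast
        have "k + j < n * 2" using k j by simp
        then have "n * d < n * 2" by (simp only: d)
        then have "d = 0 \<or> d = 1" using n_pos by auto
        then have "k + j = 0 \<or> k + j = n" using d by auto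
        then have "(n - k) mod n = j" using k j by auto
        moreover have "(\<Oplus>i\<in>{..<n}. c [^] (i * (k + j))) = [n] \<cdot> \<one>"
        proof -
          have "c [^] (i * (k + j)) = \<one>" for i
            using root_of_unity_pow_eq_one_iff[OF c n_pos] True by simp
          then show ?thesis using add.finprod_const[of \<one> "{..<n}"] by simp
        qed
        ultimately show ?thesis by simp
      next
        case False
        then have "(n - k) mod n \<noteq> j" using k by (cases "k = 0") (auto intro!: Nat.gr0I)
        then show ?thesis using root_of_unity_sum[OF c n_pos False] t by simp
      qed
      finally show "(\<Oplus>i\<in>{..<n}. c [^] (i * (k + j)) \<otimes> t [^] j) =
        (if (n - k) mod n = j then [n] \<cdot> \<one> \<otimes> t [^] j else \<zero>)" .
    qed (use t in auto)
    also have "\<dots> = [n] \<cdot> \<one> \<otimes> t [^] ((n - k) mod n)"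
      using t n_pos finsum_singleton[of "(n - k) mod n" "{..<n}" "\<lambda>j. [n] \<cdot> \<one> \<otimes> t [^] j"] by auto
    finally have "[n] \<cdot> \<one> \<otimes> t [^] ((n - k) mod n) = \<zero>" by simp
    then have "t [^] ((n - k) mod n) = \<zero>"
      using nat_one_nonzero[OF cop] integral[of "[n] \<cdot> \<one>" "t [^] ((n - k) mod n)"] t by auto
    then have "t = \<zero>" using nat_pow_eq_zero_iff[OF t(1)] by blast
    then have "c = \<zero>" using t n_pos by (simp add: nat_pow_zero)
    then show False using cR n_pos by (simp add: nat_pow_zero)
  qed
  obtain a where a: "a \<in> fixed_field 1" "a \<noteq> \<zero>" "primitive_element R (a \<otimes> x)"
    using norm_free_scale_primitive[OF free] by (auto simp: x_def z_def)
  have aR: "a \<in> carrier R" using a by (simp add: fixed_field_def)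
  have "completely_normal_element R q n (a \<otimes> x)"
  proof (rule H.completely_normal_of_level_one[OF m _ c])
    show "n dvd q - 1" using n by simp
    show "a \<otimes> x \<in> carrier R" using aR xR by simp
    fix k assume "k < n"
    then have "x \<notin> H.frob_kernel 1 (c [^] k)" using nz by (simp add: H.frob_kernel_def)
    then have "a \<otimes> x \<notin> H.frob_kernel 1 (c [^] k)"
      using a xR cR by (intro H.frob_kernel_scale) auto
    then show "H.frob_sum 1 (c [^] k) (a \<otimes> x) \<noteq> \<zero>"
      using aR xR by (simp add: H.frob_kernel_def)
  qed
  then show ?thesis using a aR xR by (auto simp: pcn_exists_def)
qed

end

section \<open>The pairs (4, 3), (5, 4) and (7, 6) by explicit computation\<close>

context finite_field_ext
begin

lemma kummer_data:
  assumes n: "n = q - 1" "n \<ge> 2" and c: "root_of_unity n c" and d: "q - 1 dvd norm_index"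
  obtains t where "t \<in> carrier R" "t [^] n = c" "t \<noteq> \<zero>" "t \<ominus> \<one> \<noteq> \<zero>"
    "t [^] q = c \<otimes> t" "c [^] q = c" "\<And>i. (t \<ominus> \<one>) [^] (q ^ i) = c [^] i \<otimes> t \<ominus> \<one>"
proof -
  have cR: "c \<in> carrier R" "c [^] n = \<one>" using c by (auto simp: root_of_unity_def)
  have c1: "c \<noteq> \<one>"
    using root_of_unity_pow_eq_one_iff[OF c n_pos, of 1] n(2) cR(1) by auto
  have c0: "c \<noteq> \<zero>" using cR n_pos by (auto simp: nat_pow_zero)
  obtain t where t: "t \<in> carrier R" "t [^] n = c"
    using ex_kummer_generator[of c] cR c0 d n(1) by auto
  have qn: "q = Suc n" using n q_gt_1 by simp
  have cq: "c [^] q = c" unfolding qn using cR by simp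
  have tq: "t [^] q = c \<otimes> t" unfolding qn using t by simp
  show thesis
  proof (rule that[OF t _ _ tq cq kummer_conjugate(2)[OF cR(1) cq t(1) tq]])
    show "t \<noteq> \<zero>" using t c0 n_pos by (auto simp: nat_pow_zero)
    show "t \<ominus> \<one> \<noteq> \<zero>" using t c1 by auto
  qed
qed

lemma nat_one_nonzero_of_not_dvd:
  assumes "\<not> p dvd m"
  shows "[m] \<cdot> \<one> \<noteq> \<zero>"
  by (rule nat_one_nonzero)
    (use prime_imp_coprime[OF prime_p assms] in \<open>simp only: coprime_commute\<close>)

text \<open>Equal cubes would give \<open>w * u = 1 + w\<close>, an element of the ground field. But
  the \<open>q\<close>-th power map multiplies \<open>w * u\<close> by \<open>w\<close>, which
  differs from \<open>1\<close>.\<close>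

lemma cyclotomic_three_not_frob_eq:
  assumes u: "u \<in> carrier R" "u \<noteq> \<zero>" "u [^] q = w \<otimes> u" and w: "w \<in> carrier R" "w \<noteq> \<one>" "w [^] q = w"
    and e: "\<one> \<oplus> w \<oplus> w \<otimes> w = \<zero>"
  shows "(w \<otimes> u \<ominus> \<one>) [^] (3::nat) \<noteq> (u \<ominus> \<one>) [^] (3::nat)"
proof
  assume "(w \<otimes> u \<ominus> \<one>) [^] (3::nat) = (u \<ominus> \<one>) [^] (3::nat)"
  then have wu: "w \<otimes> u = \<one> \<oplus> w" using cubes_eq_cyclotomic u w e by blast
  have w0: "w \<noteq> \<zero>" using e w(1) by auto
  have "w \<otimes> (w \<otimes> u) = (w \<otimes> u) [^] q" using u w by (simp add: nat_pow_distrib)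
  also have "\<dots> = \<one> [^] q \<oplus> w [^] q" unfolding wu using frob_add[of \<one> w 1] w by simp
  also have "\<dots> = \<one> \<otimes> (w \<otimes> u)" using w u by (simp add: wu)
  finally have "w \<otimes> (w \<otimes> u) = \<one> \<otimes> (w \<otimes> u)" .
  then have "w = \<one>" using u w w0 integral[of w u] by (subst (asm) m_rcancel) auto
  then show False using w by simp
qed

lemma pcn_exists_3_4:
  assumes nq: "n = 3" "q = 4"
  shows pcn_exists
proof -
  have p2: "2 = p" by (rule prime_dvd_q_eq) (simp_all add: nq)
  have M: "norm_index = 21" using norm_index_def by (simp add: nq)
  have qn: "q ^ n - 1 = 63" by (simp add: nq)
  define c where "c = gen [^] (21::nat)"
  have cR: "c \<in> carrier R" using gen by (simp add: c_def)
  have ci: "c [^] i = \<one> \<longleftrightarrow> 63 dvd 21 * i" for i :: nat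
    unfolding c_def nat_pow_pow[OF gen(1)] gen_pow_eq_one_iff qn ..
  have root: "root_of_unity n c"
    unfolding root_of_unity_def nq(1) using cR ci by auto
  obtain t where t: "t \<in> carrier R" "t [^] n = c" "t \<noteq> \<zero>" "t \<ominus> \<one> \<noteq> \<zero>"
    and tq: "t [^] q = c \<otimes> t" and cq: "c [^] q = c" and conj: "\<And>i. (t \<ominus> \<one>) [^] (q ^ i) = c [^] i \<otimes> t \<ominus> \<one>"
    using kummer_data[of c] root M nq by auto
  define z where "z = t \<ominus> \<one>"
  have zR: "z \<in> carrier R" using t by (simp add: z_def)
  have c1: "c \<noteq> \<one>" using ci[of 1] cR by auto
  have e: "\<one> \<oplus> c \<oplus> c \<otimes> c = \<zero>"
  proof -
    have "(c \<ominus> \<one>) \<otimes> (\<one> \<oplus> c \<oplus> c \<otimes> c) = c \<otimes> c \<otimes> c \<ominus> \<one>" using cR by algebra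
    also have "c \<otimes> c \<otimes> c = \<one>" using ci[of 3] cR by (simp add: numeral_3_eq_3)
    finally show ?thesis using integral[of "c \<ominus> \<one>" "\<one> \<oplus> c \<oplus> c \<otimes> c"] cR c1 by auto
  qed
  have "norm_free (inv z)"
  proof (rule norm_free_invI[OF zR])
    show "z \<noteq> \<zero>" using t by (simp add: z_def)
    fix r :: nat assume r: "prime r" "r dvd norm_index"
    then have "r = 3 \<or> r = 7" using prime_dvd_prod_list_primes[of r "[3, 7]"] by (simp add: M)
    then show "(\<exists>s. norm_index = r * s \<and> (z [^] s) [^] q \<noteq> z [^] s) \<or>
      (\<exists>s. q - 1 = r * s \<and> (z [^] norm_index) [^] s \<noteq> \<one>)"
    proof
      assume r3: "r = 3"
      \<comment> \<open>As \<open>21 = 1 + 4 + 16\<close>, this power is the product of all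
        conjugates of \<open>z\<close>.\<close>
      have "z [^] (21::nat) = z [^] (q ^ 0) \<otimes> z [^] (q ^ 1) \<otimes> z [^] (q ^ 2)"
        using zR nat_pow_mult[of z 1 4] nat_pow_mult[of z 5 16] by (simp add: nq)
      also have "\<dots> = (t \<ominus> \<one>) \<otimes> (c \<otimes> t \<ominus> \<one>) \<otimes> (c \<otimes> c \<otimes> t \<ominus> \<one>)"
        unfolding z_def conj using t cR by (simp add: numeral_2_eq_2)
      also have "\<dots> = t \<otimes> t \<otimes> t \<ominus> \<one>" by (rule cyclotomic_three_product[OF t(1) cR e])
      also have "t \<otimes> t \<otimes> t = c" using t nq by (simp add: numeral_3_eq_3)
      finally have zM: "z [^] norm_index = c \<ominus> \<one>" by (simp add: M)
      have "c \<ominus> \<one> \<noteq> \<one>"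
      proof
        assume "c \<ominus> \<one> = \<one>"
        then have "(c \<ominus> \<one>) \<oplus> \<one> = \<one> \<oplus> \<one>" by simp
        moreover have "(c \<ominus> \<one>) \<oplus> \<one> = c" using cR by algebra
        moreover have "\<one> \<oplus> \<one> = \<zero>" using char_p unfolding p2[symmetric] by (simp add: numeral_2_eq_2)
        ultimately show False using ci[of 1] cR c1 e by auto
      qed
      then show ?thesis using r3 zM cR by (intro disjI2 exI[of _ 1]) (simp add: nq)
    next
      assume r7: "r = 7"
      have "(z [^] (3::nat)) [^] q = (z [^] (q ^ 1)) [^] (3::nat)" using zR by (simp add: nat_pow_pow mult.commute)
      also have "\<dots> = (c \<otimes> t \<ominus> \<one>) [^] (3::nat)" unfolding z_def conj using cR t by simp
      finally have "(z [^] (3::nat)) [^] q \<noteq> z [^] (3::nat)"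
        using cyclotomic_three_not_frob_eq[OF t(1,3) tq cR c1 cq e] by (simp add: z_def)
      then show ?thesis using r7 by (intro disjI1 exI[of _ 3]) (simp add: M)
    qed
  qed
  then show ?thesis using pcn_exists_kummer[OF _ _ root t(1,2)] nq by (simp add: z_def)
qed

lemma pcn_exists_4_5:
  assumes nq: "n = 4" "q = 5"
  shows pcn_exists
proof -
  have p5: "5 = p" by (rule prime_dvd_q_eq) (simp_all add: nq)
  have M: "norm_index = 156" using norm_index_def by (simp add: nq)
  have "[(2::nat)] \<cdot> \<one> \<noteq> \<zero>" by (rule nat_one_nonzero_of_not_dvd) (simp add: p5[symmetric])
  then have two: "\<one> \<oplus> \<one> \<noteq> \<zero>" by (simp add: numeral_2_eq_2)
  have five: "\<one> \<oplus> \<one> \<oplus> \<one> \<oplus> \<one> \<oplus> \<one> = \<zero>" using char_p unfolding p5[symmetric] by (simp add: numeral_eq_Suc)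
  have mone: "\<ominus> \<one> \<noteq> \<one>"
  proof
    assume m: "\<ominus> \<one> = \<one>"
    have "\<one> \<oplus> \<one> = \<one> \<oplus> (\<ominus> \<one>)" by (simp only: m)
    then show False using two by (simp add: r_neg)
  qed
  \<comment> \<open>\<open>- 2\<close> has order 4 modulo 5, since its square is
    \<open>- 1\<close>.\<close>
  define c where "c = \<ominus> (\<one> \<oplus> \<one>)"
  have cR: "c \<in> carrier R" by (simp add: c_def)
  have cc: "c \<otimes> c = \<ominus> \<one>"
  proof -
    have "c \<otimes> c = (\<one> \<oplus> \<one> \<oplus> \<one> \<oplus> \<one> \<oplus> \<one>) \<ominus> \<one>" unfolding c_def by algebra
    then show ?thesis unfolding five by (simp add: minus_eq)
  qed
  have cpow: "c [^] (2::nat) = \<ominus> \<one>" "c [^] (3::nat) = \<ominus> c" "c [^] (4::nat) = \<one>"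
    using cR cc by (simp_all add: numeral_eq_Suc l_minus r_minus)
  have root: "root_of_unity n c"
    unfolding root_of_unity_def nq(1)
  proof (intro conjI allI impI notI)
    fix i :: nat assume i: "0 < i \<and> i < 4" and ci: "c [^] i = \<one>"
    have c1: "c \<noteq> \<one>" using cc mone by auto
    have "c [^] (3::nat) \<noteq> \<one>"
    proof
      assume "c [^] (3::nat) = \<one>"
      then have "\<ominus> c \<otimes> c = c" using cpow(2) cR by simp
      then show False using cc c1 cR by (simp add: l_minus)
    qed
    moreover have "i = 1 \<or> i = 2 \<or> i = 3" using i by auto
    ultimately show False using ci c1 cpow mone cR by auto
  qed (use cR cpow in auto)
  obtain t where t: "t \<in> carrier R" "t [^] n = c" "t \<noteq> \<zero>" "t \<ominus> \<one> \<noteq> \<zero>"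
    and conj: "\<And>i. (t \<ominus> \<one>) [^] (q ^ i) = c [^] i \<otimes> t \<ominus> \<one>"
    using kummer_data[of c] root M nq by auto
  define z where "z = t \<ominus> \<one>"
  define z1 where "z1 = c \<otimes> t \<ominus> \<one>"
  define z2 where "z2 = \<ominus> t \<ominus> \<one>"
  define z3 where "z3 = \<ominus> (c \<otimes> t) \<ominus> \<one>"
  have zR: "z \<in> carrier R" "z1 \<in> carrier R" "z2 \<in> carrier R" "z3 \<in> carrier R"
    using t cR by (auto simp: z_def z1_def z2_def z3_def)
  have z0: "z \<noteq> \<zero>" using t by (simp add: z_def)
  have zpow: "z [^] (5::nat) = z1" "z [^] (25::nat) = z2" "z [^] (125::nat) = z3"
    using conj[of 1] conj[of 2] conj[of 3] cR t cpow unfolding z_def z1_def z2_def z3_def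
    by (simp_all add: nq l_minus)
  have z10: "z1 \<noteq> \<zero>" using zpow(1) z0 zR nat_pow_eq_zero_iff by blast
  define u where "u = t \<otimes> t"
  have uR: "u \<in> carrier R" "u \<noteq> \<zero>" using t integral by (auto simp: u_def)
  have uu: "u \<otimes> u = c" using t by (simp add: u_def nq numeral_eq_Suc m_assoc)
  have z02: "z \<otimes> z2 = \<one> \<ominus> u" unfolding z_def z2_def u_def using t by algebra
  have z13: "z1 \<otimes> z3 = \<one> \<oplus> u"
  proof -
    have "z1 \<otimes> z3 = \<one> \<ominus> (c \<otimes> c) \<otimes> u" unfolding z1_def z3_def u_def using t cR by algebra
    then show ?thesis unfolding cc using uR by (simp add: minus_eq l_minus)
  qed
  have dbl: "x \<oplus> x \<noteq> \<zero>" if "x \<in> carrier R" "x \<noteq> \<zero>" for x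
  proof -
    have "x \<oplus> x = (\<one> \<oplus> \<one>) \<otimes> x" using that by algebra
    then show ?thesis using integral[of "\<one> \<oplus> \<one>" x] two that by auto
  qed
  have "norm_free (inv z)"
  proof (rule norm_free_invI[OF zR(1) z0])
    fix r :: nat assume r: "prime r" "r dvd norm_index"
    then have "r = 2 \<or> r = 3 \<or> r = 13" using prime_dvd_prod_list_primes[of r "[2, 2, 3, 13]"] by (simp add: M)
    then show "(\<exists>s. norm_index = r * s \<and> (z [^] s) [^] q \<noteq> z [^] s) \<or>
      (\<exists>s. q - 1 = r * s \<and> (z [^] norm_index) [^] s \<noteq> \<one>)"
    proof (elim disjE)
      assume r2: "r = 2"
      have "z [^] (156::nat) = z \<otimes> z [^] (5::nat) \<otimes> z [^] (25::nat) \<otimes> z [^] (125::nat)"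
        using zR nat_pow_mult[of z 1 5] nat_pow_mult[of z 6 25] nat_pow_mult[of z 31 125] by simp
      also have "\<dots> = (z \<otimes> z2) \<otimes> (z1 \<otimes> z3)" unfolding zpow using zR by (simp add: m_ac)
      also have "\<dots> = \<one> \<ominus> u \<otimes> u" unfolding z02 z13 using uR by algebra
      also have "\<dots> = \<one> \<oplus> \<one> \<oplus> \<one>" unfolding uu c_def by algebra
      finally have zM: "z [^] norm_index = \<one> \<oplus> \<one> \<oplus> \<one>" by (simp add: M)
      have "(\<one> \<oplus> \<one> \<oplus> \<one>) \<otimes> (\<one> \<oplus> \<one> \<oplus> \<one>) = (\<one> \<oplus> \<one> \<oplus> \<one> \<oplus> \<one> \<oplus> \<one>) \<oplus> (\<one> \<oplus> \<one> \<oplus> \<one> \<oplus> \<one> \<oplus> \<one>) \<ominus> \<one>" by algebra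
      also have "\<dots> = \<ominus> \<one>" unfolding five by (simp add: minus_eq)
      finally have "(z [^] norm_index) [^] (2::nat) \<noteq> \<one>" unfolding zM using mone by (simp add: numeral_2_eq_2)
      then show ?thesis using r2 by (intro disjI2 exI[of _ 2]) (simp add: nq)
    next
      assume r3: "r = 3"
      \<comment> \<open>\<open>156 / 3 = 52 = 2 + 2 * 25\<close>. The base 5 digits express the
        power through conjugates of \<open>z\<close>, and the \<open>q\<close>-th power map shifts
        these.\<close>
      have "z [^] (52::nat) = (z \<otimes> z2) [^] (2::nat)"
        using zR zpow(2)[symmetric] by (simp add: nat_pow_distrib nat_pow_pow nat_pow_mult)
      moreover have "(z [^] (52::nat)) [^] q = (z1 \<otimes> z3) [^] (2::nat)"
        using zR zpow(1,3)[symmetric] by (simp add: nq nat_pow_distrib nat_pow_pow nat_pow_mult)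
      moreover have "(z1 \<otimes> z3) [^] (2::nat) \<noteq> (z \<otimes> z2) [^] (2::nat)"
      proof
        assume "(z1 \<otimes> z3) [^] (2::nat) = (z \<otimes> z2) [^] (2::nat)"
        then have "(\<one> \<oplus> u) \<ominus> (\<one> \<ominus> u) = \<zero> \<or> (\<one> \<oplus> u) \<oplus> (\<one> \<ominus> u) = \<zero>"
          unfolding z02 z13 using uR by (intro squares_eq_imp) auto
        moreover have "(\<one> \<oplus> u) \<ominus> (\<one> \<ominus> u) = u \<oplus> u" "(\<one> \<oplus> u) \<oplus> (\<one> \<ominus> u) = \<one> \<oplus> \<one>"
          using uR(1) by algebra+
        ultimately show False using dbl uR two by auto
      qed
      ultimately show ?thesis using r3 by (intro disjI1 exI[of _ 52]) (simp add: M)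
    next
      assume r13: "r = 13"
      \<comment> \<open>\<open>156 / 13 = 12 = 2 + 2 * 5\<close>; after applying the
        \<open>q\<close>-th power map, the factor from \<open>z1\<close> is common to both
        sides.\<close>
      have "z [^] (12::nat) = z1 [^] (2::nat) \<otimes> z [^] (2::nat)"
        using zR zpow(1)[symmetric] by (simp add: nat_pow_pow nat_pow_mult)
      moreover have "(z [^] (12::nat)) [^] q = z1 [^] (2::nat) \<otimes> z2 [^] (2::nat)"
        using zR zpow(1,2)[symmetric] by (simp add: nq nat_pow_pow nat_pow_mult)
      moreover have "z2 [^] (2::nat) \<noteq> z [^] (2::nat)"
      proof
        assume "z2 [^] (2::nat) = z [^] (2::nat)"
        then have "z2 \<ominus> z = \<zero> \<or> z2 \<oplus> z = \<zero>" using zR by (intro squares_eq_imp) auto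
        moreover have "z2 \<ominus> z = \<ominus> (t \<oplus> t)" "z2 \<oplus> z = \<ominus> (\<one> \<oplus> \<one>)"
          unfolding z_def z2_def using t(1) by algebra+
        ultimately show False using dbl[OF t(1,3)] two t(1) by auto
      qed
      moreover have "z1 [^] (2::nat) \<noteq> \<zero>" using z10 zR nat_pow_eq_zero_iff by blast
      ultimately have "(z [^] (12::nat)) [^] q \<noteq> z [^] (12::nat)" using zR by (simp add: m_lcancel)
      then show ?thesis using r13 by (intro disjI1 exI[of _ 12]) (simp add: M)
    qed
  qed
  then show ?thesis using pcn_exists_kummer[OF _ _ root t(1,2)] nq by (simp add: z_def)
qed

lemma pcn_exists_6_7:
  assumes nq: "n = 6" "q = 7"
  shows pcn_exists
proof -
  have p7: "7 = p" by (rule prime_dvd_q_eq) (simp_all add: nq)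
  have M: "norm_index = 19608" using norm_index_def by (simp add: nq)
  have "[(2::nat)] \<cdot> \<one> \<noteq> \<zero>" "[(4::nat)] \<cdot> \<one> \<noteq> \<zero>"
    by (rule nat_one_nonzero_of_not_dvd; simp add: p7[symmetric])+
  then have two: "\<one> \<oplus> \<one> \<noteq> \<zero>" and four: "\<one> \<oplus> \<one> \<oplus> \<one> \<oplus> \<one> \<noteq> \<zero>"
    by (simp_all add: numeral_eq_Suc)
  have seven: "\<one> \<oplus> \<one> \<oplus> \<one> \<oplus> \<one> \<oplus> \<one> \<oplus> \<one> \<oplus> \<one> = \<zero>"
    using char_p unfolding p7[symmetric] by (simp add: numeral_eq_Suc)
  have mone: "\<ominus> \<one> \<noteq> \<one>"
  proof
    assume m: "\<ominus> \<one> = \<one>"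
    have "\<one> \<oplus> \<one> = \<one> \<oplus> (\<ominus> \<one>)" by (simp only: m)
    then show False using two by (simp add: r_neg)
  qed
  \<comment> \<open>\<open>3\<close> is a primitive root modulo 7, and its square
    \<open>w = 2\<close> is a primitive cube root of unity.\<close>
  define c where "c = \<one> \<oplus> \<one> \<oplus> \<one>"
  define w where "w = \<one> \<oplus> \<one>"
  have cR: "c \<in> carrier R" "w \<in> carrier R" by (simp_all add: c_def w_def)
  have cc: "c \<otimes> c = w"
  proof -
    have "c \<otimes> c = (\<one> \<oplus> \<one> \<oplus> \<one> \<oplus> \<one> \<oplus> \<one> \<oplus> \<one> \<oplus> \<one>) \<oplus> w" unfolding c_def w_def by algebra
    then show ?thesis unfolding seven using cR by simp
  qed
  have cw: "c \<otimes> w = \<ominus> \<one>"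
  proof -
    have "c \<otimes> w = (\<one> \<oplus> \<one> \<oplus> \<one> \<oplus> \<one> \<oplus> \<one> \<oplus> \<one> \<oplus> \<one>) \<ominus> \<one>" unfolding c_def w_def by algebra
    then show ?thesis unfolding seven by (simp add: minus_eq)
  qed
  have e: "\<one> \<oplus> w \<oplus> w \<otimes> w = \<zero>"
  proof -
    have "\<one> \<oplus> w \<oplus> w \<otimes> w = \<one> \<oplus> \<one> \<oplus> \<one> \<oplus> \<one> \<oplus> \<one> \<oplus> \<one> \<oplus> \<one>" unfolding w_def by algebra
    then show ?thesis unfolding seven .
  qed
  have w1: "w \<noteq> \<one>"
  proof
    assume "w = \<one>"
    then have "w \<ominus> \<one> = \<zero>" by simp
    moreover have "w \<ominus> \<one> = \<one>" unfolding w_def by algebra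
    ultimately show False by simp
  qed
  have www: "w \<otimes> (w \<otimes> w) = \<one>" by (rule cyclotomic_three(1)[OF cR(2) e])
  have cm1: "c \<noteq> \<ominus> \<one>"
  proof
    assume "c = \<ominus> \<one>"
    then have "c \<oplus> \<one> = \<zero>" by (simp add: l_neg)
    then show False using four by (simp add: c_def)
  qed
  have c1: "c \<noteq> \<one>" using cc w1 by auto
  have wm1: "w \<noteq> \<ominus> \<one>"
  proof
    assume "w = \<ominus> \<one>"
    then have "c \<otimes> \<ominus> \<one> = \<ominus> \<one>" using cw by simp
    then have "\<ominus> (\<ominus> c) = \<ominus> (\<ominus> \<one>)" using cR by (simp add: r_minus)
    then have "c = \<one>" using cR by simp
    then show False using c1 by simp
  qed
  have cpow: "c [^] (2::nat) = w" "c [^] (3::nat) = \<ominus> \<one>" "c [^] (4::nat) = \<ominus> c" "c [^] (5::nat) = \<ominus> w"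
    "c [^] (6::nat) = \<one>"
  proof -
    show 2: "c [^] (2::nat) = w" using cR cc by (simp add: numeral_2_eq_2)
    show 3: "c [^] (3::nat) = \<ominus> \<one>" using cR cc cw m_comm[of w c] by (simp add: numeral_3_eq_3)
    show "c [^] (4::nat) = \<ominus> c" using nat_pow_mult[OF cR(1), of 3 1] 3 cR by (simp add: l_minus)
    show "c [^] (5::nat) = \<ominus> w" using nat_pow_mult[OF cR(1), of 3 2] 2 3 cR by (simp add: l_minus)
    show "c [^] (6::nat) = \<one>" using nat_pow_mult[OF cR(1), of 3 3] 3 by (simp add: l_minus)
  qed
  have root: "root_of_unity n c"
    unfolding root_of_unity_def nq(1)
  proof (intro conjI allI impI notI)
    fix i :: nat assume i: "0 < i \<and> i < 6" and ci: "c [^] i = \<one>"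
    have "\<ominus> c \<noteq> \<one>" "\<ominus> w \<noteq> \<one>" using cm1 wm1 cR by (metis minus_minus)+
    moreover have "i = 1 \<or> i = 2 \<or> i = 3 \<or> i = 4 \<or> i = 5" using i by auto
    ultimately show False using ci c1 w1 cpow mone cR by auto
  qed (use cR cpow in auto)
  obtain t where t: "t \<in> carrier R" "t [^] n = c" "t \<noteq> \<zero>" "t \<ominus> \<one> \<noteq> \<zero>"
    and tq: "t [^] q = c \<otimes> t" and cq: "c [^] q = c" and conj: "\<And>i. (t \<ominus> \<one>) [^] (q ^ i) = c [^] i \<otimes> t \<ominus> \<one>"
    using kummer_data[of c] root M nq by auto
  define u where "u = t \<otimes> t"
  have uR: "u \<in> carrier R" "u \<noteq> \<zero>" using t integral by (auto simp: u_def)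
  have uq: "u [^] q = w \<otimes> u"
    using t(1) cR unfolding u_def cc[symmetric] by (simp add: nat_pow_distrib tq m_ac)
  have wq: "w [^] q = w" using cq cR unfolding cc[symmetric] by (simp add: nat_pow_distrib)
  have uuu: "u \<otimes> u \<otimes> u = c" using t by (simp add: u_def nq numeral_eq_Suc m_assoc)
  define z where "z = t \<ominus> \<one>"
  define z1 where "z1 = c \<otimes> t \<ominus> \<one>"
  define z2 where "z2 = w \<otimes> t \<ominus> \<one>"
  define z3 where "z3 = \<ominus> t \<ominus> \<one>"
  define z4 where "z4 = \<ominus> (c \<otimes> t) \<ominus> \<one>"
  define z5 where "z5 = \<ominus> (w \<otimes> t) \<ominus> \<one>"
  have zR: "z \<in> carrier R" "z1 \<in> carrier R" "z2 \<in> carrier R" "z3 \<in> carrier R" "z4 \<in> carrier R" "z5 \<in> carrier R"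
    using t cR by (auto simp: z_def z1_def z2_def z3_def z4_def z5_def)
  have z0: "z \<noteq> \<zero>" using t by (simp add: z_def)
  have zpow: "z [^] (7::nat) = z1" "z [^] (49::nat) = z2" "z [^] (343::nat) = z3"
    "z [^] (2401::nat) = z4" "z [^] (16807::nat) = z5"
    using conj[of 1] conj[of 2] conj[of 3] conj[of 4] conj[of 5] cR t cpow
    unfolding z_def z1_def z2_def z3_def z4_def z5_def
    by (simp_all add: nq l_minus)
  have zn0: "z1 \<noteq> \<zero>" "z2 \<noteq> \<zero>" "z3 \<noteq> \<zero>"
    using zpow z0 zR nat_pow_eq_zero_iff by blast+
  have z03: "z \<otimes> z3 = \<ominus> (u \<ominus> \<one>)" unfolding z_def z3_def u_def using t(1) by algebra
  have z14: "z1 \<otimes> z4 = \<ominus> (w \<otimes> u \<ominus> \<one>)"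
    unfolding z1_def z4_def u_def cc[symmetric] using t(1) cR(1) by algebra
  have z25: "z2 \<otimes> z5 = \<ominus> (w \<otimes> w \<otimes> u \<ominus> \<one>)"
    unfolding z2_def z5_def u_def using t(1) cR(2) by algebra
  have "norm_free (inv z)"
  proof (rule norm_free_invI[OF zR(1) z0])
    fix r :: nat assume r: "prime r" "r dvd norm_index"
    then have "r = 2 \<or> r = 3 \<or> r = 19 \<or> r = 43"
      using prime_dvd_prod_list_primes[of r "[2, 2, 2, 3, 19, 43]"] by (simp add: M)
    moreover have zM: "z [^] norm_index = \<ominus> w"
    proof -
      have "z [^] (19608::nat) = z \<otimes> z [^] (7::nat) \<otimes> z [^] (49::nat) \<otimes> z [^] (343::nat)
          \<otimes> z [^] (2401::nat) \<otimes> z [^] (16807::nat)"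
        using zR nat_pow_mult[of z 1 7] nat_pow_mult[of z 8 49] nat_pow_mult[of z 57 343]
          nat_pow_mult[of z 400 2401] nat_pow_mult[of z 2801 16807] by simp
      also have "\<dots> = (z \<otimes> z3) \<otimes> (z1 \<otimes> z4) \<otimes> (z2 \<otimes> z5)" unfolding zpow using zR by (simp add: m_ac)
      also have "\<dots> = \<ominus> ((u \<ominus> \<one>) \<otimes> (w \<otimes> u \<ominus> \<one>) \<otimes> (w \<otimes> w \<otimes> u \<ominus> \<one>))"
        unfolding z03 z14 z25 using uR cR by (simp add: l_minus r_minus)
      also have "\<dots> = \<ominus> (c \<ominus> \<one>)" unfolding cyclotomic_three_product[OF uR(1) cR(2) e] uuu ..
      also have "\<dots> = \<ominus> w" unfolding c_def w_def by algebra
      finally show ?thesis by (simp add: M)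
    qed
    ultimately show "(\<exists>s. norm_index = r * s \<and> (z [^] s) [^] q \<noteq> z [^] s) \<or>
      (\<exists>s. q - 1 = r * s \<and> (z [^] norm_index) [^] s \<noteq> \<one>)"
    proof (elim disjE)
      assume r2: "r = 2"
      have "(\<ominus> w) [^] (3::nat) = \<ominus> \<one>" using cR www by (simp add: numeral_3_eq_3 l_minus r_minus m_assoc)
      then show ?thesis using r2 mone unfolding zM by (intro disjI2 exI[of _ 3]) (simp add: nq)
    next
      assume r3: "r = 3"
      have "(\<ominus> w) [^] (2::nat) = w \<otimes> w" using cR by (simp add: numeral_2_eq_2 l_minus r_minus)
      moreover have "w \<otimes> w \<noteq> \<one>" using www w1 cR by auto
      ultimately show ?thesis using r3 unfolding zM by (intro disjI2 exI[of _ 2]) (simp add: nq)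
    next
      assume r19: "r = 19"
      have cube: "(\<ominus> x) [^] (3::nat) = \<ominus> (x [^] (3::nat))" if "x \<in> carrier R" for x
        using that by (simp add: numeral_3_eq_3 l_minus r_minus)
      \<comment> \<open>\<open>19608 / 19 = 1032 = 3 + 3 * 343\<close>, so only the product
        \<open>z \<otimes> z3\<close>, a polynomial in \<open>u\<close>, is involved.\<close>
      have "z [^] (1032::nat) = (z \<otimes> z3) [^] (3::nat)"
        using zR zpow(3)[symmetric] by (simp add: nat_pow_distrib nat_pow_pow nat_pow_mult)
      also have "\<dots> = \<ominus> ((u \<ominus> \<one>) [^] (3::nat))" unfolding z03 using uR by (intro cube) auto
      finally have 1: "z [^] (1032::nat) = \<ominus> ((u \<ominus> \<one>) [^] (3::nat))" .
      have "(z [^] (1032::nat)) [^] q = (z1 \<otimes> z4) [^] (3::nat)"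
        using zR zpow(1,4)[symmetric] by (simp add: nq nat_pow_distrib nat_pow_pow nat_pow_mult)
      also have "\<dots> = \<ominus> ((w \<otimes> u \<ominus> \<one>) [^] (3::nat))" unfolding z14 using uR cR by (intro cube) auto
      finally have "(z [^] (1032::nat)) [^] q \<noteq> z [^] (1032::nat)"
        unfolding 1 using cyclotomic_three_not_frob_eq[OF uR uq cR(2) w1 wq e] uR cR
        by (metis minus_minus nat_pow_closed minus_closed m_closed one_closed)
      then show ?thesis using r19 by (intro disjI1 exI[of _ 1032]) (simp add: M)
    next
      assume r43: "r = 43"
      \<comment> \<open>\<open>19608 / 43 = 456\<close> has base 7 digits 1, 2, 2, 1.
        \<open>y\<close> is the common factor of this power and its image under the
        \<open>q\<close>-th power map; the remaining factors differ by
        \<open>2 * (c + 1) * t\<close>.\<close>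
      define y where "y = z1 \<otimes> z2 [^] (2::nat) \<otimes> z3"
      have y: "y \<in> carrier R" "y \<noteq> \<zero>"
        using zR zn0 nat_pow_eq_zero_iff[of z2 2] unfolding y_def by (auto simp: integral_iff)
      have "z [^] (456::nat) = z \<otimes> z [^] (14::nat) \<otimes> z [^] (98::nat) \<otimes> z [^] (343::nat)"
        using zR nat_pow_mult[of z 1 14] nat_pow_mult[of z 15 98] nat_pow_mult[of z 113 343] by simp
      also have "z [^] (14::nat) = z1 [^] (2::nat)" using zR zpow(1)[symmetric] by (simp add: nat_pow_pow)
      also have "z [^] (98::nat) = z2 [^] (2::nat)" using zR zpow(2)[symmetric] by (simp add: nat_pow_pow)
      also have "z \<otimes> z1 [^] (2::nat) \<otimes> z2 [^] (2::nat) \<otimes> z [^] (343::nat) = y \<otimes> (z \<otimes> z1)"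
        unfolding zpow y_def using zR by (simp add: numeral_2_eq_2 m_ac)
      finally have 1: "z [^] (456::nat) = y \<otimes> (z \<otimes> z1)" .
      have "(z [^] (456::nat)) [^] q = z [^] (7::nat) \<otimes> z [^] (98::nat) \<otimes> z [^] (686::nat) \<otimes> z [^] (2401::nat)"
        using zR nat_pow_mult[of z 7 98] nat_pow_mult[of z 105 686] nat_pow_mult[of z 791 2401]
        by (simp add: nq nat_pow_pow)
      also have "z [^] (98::nat) = z2 [^] (2::nat)" using zR zpow(2)[symmetric] by (simp add: nat_pow_pow)
      also have "z [^] (686::nat) = z3 [^] (2::nat)" using zR zpow(3)[symmetric] by (simp add: nat_pow_pow)
      also have "z [^] (7::nat) \<otimes> z2 [^] (2::nat) \<otimes> z3 [^] (2::nat) \<otimes> z [^] (2401::nat) = y \<otimes> (z3 \<otimes> z4)"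
        unfolding zpow y_def using zR by (simp add: numeral_2_eq_2 m_ac)
      finally have 2: "(z [^] (456::nat)) [^] q = y \<otimes> (z3 \<otimes> z4)" .
      have "z3 \<otimes> z4 \<noteq> z \<otimes> z1"
      proof
        assume eq: "z3 \<otimes> z4 = z \<otimes> z1"
        have "(\<one> \<oplus> \<one>) \<otimes> ((c \<oplus> \<one>) \<otimes> t) = z3 \<otimes> z4 \<ominus> z \<otimes> z1"
          unfolding z_def z1_def z3_def z4_def using t(1) cR(1) by algebra
        then have "(\<one> \<oplus> \<one>) \<otimes> ((c \<oplus> \<one>) \<otimes> t) = \<zero>" unfolding eq using zR by simp
        moreover have "c \<oplus> \<one> \<noteq> \<zero>" using four by (simp add: c_def)
        ultimately show False
          using two t(1,3) cR(1) integral[of "\<one> \<oplus> \<one>" "(c \<oplus> \<one>) \<otimes> t"] integral[of "c \<oplus> \<one>" t] by auto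
      qed
      then have "(z [^] (456::nat)) [^] q \<noteq> z [^] (456::nat)" unfolding 2 unfolding 1 using y zR by (simp add: m_lcancel)
      then show ?thesis using r43 by (intro disjI1 exI[of _ 456]) (simp add: M)
    qed
  qed
  then show ?thesis using pcn_exists_kummer[OF _ _ root t(1,2)] nq by (simp add: z_def)
qed

lemma pcn_exists_of_degree_le:
  assumes "q \<ge> n"
  shows pcn_exists
proof -
  consider "n = 1" | "n = 2" | "n \<ge> 13" | "(n, q) \<in> {(3, 4), (4, 5), (6, 7)}"
    | "n \<ge> 3" "n \<le> 12" "(n, q) \<notin> {(3, 4), (4, 5), (6, 7)}"
    using n_pos by linarith
  then show ?thesis
  proof cases
    case 4
    then show ?thesis using pcn_exists_3_4 pcn_exists_4_5 pcn_exists_6_7 by auto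
  qed (use assms pcn_exists_degree_1 pcn_exists_degree_2 pcn_exists_degree_ge_13 pcn_exists_degree_le_12 in blast)+
qed

end

theorem theorem1p3:
  fixes R :: "('a, 'b) ring_scheme" and q n :: nat
  assumes "n > 0"
    and "primepow q"
    and "q \<ge> n"
    and "field R"
    and "order R = q ^ n"
  shows "\<exists>x \<in> carrier R. primitive_element R x \<and> completely_normal_element R q n x"
proof -
  obtain p e where pe: "prime p" "e > 0" "q = p ^ e" using assms(2) by (auto simp: primepow_def)
  interpret F: finite_field_ext R q n p e
    using assms pe by (intro finite_field_ext.intro finite_field_ext_axioms.intro) auto
  show ?thesis using F.pcn_exists_of_degree_le[OF assms(3)] by (simp add: F.pcn_exists_def)
qed

end
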